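(* There exist a class of maps $\mathbb{F}=\{\mathbb{T}_\alpha:\mathbb{M}_\alpha\to\mathbb{M}_\alpha\}_{\alpha\in\mathbb{R}\setminus\mathbb{Q}}$ and a renormalisation operator $\mathcal{R}_m:\mathbb{F}\to\mathbb{F}$, namely those constructed in the context, satisfying the following properties: (i) for every $\alpha\in\mathbb{R}\setminus\mathbb{Q}$, $\mathbb{M}_\alpha\subset\mathbb{C}$ is a compact set which is star-like about $0$, with $\{0,+1\}\subset\mathbb{M}_\alpha$; (ii) for every $\alpha\in\mathbb{R}\setminus\mathbb{Q}$, $\mathbb{T}_\alpha:\mathbb{M}_\alpha\to\mathbb{M}_\alpha$ is a homeomorphism which acts as rotation by $2\pi\alpha$ in the tangential direction; (iii) for every $\alpha\in(-1/2,1/2)\setminus\mathbb{Q}$, $\mathcal{R}_m(\mathbb{T}_\alpha:\mathbb{M}_\alpha\to\mathbb{M}_\alpha)=(\mathbb{T}_{-1/\alpha}:\mathbb{M}_{-1/\alpha}\to\mathbb{M}_{-1/\alpha})$; (iv) there is a constant $C$, independent of $k$ and $\alpha$, such that for every $\alpha\in\mathbb{R}\setminus\mathbb{Q}$ and every integer $k$ with $0\le k\le 1/|\alpha|$, $$\frac{C^{-1}}{1+\min\{k,|\alpha|^{-1}-k\}}\le|\mathbb{T}_\alpha^{\circ k}(+1)|\le\frac{C}{1+\min\{k,|\alpha|^{-1}-k\}};$$ (v) for every $\alpha\in\mathbb{R}\setminus\mathbb{Q}$, $\mathbb{M}_{\alpha+1}=\mathbb{M}_\alpha$, $\mathbb{T}_{\alpha+1}=\mathbb{T}_\alpha$,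 $\mathbb{M}_{-\alpha}=s(\mathbb{M}_\alpha)$ and $\mathbb{T}_{-\alpha}=s\circ\mathbb{T}_\alpha\circ s$, where $s(w)=\overline{w}$ is complex conjugation; (vi) $\mathbb{M}_\alpha$ depends continuously on $\alpha\in\mathbb{R}\setminus\mathbb{Q}$, in the Hausdorff topology.
   Context: Throughout $s(w)=\overline{w}$. A set $M\subseteq\mathbb{C}$ is star-like about $0$ if $rz\in M$ for all $z\in M$, $r\in[0,1]$. "$\mathbb{T}_\alpha$ acts as rotation by $2\pi\alpha$ in the tangential direction" means that there is a function $g_\alpha\ge 0$ with $\mathbb{T}_\alpha(re^{2\pi i\theta})=g_\alpha(r,\theta)e^{2\pi i(\theta+\alpha)}$ for every $re^{2\pi i\theta}\in\mathbb{M}_\alpha$. Continued fraction. Let $d(x,\mathbb{Z})=\min_{k\in\mathbb{Z}}|x-k|$. For irrational $\alpha$ set $\alpha_0=d(\alpha,\mathbb{Z})$, $\alpha_{n+1}=d(1/\alpha_n,\mathbb{Z})$ for $n\ge0$ (so $\alpha_n\in(0,1/2)$), and let $a_n\in\mathbb{Z}$ ($n\ge-1$), $\varepsilon_n\in\{+1,-1\}$ ($n\ge0$) be the unique numbers with $\alpha=a_{-1}+\varepsilon_0\alpha_0$, $1/\alpha_n=a_n+\varepsilon_{n+1}\alpha_{n+1}$. Put $\alpha_{-1}=1$. Changes of coordinates. Let $\mathbb{H}'=\{w\in\mathbb{C}:\operatorname{Im}w>-1\}$. For $r\in(0,1/2]$ and $w\in\overline{\mathbb{H}'}$ let $$Y_r(w)=r\operatorname{Re}w+\frac{i}{2\pi}\log\left|\frac{e^{-3\pi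 r}-e^{-\pi ri}e^{-2\pi riw}}{e^{-3\pi r}-e^{\pi ri}}\right|.$$ Let $\mathbb{Y}_n=Y_{\alpha_n}$ if $\varepsilon_n=-1$ and $\mathbb{Y}_n=-s\circ Y_{\alpha_n}$ if $\varepsilon_n=+1$. The sets. For $n\ge0$ let $I_n^0=\{w\in\overline{\mathbb{H}'}:\operatorname{Re}w\in[0,1/\alpha_n]\}$. For all $n,j\ge0$ let $J_n^j=\{w\in I_n^j:\operatorname{Re}w\in[1/\alpha_n-1,1/\alpha_n]\}$, $K_n^j=\{w\in I_n^j:\operatorname{Re}w\in[0,1/\alpha_n-1]\}$, and inductively $I_n^{j+1}=\bigcup_{l=0}^{a_n-2}(\mathbb{Y}_{n+1}(I_{n+1}^j)+l)\cup(\mathbb{Y}_{n+1}(K_{n+1}^j)+a_n-1)$ if $\varepsilon_{n+1}=-1$, $I_n^{j+1}=\bigcup_{l=1}^{a_n}(\mathbb{Y}_{n+1}(I_{n+1}^j)+l)\cup(\mathbb{Y}_{n+1}(J_{n+1}^j)+a_n+1)$ if $\varepsilon_{n+1}=+1$. Let $I_{-1}^j=\mathbb{Y}_0(I_0^{j-1})+(\varepsilon_0+1)/2$ for $j\ge1$. For $n\ge-1$, $I_n=\bigcap_{j\ge1}I_n^j$, and for $n\ge0$, $K_n=\bigcap_{j\ge1}K_n^j$. Define $\mathbb{M}_\alpha=\{s(e^{2\pi iw}):w\in I_{-1}\}\cup\{0\}$. The map $\mathbb{T}_\alpha$. The trajectory of $w_{-1}\in I_{-1}$ is the sequence $(w_i;l_i)_{i\ge-1}$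 with $w_i\in I_i$, $l_i\in\mathbb{Z}$, determined inductively by $0\le\operatorname{Re}(w_i-l_i)<1$ if $\varepsilon_{i+1}=-1$, $-1<\operatorname{Re}(w_i-l_i)\le0$ if $\varepsilon_{i+1}=+1$, and $\mathbb{Y}_{i+1}(w_{i+1})+l_i=w_i$. Write $X_0^n=(\mathbb{Y}_0+\frac{\varepsilon_0+1}{2})\circ\cdots\circ(\mathbb{Y}_n+\frac{\varepsilon_n+1}{2})$. Define $\tilde T_\alpha:I_{-1}\to I_{-1}$ by: if there is $n\ge0$ with $w_n\in K_n$ and $w_i\in I_i\setminus K_i$ for $0\le i\le n-1$, then $\tilde T_\alpha(w_{-1})=X_0^n(w_n+1)$; if $w_n\in I_n\setminus K_n$ for all $n\ge0$, then $\tilde T_\alpha(w_{-1})=\lim_{n\to\infty}X_0^n(w_n+1-1/\alpha_n)$. The map $\mathbb{T}_\alpha:\mathbb{M}_\alpha\to\mathbb{M}_\alpha$ is induced by $\tilde T_\alpha$: $\mathbb{T}_\alpha(s(e^{2\pi iw}))=s(e^{2\pi i\tilde T_\alpha(w)})$ for $w\in I_{-1}$, and $\mathbb{T}_\alpha(0)=0$. The operator $\mathcal{R}_m$. For $\alpha\in(0,1/2)\setminus\mathbb{Q}$ let $S_\alpha=\{z\in\mathbb{M}_\alpha\setminus\{0\}:\arg z\in[0,2\pi\alpha)+2\pi\mathbb{Z}\}$; for $z\in S_\alpha$ let $k_z\ge2$ be the smallest integer $\ge 2$ with $\mathbb{T}_\alpha^{\circ k_z}(z)\in S_\alpha$ (first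 return). Let $\psi_\alpha(w)=s(e^{2\pi i\mathbb{Y}_0(w)})$ on $\mathbb{H}'$; it is injective on $\{w\in\mathbb{H}':\operatorname{Re}w\in[0,1)\}$, the image of which contains $S_\alpha$; let $\phi_\alpha:S_\alpha\to\{w\in\mathbb{H}':\operatorname{Re}w\in[0,1)\}$ be the corresponding inverse. Let $h_\alpha(w)=\phi_\alpha\circ\mathbb{T}_\alpha^{\circ k_{\psi_\alpha(w)}}\circ\psi_\alpha(w)$ on $\phi_\alpha(S_\alpha)$, and let $E_\alpha$ be the map on $e^{2\pi i\phi_\alpha(S_\alpha)}\cup\{0\}$ given by $E_\alpha(e^{2\pi iw})=e^{2\pi ih_\alpha(w)}$, $E_\alpha(0)=0$. Then $\mathcal{R}_m(\mathbb{T}_\alpha:\mathbb{M}_\alpha\to\mathbb{M}_\alpha)$ is the map $E_\alpha$ together with its domain of definition. For $\alpha\in(-1/2,0)\setminus\mathbb{Q}$, $\mathcal{R}_m(\mathbb{T}_\alpha:\mathbb{M}_\alpha\to\mathbb{M}_\alpha)$ is the conjugate by $s$ of $\mathcal{R}_m(\mathbb{T}_{-\alpha}:\mathbb{M}_{-\alpha}\to\mathbb{M}_{-\alpha})$, where the conjugate of $f:X\to Y$ is $s\circ f\circ s:s(X)\to s(Y)$. For other $\alpha$ one first translates $\alpha$ by an integer into $(-1/2,1/2)$, using $\mathbb{M}_{\alpha+1}=\mathbb{M}_\alpha$, $\mathbb{T}_{\alpha+1}=\mathbb{T}_\alpha$. *)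

theory Defs
  imports "HOL-Analysis.Analysis"
begin

section \<open>Nearest-integer continued fraction\<close>

text \<open>An irrational \<open>x\<close> is written uniquely as \<open>x = a + e * d(x, \<int>)\<close> with \<open>a\<close> an integer and
  \<open>e = 1\<close> or \<open>e = -1\<close>.\<close>

definition near_int :: "real \<Rightarrow> int" where
  "near_int x = (THE a. \<exists>e\<in>{1, -1::int}. x = of_int a + of_int e * infdist x \<int>)"

definition near_sgn :: "real \<Rightarrow> int" where
  "near_sgn x = (THE e. e \<in> {1, -1} \<and> (\<exists>a::int. x = of_int a + of_int e * infdist x \<int>))"

primrec cf_rem :: "real \<Rightarrow> nat \<Rightarrow> real" where
  "cf_rem \<alpha> 0 = infdist \<alpha> \<int>"
| "cf_rem \<alpha> (Suc n) = infdist (1 / cf_rem \<alpha> n) \<int>"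

text \<open>The entry with index \<open>-1\<close> is \<open>near_int \<alpha>\<close>; it does not enter the construction.\<close>

definition cf_quot :: "real \<Rightarrow> nat \<Rightarrow> int" where
  "cf_quot \<alpha> n = near_int (1 / cf_rem \<alpha> n)"

primrec cf_sgn :: "real \<Rightarrow> nat \<Rightarrow> int" where
  "cf_sgn \<alpha> 0 = near_sgn \<alpha>"
| "cf_sgn \<alpha> (Suc n) = near_sgn (1 / cf_rem \<alpha> n)"

section \<open>Changes of coordinates\<close>

definition Y :: "real \<Rightarrow> complex \<Rightarrow> complex" where
  "Y r w = of_real (r * Re w) + \<i> / (2 * of_real pi) * of_real (ln (cmod (
      (exp (of_real (- 3 * pi * r)) - exp (- of_real (pi * r) * \<i>) * exp (- of_real (2 * pi * r) * \<i> * w))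
      / (exp (of_real (- 3 * pi * r)) - exp (of_real (pi * r) * \<i>)))))"

definition YY :: "real \<Rightarrow> nat \<Rightarrow> complex \<Rightarrow> complex" where
  "YY \<alpha> n w = (if cf_sgn \<alpha> n = -1 then Y (cf_rem \<alpha> n) w else - cnj (Y (cf_rem \<alpha> n) w))"

definition YY_shift :: "real \<Rightarrow> nat \<Rightarrow> complex \<Rightarrow> complex" where
  "YY_shift \<alpha> n w = YY \<alpha> n w + (of_int (cf_sgn \<alpha> n) + 1) / 2"

primrec X0 :: "real \<Rightarrow> nat \<Rightarrow> complex \<Rightarrow> complex" where
  "X0 \<alpha> 0 = YY_shift \<alpha> 0"
| "X0 \<alpha> (Suc n) = X0 \<alpha> n \<circ> YY_shift \<alpha> (Suc n)"

definition ex :: "complex \<Rightarrow> complex" where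
  "ex w = exp (2 * of_real pi * \<i> * w)"

section \<open>The sets\<close>

definition J_part :: "real \<Rightarrow> complex set \<Rightarrow> complex set" where
  "J_part r A = {w \<in> A. Re w \<in> {1 / r - 1 .. 1 / r}}"

definition K_part :: "real \<Rightarrow> complex set \<Rightarrow> complex set" where
  "K_part r A = {w \<in> A. Re w \<in> {0 .. 1 / r - 1}}"

text \<open>\<open>I_step \<alpha> j n\<close> is the set with upper index \<open>j\<close> and lower index \<open>n\<close>.\<close>

primrec I_step :: "real \<Rightarrow> nat \<Rightarrow> nat \<Rightarrow> complex set" where
  "I_step \<alpha> 0 = (\<lambda>n. {w. Im w \<ge> -1 \<and> Re w \<in> {0 .. 1 / cf_rem \<alpha> n}})"
| "I_step \<alpha> (Suc j) = (\<lambda>n.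
     if cf_sgn \<alpha> (Suc n) = -1 then
       (\<Union>l\<in>{0 .. cf_quot \<alpha> n - 2}. (\<lambda>w. YY \<alpha> (Suc n) w + of_int l) ` I_step \<alpha> j (Suc n))
       \<union> (\<lambda>w. YY \<alpha> (Suc n) w + of_int (cf_quot \<alpha> n - 1))
           ` K_part (cf_rem \<alpha> (Suc n)) (I_step \<alpha> j (Suc n))
     else
       (\<Union>l\<in>{1 .. cf_quot \<alpha> n}. (\<lambda>w. YY \<alpha> (Suc n) w + of_int l) ` I_step \<alpha> j (Suc n))
       \<union> (\<lambda>w. YY \<alpha> (Suc n) w + of_int (cf_quot \<alpha> n + 1))
           ` J_part (cf_rem \<alpha> (Suc n)) (I_step \<alpha> j (Suc n)))"

definition I_set :: "real \<Rightarrow> nat \<Rightarrow> complex set" where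
  "I_set \<alpha> n = (\<Inter>j\<in>{1..}. I_step \<alpha> j n)"

definition K_set :: "real \<Rightarrow> nat \<Rightarrow> complex set" where
  "K_set \<alpha> n = (\<Inter>j\<in>{1..}. K_part (cf_rem \<alpha> n) (I_step \<alpha> j n))"

text \<open>The set with lower index \<open>-1\<close>.\<close>

definition I_top :: "real \<Rightarrow> complex set" where
  "I_top \<alpha> = (\<Inter>j\<in>{1..}. YY_shift \<alpha> 0 ` I_step \<alpha> (j - 1) 0)"

definition MM :: "real \<Rightarrow> complex set" where
  "MM \<alpha> = {cnj (ex w) | w. w \<in> I_top \<alpha>} \<union> {0}"

section \<open>The maps\<close>

text \<open>\<open>traj_int \<alpha> n x\<close> is \<open>l\<^bsub>n-1\<^esub>\<close> for \<open>x = w\<^bsub>n-1\<^esub>\<close>, \<open>traj_next \<alpha> n x\<close> is then \<open>w\<^bsub>n\<^esub>\<close>,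
  and \<open>traj \<alpha> w n\<close> is the entry \<open>w\<^bsub>n\<^esub>\<close>, \<open>n \<ge> 0\<close>, of the trajectory of \<open>w = w\<^bsub>-1\<^esub>\<close>.\<close>

definition traj_int :: "real \<Rightarrow> nat \<Rightarrow> complex \<Rightarrow> int" where
  "traj_int \<alpha> n x = (THE l. if cf_sgn \<alpha> n = -1
      then 0 \<le> Re (x - of_int l) \<and> Re (x - of_int l) < 1
      else -1 < Re (x - of_int l) \<and> Re (x - of_int l) \<le> 0)"

definition traj_next :: "real \<Rightarrow> nat \<Rightarrow> complex \<Rightarrow> complex" where
  "traj_next \<alpha> n x = (THE y. y \<in> I_set \<alpha> n \<and> YY \<alpha> n y + of_int (traj_int \<alpha> n x) = x)"

primrec traj :: "real \<Rightarrow> complex \<Rightarrow> nat \<Rightarrow> complex" where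
  "traj \<alpha> w 0 = traj_next \<alpha> 0 w"
| "traj \<alpha> w (Suc n) = traj_next \<alpha> (Suc n) (traj \<alpha> w n)"

definition first_K :: "real \<Rightarrow> complex \<Rightarrow> nat \<Rightarrow> bool" where
  "first_K \<alpha> w n \<longleftrightarrow>
     traj \<alpha> w n \<in> K_set \<alpha> n \<and> (\<forall>i<n. traj \<alpha> w i \<in> I_set \<alpha> i - K_set \<alpha> i)"

definition T_lift :: "real \<Rightarrow> complex \<Rightarrow> complex" where
  "T_lift \<alpha> w =
    (if \<exists>n. first_K \<alpha> w n
     then let n = (THE n. first_K \<alpha> w n) in X0 \<alpha> n (traj \<alpha> w n + 1)
     else lim (\<lambda>n. X0 \<alpha> n (traj \<alpha> w n + 1 - of_real (1 / cf_rem \<alpha> n))))"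

text \<open>The description operator below picks out a value only because the lift respects the
  identification of points of \<open>I_top \<alpha>\<close> that differ by an integer. Maps on a set are
  restricted to it, so that equality of functions means equality on the domain.\<close>

definition TT :: "real \<Rightarrow> complex \<Rightarrow> complex" where
  "TT \<alpha> = restrict (\<lambda>z. if z = 0 then 0
     else (THE z'. \<exists>w\<in>I_top \<alpha>. z = cnj (ex w) \<and> z' = cnj (ex (T_lift \<alpha> w)))) (MM \<alpha>)"

section \<open>Renormalisation\<close>

text \<open>A map together with its domain of definition.\<close>

type_synonym cmap = "complex set \<times> (complex \<Rightarrow> complex)"

definition model :: "real \<Rightarrow> cmap" where
  "model \<alpha> = (MM \<alpha>, TT \<alpha>)"

definition model_class :: "cmap set" where
  "model_class = {model \<alpha> | \<alpha>. \<alpha> \<notin> \<rat>}"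

definition conj_map :: "cmap \<Rightarrow> cmap" where
  "conj_map F = (cnj ` fst F, restrict (cnj \<circ> snd F \<circ> cnj) (cnj ` fst F))"

definition sector :: "real \<Rightarrow> complex set \<Rightarrow> complex set" where
  "sector \<alpha> X = {z \<in> X - {0}. Arg2pi z \<in> {0 ..< 2 * pi * \<alpha>}}"

definition return_time :: "complex set \<Rightarrow> (complex \<Rightarrow> complex) \<Rightarrow> complex \<Rightarrow> nat" where
  "return_time S f z = (LEAST k. k \<ge> 2 \<and> (f ^^ k) z \<in> S)"

definition psi :: "real \<Rightarrow> complex \<Rightarrow> complex" where
  "psi \<alpha> w = cnj (ex (YY \<alpha> 0 w))"

definition phi :: "real \<Rightarrow> complex \<Rightarrow> complex" where
  "phi \<alpha> = the_inv_into {w. Im w > -1 \<and> Re w \<in> {0 ..< 1}} (psi \<alpha>)"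

definition return_map :: "real \<Rightarrow> cmap \<Rightarrow> cmap" where
  "return_map \<alpha> F =
    (let f = snd F;
         S = sector \<alpha> (fst F);
         h = (\<lambda>w. phi \<alpha> ((f ^^ return_time S f (psi \<alpha> w)) (psi \<alpha> w)));
         D = ex ` (phi \<alpha> ` S) \<union> {0}
     in (D, restrict (\<lambda>z. if z = 0 then 0
               else (THE z'. \<exists>w\<in>phi \<alpha> ` S. z = ex w \<and> z' = ex (h w))) D))"

text \<open>An operator on maps: the rotation number in \<open>(-1/2, 1/2)\<close> is recovered from the map,
  being the representative of the parameter modulo \<open>1\<close>.\<close>

definition Rm :: "cmap \<Rightarrow> cmap" where
  "Rm F = (let \<alpha> = (THE \<alpha>. \<alpha> \<notin> \<rat> \<and> -1/2 < \<alpha> \<and> \<alpha> < 1/2 \<and> model \<alpha> = F)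
           in if \<alpha> > 0 then return_map \<alpha> (model \<alpha>)
              else conj_map (return_map (- \<alpha>) (model (- \<alpha>))))"

section \<open>Properties\<close>

definition starlike_about_0 :: "complex set \<Rightarrow> bool" where
  "starlike_about_0 M \<longleftrightarrow> (\<forall>z\<in>M. \<forall>r\<in>{0..1::real}. of_real r * z \<in> M)"

definition tangential_rotation :: "real \<Rightarrow> complex set \<Rightarrow> (complex \<Rightarrow> complex) \<Rightarrow> bool" where
  "tangential_rotation \<alpha> M f \<longleftrightarrow>
    (\<exists>g :: real \<Rightarrow> real \<Rightarrow> real. (\<forall>r \<theta>. g r \<theta> \<ge> 0) \<and>
       (\<forall>r\<ge>0. \<forall>\<theta>. of_real r * cis (2 * pi * \<theta>) \<in> M \<longrightarrow>
          f (of_real r * cis (2 * pi * \<theta>)) = of_real (g r \<theta>) * cis (2 * pi * (\<theta> + \<alpha>))))"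

text \<open>Meaningful for nonempty bounded sets.\<close>

definition hausdorff_distance :: "'a::metric_space set \<Rightarrow> 'a set \<Rightarrow> real" where
  "hausdorff_distance A B = max (SUP a\<in>A. infdist a B) (SUP b\<in>B. infdist b A)"

end

theory Submission
  imports Defs
begin

text \<open>All maps of the construction preserve vertical lines and contract them by a factor at most
  \<open>2/3\<close>. In height coordinates a point of the model over \<open>u\<close> is a
  sequence of heights \<open>y n \<ge> -1\<close>, each the image of the next under a
  contraction of the line with address \<open>x n\<close>, and \<open>T\<close> replaces the
  addresses \<open>x n\<close> by \<open>x n + 1\<close> modulo \<open>1 / r n\<close>, up
  to and including the first level where no reduction is needed. Since one step of
  \<open>x\<close> displaces heights by at most \<open>2/3\<close>, \<open>T\<close> moves
  heights at every depth by at most \<open>2\<close>; so it is a geometric limit of maps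
  given by finitely many levels, uniformly in the point and in \<open>\<alpha>\<close>.
  Injectivity, surjectivity and joint continuity in the point and in \<open>\<alpha>\<close>
  follow from the contraction, and renormalisation drops the first entry of the sequence.
  The rays below the orbit of \<open>1\<close> are dense in the model, and the orbit of
  \<open>1\<close> depends continuously on \<open>\<alpha>\<close>: this gives the lower
  half of Hausdorff continuity, the upper half being closedness of the model jointly in
  \<open>\<alpha>\<close>.\<close>

section \<open>The change of coordinates on vertical lines\<close>

text \<open>The obstacle is discontinuity: \<open>addr\<close> jumps where \<open>u\<close> crosses
  an integer, and the definition of T splits according to whether and when the reduction stops. Both
  are removed by one relation, the equality of heights at the addresses \<open>0\<close>,
  \<open>1/r - 1\<close> and \<open>1/r\<close>. It makes the recursion of \<open>pull\<close> valid
  on closed address intervals, so that at a jump the branches of both sides may be used. T becomes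
  an odometer: adding 1 to the first address either fits, or overflows and carries the same step to
  the next level; the limit in \<open>rot\<close> treats finite and infinite carries alike. The
  constants come from the inequality \<open>3/2 * r \<le> 1 - exp (- (pi * r))\<close> on
  \<open>[0, 1/2]\<close>: it bounds both partial derivatives of the heights by \<open>2/3\<close>,
  and \<open>2\<close> solves \<open>d = 2/3 + 2/3 * d\<close>. Over the k-th orbit position the
  fibre is exactly a half-line starting at the orbit height, because over \<open>0\<close> it
  consists of the heights \<open>\<ge> 0\<close> and T is increasing on each line. These half-lines
  move continuously with \<alpha>; other fibres are reached only through density.\<close>

definition numer :: "real \<Rightarrow> real \<Rightarrow> real \<Rightarrow> real" where
  "numer r x y = (exp (2 * pi * r * y))\<^sup>2
     - 2 * exp (- 3 * pi * r) * exp (2 * pi * r * y) * cos (pi * r * (2 * x + 1)) + (exp (- 3 * pi * r))\<^sup>2"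

definition hgt0 :: "real \<Rightarrow> real \<Rightarrow> real \<Rightarrow> real" where
  "hgt0 r x y = (ln (numer r x y) - ln (numer r 0 0)) / (4 * pi)"

text \<open>\<open>hgt0 r x y\<close> is the imaginary part of \<open>Y r (x + i y)\<close> for \<open>y
  \<ge> -1\<close>. Below \<open>-1\<close>, \<open>hgt\<close> continues it with slope
  \<open>1/2\<close>, so that every vertical line is mapped bijectively and contracted, and
  inverses are total.\<close>

definition hgt :: "real \<Rightarrow> real \<Rightarrow> real \<Rightarrow> real" where
  "hgt r x y = hgt0 r x (max y (-1)) + min (y + 1) 0 / 2"

text \<open>The chord of the convex function \<open>exp (- (pi * r))\<close> over
  \<open>[0, 1/2]\<close>: its value at \<open>1/2\<close> is at most \<open>1/4\<close>, so the
  chord stays below \<open>1 - 3/2 * r\<close>. The bound \<open>1/4\<close> comes from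
  \<open>(13/8)^3 \<le> exp (3/2)\<close>.\<close>

lemma exp_minus_pi_le:
  assumes "0 \<le> r" "r \<le> 1/2"
  shows "3/2 * r \<le> 1 - exp (- (pi * r))"
proof -
  have "(1 + 1/2 + (1/2)\<^sup>2/2) \<le> exp (1/2::real)"
    by (rule exp_lower_Taylor_quadratic) simp
  then have "(13/8)^3 \<le> exp (1/2::real) ^ 3"
    by (intro power_mono) (auto simp: power2_eq_square)
  also have "\<dots> = exp (3/2)"
    by (simp flip: exp_of_nat_mult)
  also have "\<dots> \<le> exp (pi/2)"
    using pi_gt3 by simp
  finally have "4 \<le> exp (pi/2)"
    by (simp add: power3_eq_cube)
  then have e: "exp (- (pi/2)) \<le> 1/4"
    by (simp add: exp_minus field_simps)
  have "convex_on UNIV (exp :: real \<Rightarrow> real)"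
    by (rule exp_convex)
  then have "exp ((1 - 2*r) *\<^sub>R 0 + (2*r) *\<^sub>R (- (pi/2))) \<le> (1 - 2*r) * exp 0 + (2*r) * exp (- (pi/2))"
    using assms by (intro convex_onD) auto
  also have "\<dots> \<le> (1 - 2*r) + (2*r) * (1/4)"
    using e assms by (intro add_mono mult_left_mono) auto
  finally show ?thesis
    by (simp add: algebra_simps)
qed

text \<open>For heights from \<open>-1\<close> on, \<open>exp (- 3 * pi * r)\<close> is at most
  \<open>exp (2 * pi * r * y) * exp (- (pi * r))\<close>, so the relative gap is uniform in
  \<open>y\<close>. Both slope bounds \<open>2/3\<close> rest on it.\<close>

lemma exp_gap:
  assumes "0 \<le> r" "r \<le> 1/2" "-1 \<le> y"
  shows "3/2 * r * exp (2 * pi * r * y) \<le> exp (2 * pi * r * y) - exp (- 3 * pi * r)"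
proof -
  have "exp (- 3 * pi * r) \<le> exp (2 * pi * r * y - pi * r)"
  proof -
    have "0 \<le> (2 * pi * r) * (y + 1)"
      using assms by (intro mult_nonneg_nonneg) auto
    then show ?thesis by (simp add: algebra_simps)
  qed
  also have "\<dots> = exp (2 * pi * r * y) * exp (- (pi * r))"
    by (simp add: exp_diff exp_minus divide_inverse)
  also have "\<dots> \<le> exp (2 * pi * r * y) * (1 - 3/2 * r)"
    using exp_minus_pi_le[of r] assms by (intro mult_left_mono) auto
  finally show ?thesis by (simp add: algebra_simps)
qed

lemma quad_form_lower:
  fixes p q c :: real
  assumes "0 \<le> p" "0 \<le> q" "\<bar>c\<bar> \<le> 1"
  shows "(p - q)\<^sup>2 \<le> p\<^sup>2 - 2 * q * p * c + q\<^sup>2"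
proof -
  have "q * p * c \<le> q * p * 1"
    using assms by (intro mult_left_mono) auto
  then show ?thesis by (simp add: power2_eq_square algebra_simps)
qed

lemma exp_lt:
  assumes "0 < r" "r \<le> 1/2" "-1 \<le> y"
  shows "exp (- 3 * pi * r) < exp (2 * pi * r * y)"
proof -
  have "0 < 3/2 * r * exp (2 * pi * r * y)" using assms by simp
  then show ?thesis using exp_gap[of r y] assms by linarith
qed

text \<open>By the law of cosines \<open>numer r x y\<close> is the squared distance of two complex
  numbers of moduli \<open>exp (2 * pi * r * y)\<close> and \<open>exp (- 3 * pi * r)\<close> whose
  arguments differ by \<open>pi * r * (2 * x + 1)\<close>; the bound is the reverse triangle
  inequality.\<close>

lemma numer_lower:
  "(exp (2 * pi * r * y) - exp (- 3 * pi * r))\<^sup>2 \<le> numer r x y"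
  unfolding numer_def by (rule quad_form_lower) auto

lemma numer_pos:
  assumes "0 < r" "r \<le> 1/2" "-1 \<le> y"
  shows "0 < numer r x y"
proof -
  have "0 < (exp (2 * pi * r * y) - exp (- 3 * pi * r))\<^sup>2"
    using exp_lt[OF assms] by simp
  also note numer_lower
  finally show ?thesis .
qed

lemma DERIV_ln_divide_chain:
  fixes f :: "real \<Rightarrow> real"
  assumes "0 < f x" "(f has_real_derivative D) (at x)"
  shows "((\<lambda>x. ln (f x)) has_real_derivative D / f x) (at x)"
  using DERIV_chain2[OF DERIV_ln_divide[OF assms(1)] assms(2)] by simp

lemma hgt0_deriv_y:
  assumes "0 < r" "r \<le> 1/2" "-1 \<le> y"
  shows "((\<lambda>y. hgt0 r x y) has_real_derivative
     r * exp (2 * pi * r * y) * (exp (2 * pi * r * y) - exp (- 3 * pi * r) * cos (pi * r * (2 * x + 1)))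
       / numer r x y) (at y)"
proof -
  have "((\<lambda>y. numer r x y) has_real_derivative 4 * pi *
     (r * exp (2 * pi * r * y) * (exp (2 * pi * r * y) - exp (- 3 * pi * r) * cos (pi * r * (2 * x + 1))))) (at y)"
    unfolding numer_def
    by (rule derivative_eq_intros refl)+ (simp add: algebra_simps power2_eq_square)
  from DERIV_ln_divide_chain[OF numer_pos[OF assms] this] show ?thesis
    unfolding hgt0_def by (rule DERIV_cong[OF DERIV_cdivide[OF DERIV_diff[OF _ DERIV_const]]]) simp
qed

lemma hgt0_deriv_x:
  assumes "0 < r" "r \<le> 1/2" "-1 \<le> y"
  shows "((\<lambda>x. hgt0 r x y) has_real_derivative
     r * exp (2 * pi * r * y) * exp (- 3 * pi * r) * sin (pi * r * (2 * x + 1))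
       / numer r x y) (at x)"
proof -
  have "((\<lambda>x. numer r x y) has_real_derivative 4 * pi *
     (r * exp (2 * pi * r * y) * exp (- 3 * pi * r) * sin (pi * r * (2 * x + 1)))) (at x)"
    unfolding numer_def
    by (rule derivative_eq_intros refl)+ (simp add: algebra_simps power2_eq_square)
  from DERIV_ln_divide_chain[OF numer_pos[OF assms] this] show ?thesis
    unfolding hgt0_def by (rule DERIV_cong[OF DERIV_cdivide[OF DERIV_diff[OF _ DERIV_const]]]) simp
qed

text \<open>The quotient is the derivative of \<open>hgt0\<close> in \<open>y\<close>, with
  \<open>p = exp (2 * pi * r * y)\<close> and \<open>q = exp (- 3 * pi * r)\<close>. Above:
  \<open>n - (p - q) * (p - q * c) = q * (1 - c) * (p + q)\<close> is nonnegative, and the gap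
  replaces \<open>p - q\<close> by \<open>3/2 * r * p\<close>. Below:
  \<open>2 * p * (p - q * c) - n = p\<^sup>2 - q\<^sup>2\<close>.\<close>

lemma quad_form_slope_y:
  fixes p q c r :: real
  assumes "0 < r" "0 < q" "q < p" "\<bar>c\<bar> \<le> 1" "3/2 * r * p \<le> p - q"
  defines "n \<equiv> p\<^sup>2 - 2 * q * p * c + q\<^sup>2"
  shows "r * p * (p - q * c) / n \<le> 2/3" "r / 2 \<le> r * p * (p - q * c) / n"
proof -
  have "0 < (p - q)\<^sup>2" using assms by simp
  also have "\<dots> \<le> n" unfolding n_def using assms by (intro quad_form_lower) auto
  finally have n: "0 < n" .
  have pq: "0 \<le> p - q * c"
  proof -
    have "q * c \<le> q * 1" using assms by (intro mult_left_mono) auto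
    then show ?thesis using assms(3) by linarith
  qed
  have "(3/2 * r * p) * (p - q * c) \<le> (p - q) * (p - q * c)"
    using assms pq by (intro mult_right_mono) auto
  also have "\<dots> \<le> n"
  proof -
    have "0 \<le> q * (1 - c) * (p + q)" using assms by (intro mult_nonneg_nonneg) auto
    then show ?thesis unfolding n_def by (simp add: algebra_simps power2_eq_square)
  qed
  finally show "r * p * (p - q * c) / n \<le> 2/3" using n by (simp add: field_simps)
  have "n \<le> 2 * p * (p - q * c)"
  proof -
    have "q\<^sup>2 \<le> p\<^sup>2" using assms by (intro power_mono) auto
    then show ?thesis unfolding n_def by (simp add: algebra_simps power2_eq_square)
  qed
  then have "r * n \<le> r * (2 * p * (p - q * c))" using assms by (intro mult_left_mono) auto
  then show "r / 2 \<le> r * p * (p - q * c) / n" using n by (simp add: field_simps)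
qed

text \<open>The quotient is the derivative of \<open>hgt0\<close> in \<open>x\<close>. Completing
  the square gives \<open>n = (p - q * c)\<^sup>2 + (q * s)\<^sup>2\<close>, which dominates the
  product of \<open>p - q\<close> and \<open>q * \<bar>s\<bar>\<close> by the inequality of
  arithmetic and geometric means.\<close>

lemma quad_form_slope_x:
  fixes p q c s r :: real
  assumes "0 < r" "0 < q" "q < p" "s\<^sup>2 + c\<^sup>2 = 1" "3/2 * r * p \<le> p - q"
  defines "n \<equiv> p\<^sup>2 - 2 * q * p * c + q\<^sup>2"
  shows "\<bar>r * p * q * s / n\<bar> \<le> 2/3"
proof -
  have c: "\<bar>c\<bar> \<le> 1"
    using assms(4) by (metis abs_square_le_1 le_add_same_cancel2 zero_le_power2)
  have "0 < (p - q)\<^sup>2" using assms by simp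
  also have "\<dots> \<le> n" unfolding n_def using assms c by (intro quad_form_lower) auto
  finally have n: "0 < n" .
  have "(3/2 * r * p) * (q * \<bar>s\<bar>) \<le> (p - q) * (q * \<bar>s\<bar>)"
    using assms by (intro mult_right_mono) auto
  also have "\<dots> \<le> ((p - q)\<^sup>2 + (q * \<bar>s\<bar>)\<^sup>2) / 2"
    using zero_le_power2[of "(p - q) - q * \<bar>s\<bar>"] by (simp add: power2_eq_square algebra_simps)
  also have "\<dots> \<le> n"
  proof -
    have qc: "q * c \<le> q * 1" using assms c by (intro mult_left_mono) auto
    have "(p - q)\<^sup>2 \<le> (p - q * c)\<^sup>2" using assms qc by (intro power_mono) auto
    moreover have "n = (p - q * c)\<^sup>2 + (q * \<bar>s\<bar>)\<^sup>2"
    proof -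
      have "q\<^sup>2 * (s\<^sup>2 + c\<^sup>2) = q\<^sup>2" using assms by simp
      then show ?thesis unfolding n_def by (simp add: algebra_simps power2_eq_square)
    qed
    moreover have "a \<le> b \<Longrightarrow> 0 \<le> b \<Longrightarrow> 0 \<le> d \<Longrightarrow> (a + d) / 2 \<le> b + d" for a b d :: real
      by simp
    ultimately show ?thesis by (metis zero_le_power2)
  qed
  finally have "r * p * q * \<bar>s\<bar> \<le> 2/3 * n" by simp
  moreover have "\<bar>r * p * q * s\<bar> = r * p * q * \<bar>s\<bar>" using assms by (simp add: abs_mult)
  ultimately show ?thesis using n by (simp add: field_simps abs_divide)
qed

lemma hgt0_slope_y:
  assumes r: "0 < r" "r \<le> 1/2" and "-1 \<le> y" "y \<le> y'"
  shows "r/2 * (y' - y) \<le> hgt0 r x y' - hgt0 r x y" "hgt0 r x y' - hgt0 r x y \<le> 2/3 * (y' - y)"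
proof -
  let ?f = "\<lambda>y. r * exp (2 * pi * r * y) * (exp (2 * pi * r * y) - exp (- 3 * pi * r) * cos (pi * r * (2 * x + 1)))
       / numer r x y"
  have "r/2 * (y' - y) \<le> hgt0 r x y' - hgt0 r x y \<and> hgt0 r x y' - hgt0 r x y \<le> 2/3 * (y' - y)"
  proof (cases "y = y'")
    case False
    then have "y < y'" using assms by simp
    then obtain z where z: "y < z" "z < y'" "hgt0 r x y' - hgt0 r x y = (y' - y) * ?f z"
      using MVT2[of y y' "hgt0 r x" ?f] hgt0_deriv_y[OF r] assms by force
    have "?f z \<le> 2/3" "r/2 \<le> ?f z"
      unfolding numer_def
      using r z assms exp_lt[of r z] exp_gap[of r z]
      by (intro quad_form_slope_y; auto)+
    then have "r/2 * (y' - y) \<le> ?f z * (y' - y)" "?f z * (y' - y) \<le> 2/3 * (y' - y)"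
      using \<open>y < y'\<close> by (auto intro!: mult_right_mono simp del: times_divide_eq_left)
    then show ?thesis unfolding z(3) by (simp only: mult.commute) 
  qed simp
  then show "r/2 * (y' - y) \<le> hgt0 r x y' - hgt0 r x y" "hgt0 r x y' - hgt0 r x y \<le> 2/3 * (y' - y)" by auto
qed

text \<open>An increment splits into a part above \<open>-1\<close>, where \<open>hgt0\<close> acts,
  and a part below, where the slope \<open>1/2\<close> lies between \<open>r/2\<close> and
  \<open>2/3\<close>.\<close>

lemma hgt_slope_y:
  assumes r: "0 < r" "r \<le> 1/2" and "y \<le> y'"
  shows "r/2 * (y' - y) \<le> hgt r x y' - hgt r x y" "hgt r x y' - hgt r x y \<le> 2/3 * (y' - y)"
proof -
  define m where "m = max y (-1)"
  define m' where "m' = max y' (-1)"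
  define k where "k = min (y + 1) 0"
  define k' where "k' = min (y' + 1) 0"
  have d: "hgt r x y' - hgt r x y = (hgt0 r x m' - hgt0 r x m) + (k' - k) / 2"
    by (simp add: hgt_def m_def m'_def k_def k'_def field_simps)
  have s: "y' - y = (m' - m) + (k' - k)" "m \<le> m'" "-1 \<le> m" "k \<le> k'"
    using assms by (auto simp: m_def m'_def k_def k'_def max_def min_def)
  note b = hgt0_slope_y[OF r s(3,2), of x]
  have "r * (k' - k) \<le> 1 * (k' - k)"
    using r s(4) by (intro mult_right_mono) auto
  then show "r/2 * (y' - y) \<le> hgt r x y' - hgt r x y"
    unfolding d s(1) using b(1) by argo
  show "hgt r x y' - hgt r x y \<le> 2/3 * (y' - y)"
    unfolding d s(1) using b(2) s(4) by argo
qed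

lemma hgt_lipschitz_y:
  assumes "0 < r" "r \<le> 1/2"
  shows "\<bar>hgt r x y - hgt r x y'\<bar> \<le> 2/3 * \<bar>y - y'\<bar>"
proof -
  have *: "\<bar>hgt r x b - hgt r x a\<bar> \<le> 2/3 * \<bar>b - a\<bar>" if "a \<le> b" for a b
  proof -
    have "0 \<le> r/2 * (b - a)" using assms that by simp
    then show ?thesis using hgt_slope_y[OF assms that, of x] that by simp
  qed
  show ?thesis
  proof (cases "y \<le> y'")
    case True
    then show ?thesis using *[OF True] by (simp add: abs_minus_commute)
  qed (use *[of y' y] in simp)
qed

lemma hgt_lipschitz_x:
  assumes r: "0 < r" "r \<le> 1/2"
  shows "\<bar>hgt r x y - hgt r x' y\<bar> \<le> 2/3 * \<bar>x - x'\<bar>"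
proof -
  define m where "m = max y (-1)"
  have m: "-1 \<le> m" by (simp add: m_def)
  let ?f = "\<lambda>x. r * exp (2 * pi * r * m) * exp (- 3 * pi * r) * sin (pi * r * (2 * x + 1)) / numer r x m"
  have *: "\<bar>hgt0 r b m - hgt0 r a m\<bar> \<le> 2/3 * (b - a)" if "a \<le> b" for a b
  proof (cases "a = b")
    case False
    then have "a < b" using that by simp
    then obtain z where z: "hgt0 r b m - hgt0 r a m = (b - a) * ?f z"
      using MVT2[of a b "\<lambda>x. hgt0 r x m" ?f] hgt0_deriv_x[OF r m] by blast
    have "\<bar>?f z\<bar> \<le> 2/3"
      unfolding numer_def
      using r m exp_lt[OF r m] exp_gap[of r m]
      by (intro quad_form_slope_x) auto
    then have "\<bar>b - a\<bar> * \<bar>?f z\<bar> \<le> \<bar>b - a\<bar> * (2/3)" by (intro mult_left_mono) auto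
    then show ?thesis using \<open>a < b\<close> unfolding z abs_mult by (simp only: abs_of_pos diff_gt_0_iff_gt mult.commute)
  qed simp
  have "hgt r x y - hgt r x' y = hgt0 r x m - hgt0 r x' m" by (simp add: hgt_def m_def)
  then show ?thesis using *[of x x'] *[of x' x] by (cases "x \<le> x'") (auto simp: abs_minus_commute)
qed

lemma hgt_strict_mono:
  assumes "0 < r" "r \<le> 1/2" "y < y'"
  shows "hgt r x y < hgt r x y'"
proof -
  have "0 < r/2 * (y' - y)" using assms by simp
  then show ?thesis using hgt_slope_y(1)[of r y y' x] assms by linarith
qed

lemma hgt_periodic:
  assumes "r \<noteq> 0"
  shows "hgt r (x + 1 / r) y = hgt r x y"
proof -
  have "pi * r * (2 * (x + 1 / r) + 1) = pi * r * (2 * x + 1) + 2 * pi"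
    using assms by (simp add: field_simps)
  then have "cos (pi * r * (2 * (x + 1 / r) + 1)) = cos (pi * r * (2 * x + 1))"
    by (simp only: cos_periodic)
  then show ?thesis by (simp add: hgt_def hgt0_def numer_def)
qed

text \<open>An instance of the reflection \<open>x \<mapsto> -1 - x\<close>, which changes the sign
  of the angle \<open>pi * r * (2 * x + 1)\<close>. With the period \<open>1 / r\<close> it gives
  the value at \<open>1 / r - 1\<close>.\<close>

lemma hgt_minus_one: "hgt r (-1) y = hgt r 0 y"
proof -
  have "cos (pi * r * (2 * (-1) + 1)) = cos (pi * r * (2 * 0 + 1))"
    using cos_minus[of "pi * r"] by simp
  then show ?thesis by (simp only: hgt_def hgt0_def numer_def)
qed

lemma hgt_zero [simp]: "hgt r 0 0 = 0"
  by (simp add: hgt_def hgt0_def)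

lemma numer_zero_upper:
  assumes "0 < r"
  shows "numer r 0 0 \<le> 10 * (pi * r)\<^sup>2"
proof -
  define q where "q = exp (- 3 * pi * r)"
  have q: "0 < q" "q \<le> 1" using assms by (auto simp: q_def)
  have "1 - q \<le> 3 * pi * r" using exp_ge_add_one_self[of "- 3 * pi * r"] by (simp add: q_def)
  then have "(1 - q)\<^sup>2 \<le> (3 * pi * r)\<^sup>2" using q by (intro power_mono) auto
  moreover have "2 * (1 - cos (pi * r)) \<le> (pi * r)\<^sup>2"
  proof -
    have "cos (pi * r) = 1 - 2 * (sin (pi * r / 2))\<^sup>2"
      using cos_double_sin[of "pi * r / 2"] by simp
    moreover have "(sin (pi * r / 2))\<^sup>2 \<le> (pi * r / 2)\<^sup>2"
      using abs_sin_x_le_abs_x[of "pi * r / 2"] by (simp only: abs_le_square_iff)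
    ultimately show ?thesis by (simp add: power2_eq_square)
  qed
  then have "q * (2 * (1 - cos (pi * r))) \<le> 1 * (pi * r)\<^sup>2"
    using q by (intro mult_mono) auto
  moreover have "numer r 0 0 = (1 - q)\<^sup>2 + q * (2 * (1 - cos (pi * r)))"
    unfolding numer_def q_def[symmetric] by (simp add: power2_eq_square algebra_simps)
  ultimately show ?thesis by (simp add: power2_eq_square)
qed

text \<open>After exponentiation the claim compares the lower bound
  \<open>(3/2 * r * exp (- pi))\<^sup>2\<close> of \<open>numer r x y\<close> with the upper bound
  \<open>160 * r\<^sup>2 * exp (- (4 * pi))\<close> of the normalising term, and \<open>r\<close>
  cancels.\<close>

lemma hgt_gt_minus_one:
  assumes r: "0 < r" "r \<le> 1/2" and y: "-1 \<le> y"
  shows "-1 < hgt r x y"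
proof -
  have e1: "5/2 \<le> exp (1::real)" using exp_lower_Taylor_quadratic[of 1] by simp
  \<comment> \<open>A rough value is enough: the final comparison only asks for
    \<open>160 < 9/4 * exp (2 * pi)\<close>.\<close>
  have "(5/2)^6 \<le> exp (1::real)^6" using e1 by (intro power_mono) auto
  also have "\<dots> = exp 6" by (simp flip: exp_of_nat_mult)
  also have "\<dots> \<le> exp (2 * pi)" using pi_gt3 by simp
  finally have e: "240 \<le> exp (2 * pi)" by (simp add: power_numeral_reduce)
  have "3/2 * r * exp (- pi) \<le> 3/2 * r * exp (2 * pi * r * y)"
  proof -
    have "-1 \<le> 2 * r * y"
    proof -
      have "2 * r * (-1) \<le> 2 * r * y" using r y by (intro mult_left_mono) auto
      then show ?thesis using r by linarith
    qed
    then have "- pi \<le> pi * (2 * r * y)" using mult_left_mono[of "-1" "2 * r * y" pi] by simp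
    then show ?thesis using r by (intro mult_left_mono) (auto simp: mult_ac)
  qed
  also have "\<dots> \<le> exp (2 * pi * r * y) - exp (- 3 * pi * r)" using exp_gap r y by simp
  finally have "(3/2 * r * exp (- pi))\<^sup>2 \<le> (exp (2 * pi * r * y) - exp (- 3 * pi * r))\<^sup>2"
    using r by (intro power_mono) auto
  also note numer_lower
  finally have n: "(3/2 * r * exp (- pi))\<^sup>2 \<le> numer r x y" .
  have "numer r 0 0 * exp (- (4 * pi)) \<le> 10 * (pi * r)\<^sup>2 * exp (- (4 * pi))"
    using numer_zero_upper r by (intro mult_right_mono) auto
  also have "\<dots> \<le> 160 * r\<^sup>2 * exp (- (4 * pi))"
  proof -
    have "(pi * r)\<^sup>2 \<le> (4 * r)\<^sup>2" using pi_less_4 r by (intro power_mono mult_right_mono) auto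
    then have "10 * (pi * r)\<^sup>2 \<le> 160 * r\<^sup>2" by (simp add: power_mult_distrib)
    then show ?thesis by (intro mult_right_mono) auto
  qed
  also have "\<dots> < 9/4 * r\<^sup>2 * exp (2 * pi) * exp (- (4 * pi))"
  proof -
    have "160 * r\<^sup>2 < 9/4 * r\<^sup>2 * 240" using r by simp
    also have "\<dots> \<le> 9/4 * r\<^sup>2 * exp (2 * pi)" using e by (intro mult_left_mono) auto
    finally show ?thesis by (intro mult_strict_right_mono) auto
  qed
  also have "\<dots> = (3/2 * r * exp (- pi))\<^sup>2"
    by (simp add: power2_eq_square mult_exp_exp flip: exp_add)
  also note n
  finally have "numer r 0 0 * exp (- (4 * pi)) < numer r x y" .
  then have "ln (numer r 0 0 * exp (- (4 * pi))) < ln (numer r x y)"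
    using numer_pos r y by (subst ln_less_cancel_iff) (auto intro!: mult_pos_pos)
  then have "ln (numer r 0 0) - 4 * pi < ln (numer r x y)"
    using numer_pos[OF r, of 0 0] by (simp add: ln_mult)
  then have "-1 < hgt0 r x y" unfolding hgt0_def by (simp add: field_simps)
  then show ?thesis using y by (simp add: hgt_def max_def)
qed

lemma tendsto_hgt [tendsto_intros]:
  assumes "(f \<longlongrightarrow> r) F" "(g \<longlongrightarrow> x) F" "(h \<longlongrightarrow> y) F" "0 < r" "r \<le> 1/2"
  shows "((\<lambda>i. hgt (f i) (g i) (h i)) \<longlongrightarrow> hgt r x y) F"
proof -
  have n: "((\<lambda>i. numer (f i) (g' i) (h' i)) \<longlongrightarrow> numer r x' y') F"
    if "(g' \<longlongrightarrow> x') F" "(h' \<longlongrightarrow> y') F" for g' h' x' y'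
  proof -
    have "((\<lambda>i. cos (pi * f i * (2 * g' i + 1))) \<longlongrightarrow> cos (pi * r * (2 * x' + 1))) F"
      by (rule tendsto_compose[OF isCont_cos[unfolded isCont_def]]) (intro tendsto_intros that assms)
    then show ?thesis unfolding numer_def by (intro tendsto_intros that assms)
  qed
  show ?thesis
    unfolding hgt_def hgt0_def
    using numer_pos[OF assms(4,5), of "max y (-1)" x] numer_pos[OF assms(4,5), of 0 0]
    by (intro tendsto_intros n assms) auto
qed

lemma hgt_surj:
  assumes r: "0 < r" "r \<le> 1/2"
  shows "\<exists>y. hgt r x y = v"
proof -
  have cont: "isCont (hgt r x) y" for y
    unfolding isCont_def by (intro tendsto_intros r)
  \<comment> \<open>The slope is at least \<open>r/2\<close>, so moving by \<open>d\<close> from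
    height \<open>0\<close> changes the value by at least its distance to \<open>v\<close>.\<close>
  define d where "d = (2/r) * \<bar>v - hgt r x 0\<bar>"
  have d: "0 \<le> d" "r/2 * d = \<bar>v - hgt r x 0\<bar>" using r by (auto simp: d_def)
  have "hgt r x (- d) \<le> v" using hgt_slope_y(1)[OF r, of "- d" 0 x] d by (simp del: times_divide_eq_left)
  moreover have "v \<le> hgt r x d" using hgt_slope_y(1)[OF r, of 0 d x] d by (simp del: times_divide_eq_left)
  ultimately show ?thesis
    using IVT[of "hgt r x" "- d" v d] d cont by auto
qed

lemma Y_eq_hgt:
  assumes r: "0 < r" "r \<le> 1/2" and "-1 \<le> Im w"
  shows "Y r w = Complex (r * Re w) (hgt r (Re w) (Im w))"
proof -
  define x where "x = Re w"
  define y where "y = Im w"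
  have y: "-1 \<le> y" using assms by (simp add: y_def)
  \<comment> \<open>The law of cosines, used for the numerator of \<open>Y\<close> and, with
    \<open>p = 1\<close> and \<open>t = pi * r\<close>, for its denominator.\<close>
  have sq: "(cmod (exp (of_real (- 3 * pi * r)) - of_real p * cis t))\<^sup>2
       = p\<^sup>2 - 2 * exp (- 3 * pi * r) * p * cos t + (exp (- 3 * pi * r))\<^sup>2" for p t :: real
  proof -
    have "(cmod (exp (of_real (- 3 * pi * r)) - of_real p * cis t))\<^sup>2
       = (exp (- 3 * pi * r) - p * cos t)\<^sup>2 + (p * sin t)\<^sup>2"
      by (subst exp_of_real) (simp add: cmod_power2)
    also have "\<dots> = p\<^sup>2 * ((sin t)\<^sup>2 + (cos t)\<^sup>2) - 2 * exp (- 3 * pi * r) * p * cos t + (exp (- 3 * pi * r))\<^sup>2"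
      unfolding power2_eq_square by algebra
    finally show ?thesis by simp
  qed
  define A where "A = exp (of_real (- 3 * pi * r)) - exp (- of_real (pi * r) * \<i>) * exp (- of_real (2 * pi * r) * \<i> * w)"
  define B where "B = exp (of_real (- 3 * pi * r)) - exp (of_real (pi * r) * \<i>)"
  have "exp (- of_real (pi * r) * \<i>) * exp (- of_real (2 * pi * r) * \<i> * w)
      = exp (of_real (2 * pi * r * y) + \<i> * of_real (- (pi * r * (2 * x + 1))))"
    unfolding exp_add[symmetric]
    by (rule arg_cong[of _ _ exp]) (simp add: complex_eq_iff x_def y_def algebra_simps)
  also have "\<dots> = of_real (exp (2 * pi * r * y)) * cis (- (pi * r * (2 * x + 1)))"
    by (simp only: exp_add cis_conv_exp exp_of_real)
  finally have "(cmod A)\<^sup>2 = numer r x y"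
    unfolding A_def by (simp only: sq numer_def cos_minus)
  moreover have "exp (of_real (pi * r) * \<i>) = of_real 1 * cis (pi * r)"
    by (simp add: cis_conv_exp mult.commute)
  then have "(cmod B)\<^sup>2 = numer r 0 0"
    unfolding B_def by (simp only: sq) (simp add: numer_def)
  moreover have pos: "0 < numer r x y" "0 < numer r 0 0" using numer_pos[OF r] y by auto
  ultimately have AB: "cmod A > 0" "cmod B > 0" "ln (numer r x y) = 2 * ln (cmod A)" "ln (numer r 0 0) = 2 * ln (cmod B)"
    by (auto simp flip: ln_realpow) (metis ln_realpow of_nat_numeral zero_less_norm_iff zero_less_power2)+
  then have "ln (cmod (A / B)) = (ln (numer r x y) - ln (numer r 0 0)) / 2"
    by (simp add: norm_divide ln_div)
  then have "Y r w = of_real (r * x) + \<i> / (2 * of_real pi) * of_real ((ln (numer r x y) - ln (numer r 0 0)) / 2)"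
    unfolding Y_def A_def B_def x_def by (simp only:)
  moreover have "hgt r x y = (ln (numer r x y) - ln (numer r 0 0)) / (4 * pi)"
    using y by (simp add: hgt_def hgt0_def max_def)
  ultimately show ?thesis by (simp add: complex_eq_iff x_def y_def)
qed

section \<open>Systems of vertical maps\<close>

definition sh :: "(nat \<Rightarrow> 'a) \<Rightarrow> nat \<Rightarrow> 'a" where
  "sh f n = f (Suc n)"

text \<open>No number \<alpha> is mentioned: the class is closed under dropping the first entry, so
  inductions on depth range over all systems at once. The quotients are not stored, only that they
  are integers.\<close>

definition cf_system :: "(nat \<Rightarrow> real) \<Rightarrow> (nat \<Rightarrow> int) \<Rightarrow> bool" where
  "cf_system r e \<longleftrightarrow> (\<forall>n. 0 < r n \<and> r n \<le> 1/2 \<and> e n \<in> {1, -1} \<and>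
     (\<exists>a::int. 1 / r n = of_int a + of_int (e (Suc n)) * r (Suc n)))"

text \<open>The map \<open>YY \<alpha> n\<close> sends the line over \<open>x\<close> to the line over
  \<open>- e n * r n * x\<close>. Positions on the circle are measured by \<open>u = - e n *
  Re w\<close> modulo 1; then \<open>addr r u\<close> is the real part of the preimage of
  the line and \<open>next_u r e u\<close> its position on the next circle, and the sign
  \<open>e 0\<close> drops out of everything below.\<close>

definition addr :: "(nat \<Rightarrow> real) \<Rightarrow> real \<Rightarrow> real" where
  "addr r u = frac u / r 0"

definition next_u :: "(nat \<Rightarrow> real) \<Rightarrow> (nat \<Rightarrow> int) \<Rightarrow> real \<Rightarrow> real" where
  "next_u r e u = - of_int (e 1) * addr r u"

definition hgt_inv :: "real \<Rightarrow> real \<Rightarrow> real \<Rightarrow> real" where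
  "hgt_inv r x v = (THE y. hgt r x y = v)"

primrec pull :: "nat \<Rightarrow> (nat \<Rightarrow> real) \<Rightarrow> (nat \<Rightarrow> int) \<Rightarrow> real \<Rightarrow> real \<Rightarrow> real" where
  "pull 0 r e u t = t"
| "pull (Suc m) r e u t = hgt (r 0) (addr r u) (pull m (sh r) (sh e) (next_u r e u) t)"

primrec deep :: "nat \<Rightarrow> (nat \<Rightarrow> real) \<Rightarrow> (nat \<Rightarrow> int) \<Rightarrow> real \<Rightarrow> real \<Rightarrow> real" where
  "deep 0 r e u y = y"
| "deep (Suc m) r e u y = deep m (sh r) (sh e) (next_u r e u) (hgt_inv (r 0) (addr r u) y)"

text \<open>\<open>pull m\<close> composes \<open>m\<close> vertical maps, \<open>deep m\<close> is its
  inverse. The fibre of the model over \<open>u\<close> consists of the heights whose whole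
  inverse trajectory stays above \<open>-1\<close>, and \<open>rot\<close> is the map T in
  height coordinates.\<close>

definition fib :: "(nat \<Rightarrow> real) \<Rightarrow> (nat \<Rightarrow> int) \<Rightarrow> real \<Rightarrow> real \<Rightarrow> bool" where
  "fib r e u y \<longleftrightarrow> (\<forall>m. -1 \<le> deep m r e u y)"

definition rot :: "(nat \<Rightarrow> real) \<Rightarrow> (nat \<Rightarrow> int) \<Rightarrow> real \<Rightarrow> real \<Rightarrow> real" where
  "rot r e u y = lim (\<lambda>m. pull m r e (u + r 0) (deep m r e u y))"

section \<open>Addresses, positions and the gluing of branches\<close>

lemma cf_system_sh: "cf_system r e \<Longrightarrow> cf_system (sh r) (sh e)"
  by (simp add: cf_system_def sh_def)

lemma cf_systemD:
  assumes "cf_system r e"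
  shows "0 < r n" "r n \<le> 1/2" "r n \<noteq> 0" "e n = 1 \<or> e n = -1"
  using assms by (auto simp: cf_system_def dest: spec[of _ n])

lemma cf_system_int:
  assumes "cf_system r e"
  obtains a :: int where "1 / r 0 = of_int a + of_int (e 1) * r 1"
  using assms by (auto simp: cf_system_def dest: spec[of _ 0])

text \<open>\<open>next_u\<close> carries the factor \<open>- e 1\<close>. Multiplied out, raising
  an address by \<open>1 / r 0\<close> lowers the next position by \<open>r 1\<close> modulo
  integers, whatever the sign.\<close>

lemma cf_system_int':
  assumes "cf_system r e"
  obtains a :: int where "of_int (e 1) * (1 / r 0) = of_int a + r 1"
proof -
  obtain a :: int where a: "1 / r 0 = of_int a + of_int (e 1) * r 1"
    using cf_system_int[OF assms] .
  have "of_int (e 1) * (1 / r 0) = of_int (e 1 * a) + of_int (e 1 * e 1) * r 1"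
    unfolding a by (simp add: algebra_simps)
  moreover have "e 1 * e 1 = 1" using cf_systemD(4)[OF assms, of 1] by auto
  ultimately have "of_int (e 1) * (1 / r 0) = of_int (e 1 * a) + r 1" by (simp only: of_int_1 mult_1)
  then show thesis by (rule that)
qed

lemma addr_bounds:
  assumes "cf_system r e"
  shows "0 \<le> addr r u" "addr r u < 1 / r 0"
  using cf_systemD(1)[OF assms, of 0] frac_lt_1[of u] by (auto simp: addr_def divide_strict_right_mono)

lemma addr_eq: "cf_system r e \<Longrightarrow> u = of_int \<lfloor>u\<rfloor> + r 0 * addr r u"
  using cf_systemD(3)[of r e 0] by (simp add: addr_def frac_def)

lemma addr_cong: "u' = u + of_int k \<Longrightarrow> addr r u' = addr r u"
  by (simp add: addr_def frac_def)

lemma addr_of: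
  assumes "cf_system r e" "0 \<le> x" "x < 1 / r 0"
  shows "addr r (of_int k + r 0 * x) = x"
proof -
  have "0 \<le> r 0 * x" "r 0 * x < 1"
    using assms cf_systemD[OF assms(1), of 0] by (auto simp: field_simps)
  then have "frac (of_int k + r 0 * x) = r 0 * x"
    by (subst frac_unique_iff) auto
  then show ?thesis using cf_systemD(3)[OF assms(1)] by (simp add: addr_def)
qed

lemma next_u_cong: "u' = u + of_int k \<Longrightarrow> next_u r e u' = next_u r e u"
  by (simp add: next_u_def addr_cong)

lemma pull_cong:
  assumes "u' = u + of_int k"
  shows "pull m r e u' t = pull m r e u t"
  using addr_cong[OF assms, of r] next_u_cong[OF assms, of r e] by (cases m) simp_all

lemma pull_0_zero [simp]: "pull m r e 0 0 = 0"
  by (induction m arbitrary: r e) (simp_all add: addr_def next_u_def)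

text \<open>The consistency relation of the construction: since \<open>hgt r\<close> agrees at
  \<open>0\<close>, \<open>1/r - 1\<close> and \<open>1/r\<close>, both ends of the interval
  \<open>[0, 1/r]\<close> give the same fibre, although the next positions differ.\<close>

lemma pull_minus_r:
  assumes "cf_system r e"
  shows "pull m r e (- r 0) t = pull m r e 0 t"
  using assms
proof (induction m arbitrary: r e)
  case (Suc m)
  note r = cf_systemD[OF Suc.prems, of 0]
  have "- r 0 = of_int (-1) + r 0 * (1 / r 0 - 1)" using r by (simp add: field_simps)
  moreover have "1 \<le> 1 / r 0" using r by (simp add: field_simps)
  ultimately have x: "addr r (- r 0) = 1 / r 0 - 1"
    using addr_of[OF Suc.prems, of "1 / r 0 - 1" "-1"] by simp
  obtain a :: int where a: "of_int (e 1) * (1 / r 0) = of_int a + r 1"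
    using cf_system_int'[OF Suc.prems] .
  have "next_u r e (- r 0) = - (sh r 0) + of_int (e 1 - a)"
    using a by (simp add: next_u_def x sh_def algebra_simps)
  then have "pull m (sh r) (sh e) (next_u r e (- r 0)) t = pull m (sh r) (sh e) 0 t"
    using pull_cong Suc.IH[OF cf_system_sh[OF Suc.prems]] by metis
  moreover have "hgt (r 0) (1 / r 0 - 1) y = hgt (r 0) 0 y" for y
    using hgt_periodic[OF r(3), of "-1" y] hgt_minus_one by simp
  ultimately show ?case by (simp add: x) (simp add: addr_def next_u_def)
qed simp

text \<open>The recursion of \<open>pull\<close> on a closed range of addresses. At
  \<open>x = 1 / r 0\<close> the actual address is \<open>0\<close>: the heights agree by
  periodicity, and the next positions \<open>0\<close> and \<open>- r 1\<close> carry the same maps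
  by \<open>pull_minus_r\<close>. Continuity and gluing below go through this form.\<close>

lemma pull_branch:
  assumes "cf_system r e" "0 \<le> x" "x \<le> 1 / r 0"
  shows "pull (Suc m) r e (of_int k + r 0 * x) t
     = hgt (r 0) x (pull m (sh r) (sh e) (- of_int (e 1) * x) t)"
proof (cases "x < 1 / r 0")
  case True
  then show ?thesis by (simp add: addr_of[OF assms(1,2)] next_u_def)
next
  case False
  then have x: "x = 1 / r 0" using assms by simp
  note r = cf_systemD[OF assms(1), of 0]
  have "pull (Suc m) r e (of_int k + r 0 * x) t = pull (Suc m) r e 0 t"
    by (rule pull_cong[of _ _ "k + 1"]) (use r x in simp)
  moreover obtain a :: int where a: "of_int (e 1) * (1 / r 0) = of_int a + r 1"
    using cf_system_int'[OF assms(1)] .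
  have "pull m (sh r) (sh e) (- of_int (e 1) * x) t = pull m (sh r) (sh e) (- (sh r 0)) t"
    by (rule pull_cong[of _ _ "- a"]) (use a x in \<open>simp add: sh_def\<close>)
  moreover have "hgt (r 0) x y = hgt (r 0) 0 y" for y
    using hgt_periodic[OF r(3), of 0 y] x by simp
  ultimately show ?thesis
    using pull_minus_r[OF cf_system_sh[OF assms(1)]] by (simp add: addr_def next_u_def)
qed

section \<open>Monotonicity, contraction and inversion\<close>

lemma pull_strict_mono:
  "cf_system r e \<Longrightarrow> t < t' \<Longrightarrow> pull m r e u t < pull m r e u t'"
  by (induction m arbitrary: r e u)
    (auto intro!: hgt_strict_mono cf_system_sh intro: cf_systemD(1,2))

lemma pull_mono:
  "cf_system r e \<Longrightarrow> t \<le> t' \<Longrightarrow> pull m r e u t \<le> pull m r e u t'"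
  using pull_strict_mono[of r e t t' m u] by (cases "t = t'") auto

lemma pull_lipschitz:
  assumes "cf_system r e"
  shows "\<bar>pull m r e u t - pull m r e u t'\<bar> \<le> (2/3)^m * \<bar>t - t'\<bar>"
  using assms
proof (induction m arbitrary: r e u)
  case (Suc m)
  have "\<bar>pull (Suc m) r e u t - pull (Suc m) r e u t'\<bar>
     \<le> 2/3 * \<bar>pull m (sh r) (sh e) (next_u r e u) t - pull m (sh r) (sh e) (next_u r e u) t'\<bar>"
    using hgt_lipschitz_y[OF cf_systemD(1,2)[OF Suc.prems]] by simp
  also have "\<dots> \<le> 2/3 * ((2/3)^m * \<bar>t - t'\<bar>)"
    using Suc.IH[OF cf_system_sh[OF Suc.prems]] by (intro mult_left_mono) auto
  finally show ?case by simp
qed simp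

lemma hgt_inv:
  assumes "0 < r" "r \<le> 1/2"
  shows "hgt r x (hgt_inv r x v) = v"
proof -
  obtain y where y: "hgt r x y = v" using hgt_surj[OF assms] by blast
  have "\<exists>!y. hgt r x y = v"
  proof (rule ex1I)
    show "hgt r x y = v" by (rule y)
  next
    fix z assume "hgt r x z = v"
    then show "z = y" using y hgt_strict_mono[OF assms, of y z x] hgt_strict_mono[OF assms, of z y x]
      by (cases y z rule: linorder_cases) auto
  qed
  then show ?thesis unfolding hgt_inv_def by (rule theI')
qed

lemma hgt_inv_eq:
  assumes "0 < r" "r \<le> 1/2" "hgt r x y = v"
  shows "hgt_inv r x v = y"
  using hgt_inv[OF assms(1,2), of x v] assms(3) hgt_strict_mono[OF assms(1,2), of y "hgt_inv r x v" x]
    hgt_strict_mono[OF assms(1,2), of "hgt_inv r x v" y x]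
  by (cases y "hgt_inv r x v" rule: linorder_cases) auto

lemma pull_deep: "cf_system r e \<Longrightarrow> pull m r e u (deep m r e u y) = y"
proof (induction m arbitrary: r e u y)
  case (Suc m)
  then show ?case
    using hgt_inv[OF cf_systemD(1,2)[OF Suc.prems]] by (simp add: cf_system_sh)
qed simp

lemma deep_eqI:
  assumes "cf_system r e" "pull m r e u t = y"
  shows "deep m r e u y = t"
  using pull_deep[OF assms(1), of m u y] assms(2)
    pull_strict_mono[OF assms(1), of t "deep m r e u y" m u]
    pull_strict_mono[OF assms(1), of "deep m r e u y" t m u]
  by (cases t "deep m r e u y" rule: linorder_cases) auto

lemma deep_cong:
  assumes "u' = u + of_int k"
  shows "deep m r e u' y = deep m r e u y"
  using addr_cong[OF assms, of r] next_u_cong[OF assms, of r e] by (cases m) simp_all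

text \<open>Turns the condition of \<open>fib\<close> at depth \<open>m\<close> into the lower bound
  \<open>pull m r e u (-1) \<le> y\<close> on the height itself; in this form fibres are compared
  with the sets of the construction.\<close>

lemma deep_le_iff:
  assumes "cf_system r e"
  shows "t \<le> deep m r e u y \<longleftrightarrow> pull m r e u t \<le> y"
  using pull_deep[OF assms, of m u y] pull_mono[OF assms, of t "deep m r e u y" m u]
    pull_strict_mono[OF assms, of "deep m r e u y" t m u]
  by (cases "t \<le> deep m r e u y") auto

lemma deep_branch:
  assumes "cf_system r e" "0 \<le> x" "x \<le> 1 / r 0"
  shows "deep (Suc m) r e (of_int k + r 0 * x) (hgt (r 0) x y)
     = deep m (sh r) (sh e) (- of_int (e 1) * x) y"
  by (rule deep_eqI[OF assms(1)])
    (simp only: pull_branch[OF assms] pull_deep[OF cf_system_sh[OF assms(1)]])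

lemma pull_ge_minus_one:
  "cf_system r e \<Longrightarrow> -1 \<le> t \<Longrightarrow> -1 \<le> pull m r e u t"
  by (induction m arbitrary: r e u)
    (auto intro!: less_imp_le[OF hgt_gt_minus_one] cf_system_sh intro: cf_systemD(1,2))

section \<open>Fibres\<close>

lemma fib_cong:
  assumes "u' = u + of_int k"
  shows "fib r e u' y = fib r e u y"
  unfolding fib_def deep_cong[OF assms] ..

lemma all_nat_split: "(\<forall>m. P m) \<longleftrightarrow> P 0 \<and> (\<forall>m. P (Suc m))"
  by (metis not0_implies_Suc)

lemma fib_branch:
  assumes "cf_system r e" "0 \<le> x" "x \<le> 1 / r 0"
  shows "fib r e (of_int k + r 0 * x) (hgt (r 0) x y) \<longleftrightarrow> fib (sh r) (sh e) (- of_int (e 1) * x) y"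
proof -
  have "-1 \<le> hgt (r 0) x y" if "-1 \<le> y"
    using hgt_gt_minus_one[OF cf_systemD(1,2)[OF assms(1)] that, of 0 x] by simp
  moreover have "-1 \<le> deep 0 (sh r) (sh e) (- of_int (e 1) * x) y \<longleftrightarrow> -1 \<le> y" by simp
  ultimately show ?thesis
    unfolding fib_def
    by (subst all_nat_split) (use deep_branch[OF assms] in \<open>auto dest: spec[of _ 0]\<close>)
qed

text \<open>A point at height \<open>y\<close> has modulus \<open>exp (- (2 * pi * y))\<close>, so
  this is star-likeness about 0.\<close>

lemma fib_mono:
  assumes "cf_system r e" "fib r e u y" "y \<le> y'"
  shows "fib r e u y'"
  using assms unfolding fib_def by (metis deep_le_iff order_trans)

lemma fib_0: "cf_system r e \<Longrightarrow> fib r e 0 0"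
  using deep_eqI[of r e _ 0 0 0] by (simp add: fib_def)

lemma fib_ge: "fib r e u y \<Longrightarrow> -1 \<le> y"
  by (metis deep.simps(1) fib_def)

text \<open>By contraction, \<open>-1\<close> may be replaced by any lower bound in the definition of
  the fibre; this makes its invariance under maps of bounded displacement immediate.\<close>

lemma bounded_below_imp_ge:
  assumes "cf_system r e" "\<And>m. B \<le> deep m r e u y"
  shows "-1 \<le> y"
proof -
  define b where "b = min B (-1)"
  have "-1 - (2/3)^m * \<bar>-1 - b\<bar> \<le> y" for m
  proof -
    have "pull m r e u b \<le> y"
      using assms(2)[of m] deep_le_iff[OF assms(1), of b m u y] by (auto simp: b_def)
    then show ?thesis
      using pull_lipschitz[OF assms(1), of m u "-1" b] pull_ge_minus_one[OF assms(1), of "-1" m u]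
      by linarith
  qed
  moreover have "(\<lambda>m. -1 - (2/3)^m * \<bar>-1 - b\<bar>) \<longlonglongrightarrow> -1 - 0 * \<bar>-1 - b\<bar>"
    by (intro tendsto_intros LIMSEQ_power_zero) auto
  ultimately show ?thesis
    by (intro LIMSEQ_le_const2) auto
qed

lemma fib_bounded_below:
  assumes "cf_system r e" "\<And>m. B \<le> deep m r e u y"
  shows "fib r e u y"
  unfolding fib_def
proof
  fix m
  show "-1 \<le> deep m r e u y" using assms
  proof (induction m arbitrary: r e u y)
    case 0
    show ?case using bounded_below_imp_ge[of r e B u y] 0 by simp
  next
    case (Suc m)
    show ?case using Suc.IH[OF cf_system_sh[OF Suc.prems(1)], of "next_u r e u"] Suc.prems(2)[of "Suc _"] by simp
  qed
qed

section \<open>One rotation step as an odometer with carry\<close>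

lemma shift_small:
  assumes "cf_system r e" "addr r u + 1 \<le> 1 / r 0"
  shows "u + r 0 = of_int \<lfloor>u\<rfloor> + r 0 * (addr r u + 1)" "0 \<le> addr r u + 1"
    "- of_int (e 1) * (addr r u + 1) = next_u r e u + of_int (- e 1)"
  using addr_eq[OF assms(1), of u] addr_bounds[OF assms(1), of u]
  by (auto simp: next_u_def algebra_simps)

text \<open>The carry. Reducing the overflowing address by \<open>1 / r 0\<close> moves the next
  position by \<open>sh r 0\<close> up to an integer, which is the rotation step of the shifted
  system. The boundary case \<open>addr r u + 1 = 1 / r 0\<close> falls both here and under
  \<open>shift_small\<close>.\<close>

lemma shift_large:
  assumes "cf_system r e" "1 / r 0 \<le> addr r u + 1"
  obtains a :: int where "u + r 0 = of_int (\<lfloor>u\<rfloor> + 1) + r 0 * (addr r u + 1 - 1 / r 0)"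
    "0 \<le> addr r u + 1 - 1 / r 0" "addr r u + 1 - 1 / r 0 \<le> 1 / r 0"
    "- of_int (e 1) * (addr r u + 1 - 1 / r 0) = next_u r e u + sh r 0 + of_int a"
    "\<And>y. hgt (r 0) (addr r u + 1 - 1 / r 0) y = hgt (r 0) (addr r u + 1) y"
proof -
  note r = cf_systemD[OF assms(1), of 0]
  obtain a :: int where a: "of_int (e 1) * (1 / r 0) = of_int a + r 1"
    using cf_system_int'[OF assms(1)] .
  show thesis
  proof (rule that[of "a - e 1"])
    show "u + r 0 = of_int (\<lfloor>u\<rfloor> + 1) + r 0 * (addr r u + 1 - 1 / r 0)"
      using addr_eq[OF assms(1), of u] r by (simp add: algebra_simps)
    show "- of_int (e 1) * (addr r u + 1 - 1 / r 0) = next_u r e u + sh r 0 + of_int (a - e 1)"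
      using a by (simp add: next_u_def sh_def algebra_simps)
    have "2 \<le> 1 / r 0" using r by (simp add: field_simps)
    then show "addr r u + 1 - 1 / r 0 \<le> 1 / r 0" "0 \<le> addr r u + 1 - 1 / r 0"
      using addr_bounds[OF assms(1), of u] assms(2) by auto
    show "hgt (r 0) (addr r u + 1 - 1 / r 0) y = hgt (r 0) (addr r u + 1) y" for y
      using hgt_periodic[OF r(3), of "addr r u + 1 - 1 / r 0" y] by simp
  qed
qed

lemma pull_shift_small:
  assumes "cf_system r e" "addr r u + 1 \<le> 1 / r 0"
  shows "pull (Suc m) r e (u + r 0) t
     = hgt (r 0) (addr r u + 1) (pull m (sh r) (sh e) (next_u r e u) t)"
  using pull_branch[OF assms(1) shift_small(2)[OF assms] assms(2), of m "\<lfloor>u\<rfloor>" t]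
    pull_cong[OF shift_small(3)[OF assms]]
  by (simp only: shift_small(1)[OF assms])

lemma pull_shift_large:
  assumes "cf_system r e" "1 / r 0 \<le> addr r u + 1"
  shows "pull (Suc m) r e (u + r 0) t
     = hgt (r 0) (addr r u + 1) (pull m (sh r) (sh e) (next_u r e u + sh r 0) t)"
proof -
  obtain a :: int where a: "u + r 0 = of_int (\<lfloor>u\<rfloor> + 1) + r 0 * (addr r u + 1 - 1 / r 0)"
    "0 \<le> addr r u + 1 - 1 / r 0" "addr r u + 1 - 1 / r 0 \<le> 1 / r 0"
    "- of_int (e 1) * (addr r u + 1 - 1 / r 0) = next_u r e u + sh r 0 + of_int a"
    "\<And>y. hgt (r 0) (addr r u + 1 - 1 / r 0) y = hgt (r 0) (addr r u + 1) y"
    using shift_large[OF assms] by metis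
  show ?thesis
    unfolding a(1) pull_branch[OF assms(1) a(2,3)] a(5) pull_cong[OF a(4)] ..
qed

text \<open>The change of address costs \<open>2/3\<close> at the first level, and a carry adds
  \<open>2/3\<close> of the displacement below: \<open>2 = 2/3 + 2/3 * 2\<close>.\<close>

lemma pull_shift_dist:
  assumes "cf_system r e"
  shows "\<bar>pull m r e (u + r 0) t - pull m r e u t\<bar> \<le> 2"
  using assms
proof (induction m arbitrary: r e u)
  case (Suc m)
  note r = cf_systemD[OF Suc.prems, of 0]
  define x where "x = addr r u"
  define v where "v = pull m (sh r) (sh e) (next_u r e u) t"
  define v' where "v' = pull m (sh r) (sh e) (next_u r e u + sh r 0) t"
  have 1: "\<bar>hgt (r 0) (x + 1) y - hgt (r 0) x y\<bar> \<le> 2/3" for y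
    using hgt_lipschitz_x[OF r(1,2), of "x + 1" y x] by simp
  have 2: "\<bar>hgt (r 0) (x + 1) v' - hgt (r 0) (x + 1) v\<bar> \<le> 2/3 * \<bar>v' - v\<bar>"
    using hgt_lipschitz_y[OF r(1,2)] by simp
  have 3: "\<bar>v' - v\<bar> \<le> 2" unfolding v_def v'_def using Suc.IH cf_system_sh[OF Suc.prems] by blast
  have "pull (Suc m) r e (u + r 0) t = hgt (r 0) (x + 1) v \<or> pull (Suc m) r e (u + r 0) t = hgt (r 0) (x + 1) v'"
    using pull_shift_small[OF Suc.prems, of u m t] pull_shift_large[OF Suc.prems, of u m t]
    unfolding x_def v_def v'_def by (cases "addr r u + 1 \<le> 1 / r 0") auto
  moreover have "\<bar>hgt (r 0) (x + 1) v' - hgt (r 0) x v\<bar> \<le> 2"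
    using 1[of v] order_trans[OF 2 mult_left_mono[OF 3]] by linarith
  ultimately show ?case
    using 1[of v] unfolding pull.simps(2)[of _ _ _ u] x_def[symmetric] v_def[symmetric]
    by (elim disjE) linarith+
qed simp

text \<open>Without a carry the approximations of positive depth coincide, since the levels below
  cancel against \<open>deep\<close>; with a carry the difference is that of the shifted system,
  contracted once. At depth 0 it is a displacement, hence at most \<open>2\<close>.\<close>

lemma rot_approx_step:
  assumes "cf_system r e"
  shows "\<bar>pull (Suc m) r e (u + r 0) (deep (Suc m) r e u y) - pull m r e (u + r 0) (deep m r e u y)\<bar>
     \<le> 2 * (2/3)^m"
  using assms
proof (induction m arbitrary: r e u y)
  case 0
  show ?case
    using pull_shift_dist[OF 0, of "Suc 0" u "deep (Suc 0) r e u y"] pull_deep[OF 0, of "Suc 0" u y]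
    by (simp del: pull.simps deep.simps add: pull.simps(1)[of r e] deep.simps(1)[of r e])
next
  case (Suc m)
  note r = cf_systemD[OF Suc.prems, of 0] and s = cf_system_sh[OF Suc.prems]
  define v where "v = hgt_inv (r 0) (addr r u) y"
  have d: "deep (Suc n) r e u y = deep n (sh r) (sh e) (next_u r e u) v" for n
    by (simp add: v_def)
  show ?case
  proof (cases "addr r u + 1 \<le> 1 / r 0")
    case True
    then show ?thesis
      unfolding pull_shift_small[OF Suc.prems True] d pull_deep[OF s] by simp
  next
    case False
    then have l: "1 / r 0 \<le> addr r u + 1" by simp
    have "\<bar>pull (Suc (Suc m)) r e (u + r 0) (deep (Suc (Suc m)) r e u y) - pull (Suc m) r e (u + r 0) (deep (Suc m) r e u y)\<bar>
      \<le> 2/3 * \<bar>pull (Suc m) (sh r) (sh e) (next_u r e u + sh r 0) (deep (Suc m) (sh r) (sh e) (next_u r e u) v)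
        - pull m (sh r) (sh e) (next_u r e u + sh r 0) (deep m (sh r) (sh e) (next_u r e u) v)\<bar>"
      unfolding pull_shift_large[OF Suc.prems l] d by (rule hgt_lipschitz_y[OF r(1,2)])
    also have "\<dots> \<le> 2/3 * (2 * (2/3)^m)"
      by (intro mult_left_mono Suc.IH s) simp
    finally show ?thesis by simp
  qed
qed

lemma geometric_steps_limit:
  fixes f :: "nat \<Rightarrow> real"
  assumes step: "\<And>m. \<bar>f (Suc m) - f m\<bar> \<le> C * q^m" and q: "0 \<le> q" "q < 1"
  shows "f \<longlonglongrightarrow> lim f" "\<bar>lim f - f m\<bar> \<le> C * q^m / (1 - q)"
proof -
  have sg: "summable (\<lambda>i. C * q^i)" using q by (intro summable_mult summable_geometric) auto
  have sum: "summable (\<lambda>i. f (Suc i) - f i)"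
    by (rule summable_comparison_test[OF _ sg]) (use step in auto)
  have "(\<lambda>n. \<Sum>i<n. f (Suc i) - f i) \<longlonglongrightarrow> (\<Sum>i. f (Suc i) - f i)"
    using sum by (rule summable_LIMSEQ)
  then have "(\<lambda>n. f n - f 0) \<longlonglongrightarrow> (\<Sum>i. f (Suc i) - f i)" by (simp add: sum_lessThan_telescope)
  then have "(\<lambda>n. (f n - f 0) + f 0) \<longlonglongrightarrow> (\<Sum>i. f (Suc i) - f i) + f 0"
    by (intro tendsto_intros)
  then have "convergent f" by (auto simp: convergent_def)
  then show lim: "f \<longlonglongrightarrow> lim f" by (simp add: convergent_LIMSEQ_iff)
  have b: "\<bar>f (m + k) - f m\<bar> \<le> C * q^m / (1 - q)" for k
  proof -
    have C: "0 \<le> C" using step[of 0] by simp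
    have "\<bar>f (m + k) - f m\<bar> \<le> (\<Sum>i<k. C * q^(m + i))"
    proof (induction k)
      case (Suc k)
      then show ?case using step[of "m + k"] by simp
    qed simp
    also have "\<dots> = C * q^m * (\<Sum>i<k. q^i)"
      by (simp add: power_add sum_distrib_left mult_ac)
    also have "\<dots> \<le> C * q^m * (1 / (1 - q))"
    proof (intro mult_left_mono)
      show "(\<Sum>i<k. q^i) \<le> 1 / (1 - q)"
        using q by (subst sum_gp_strict) (auto intro!: divide_right_mono)
    qed (use C q in auto)
    finally show ?thesis by simp
  qed
  have "(\<lambda>k. \<bar>f (m + k) - f m\<bar>) \<longlonglongrightarrow> \<bar>lim f - f m\<bar>"
    using LIMSEQ_ignore_initial_segment[OF lim, of m] by (intro tendsto_intros) (simp add: add.commute)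
  then show "\<bar>lim f - f m\<bar> \<le> C * q^m / (1 - q)"
    by (rule LIMSEQ_le_const2) (use b in auto)
qed

text \<open>\<open>6 = 2 / (1 - 2/3)\<close>. The rate depends neither on the system nor on the
  point, which is what joint continuity rests on.\<close>

lemma rot_limit:
  assumes "cf_system r e"
  shows "(\<lambda>m. pull m r e (u + r 0) (deep m r e u y)) \<longlonglongrightarrow> rot r e u y"
    "\<bar>rot r e u y - pull m r e (u + r 0) (deep m r e u y)\<bar> \<le> 6 * (2/3)^m"
  using geometric_steps_limit[of "\<lambda>m. pull m r e (u + r 0) (deep m r e u y)" 2 "2/3", OF rot_approx_step[OF assms]]
  unfolding rot_def by auto

lemma rot_cong:
  assumes "u' = u + of_int k"
  shows "rot r e u' y = rot r e u y"
proof -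
  have "u' + r 0 = u + r 0 + of_int k" using assms by simp
  from pull_cong[OF this] show ?thesis unfolding rot_def deep_cong[OF assms] by simp
qed

lemma rot_dist:
  assumes "cf_system r e"
  shows "\<bar>rot r e u y - y\<bar> \<le> 2"
proof -
  have "\<bar>pull m r e (u + r 0) (deep m r e u y) - y\<bar> \<le> 2" for m
    using pull_shift_dist[OF assms, of m u "deep m r e u y"] by (simp add: pull_deep[OF assms])
  moreover have "(\<lambda>m. \<bar>pull m r e (u + r 0) (deep m r e u y) - y\<bar>) \<longlonglongrightarrow> \<bar>rot r e u y - y\<bar>"
    by (intro tendsto_intros rot_limit[OF assms])
  ultimately show ?thesis by (intro LIMSEQ_le_const2) auto
qed

text \<open>Together with \<open>rot_large\<close> the functional equation of the limit map: either
  the step ends at the first level, or \<open>rot\<close> of the shifted system takes over. In the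
  boundary case both formulas are available.\<close>

lemma rot_small:
  assumes "cf_system r e" "addr r u + 1 \<le> 1 / r 0"
  shows "rot r e u y = hgt (r 0) (addr r u + 1) (hgt_inv (r 0) (addr r u) y)"
proof -
  have "pull (Suc m) r e (u + r 0) (deep (Suc m) r e u y)
     = hgt (r 0) (addr r u + 1) (hgt_inv (r 0) (addr r u) y)" for m
    unfolding pull_shift_small[OF assms] by (simp add: pull_deep cf_system_sh assms)
  then have "(\<lambda>m. pull (Suc m) r e (u + r 0) (deep (Suc m) r e u y))
     \<longlonglongrightarrow> hgt (r 0) (addr r u + 1) (hgt_inv (r 0) (addr r u) y)" by (simp del: pull.simps deep.simps)
  then show ?thesis
    using LIMSEQ_unique[OF LIMSEQ_Suc[OF rot_limit(1)[OF assms(1)]]] by blast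
qed

lemma rot_large:
  assumes "cf_system r e" "1 / r 0 \<le> addr r u + 1"
  shows "rot r e u y = hgt (r 0) (addr r u + 1)
     (rot (sh r) (sh e) (next_u r e u) (hgt_inv (r 0) (addr r u) y))"
proof -
  note r = cf_systemD[OF assms(1), of 0]
  have "(\<lambda>m. pull (Suc m) r e (u + r 0) (deep (Suc m) r e u y))
     \<longlonglongrightarrow> hgt (r 0) (addr r u + 1) (rot (sh r) (sh e) (next_u r e u) (hgt_inv (r 0) (addr r u) y))"
    unfolding pull_shift_large[OF assms] deep.simps(2)
    by (intro tendsto_hgt tendsto_const rot_limit(1) cf_system_sh assms r)
  then show ?thesis
    using LIMSEQ_unique[OF LIMSEQ_Suc[OF rot_limit(1)[OF assms(1)]]] by blast
qed

text \<open>At each depth T either leaves the height alone, the carry having stopped, or acts as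
  \<open>rot\<close> of a shifted system, to which \<open>rot_dist\<close> applies.\<close>

lemma deep_rot_dist:
  assumes "cf_system r e"
  shows "\<bar>deep m r e (u + r 0) (rot r e u y) - deep m r e u y\<bar> \<le> 2"
  using assms
proof (induction m arbitrary: r e u y)
  case 0
  then show ?case using rot_dist[OF 0] by simp
next
  case (Suc m)
  define v where "v = hgt_inv (r 0) (addr r u) y"
  have d: "deep (Suc m) r e u y = deep m (sh r) (sh e) (next_u r e u) v"
    by (simp add: v_def)
  show ?case
  proof (cases "addr r u + 1 \<le> 1 / r 0")
    case True
    note s = shift_small[OF Suc.prems True]
    have "deep (Suc m) r e (u + r 0) (rot r e u y) = deep m (sh r) (sh e) (next_u r e u) v"
      unfolding rot_small[OF Suc.prems True] v_def[symmetric] s(1)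
        deep_branch[OF Suc.prems s(2) True] deep_cong[OF s(3)] ..
    then show ?thesis by (simp only: d)
  next
    case False
    then have l: "1 / r 0 \<le> addr r u + 1" by simp
    obtain a :: int where a: "u + r 0 = of_int (\<lfloor>u\<rfloor> + 1) + r 0 * (addr r u + 1 - 1 / r 0)"
      "0 \<le> addr r u + 1 - 1 / r 0" "addr r u + 1 - 1 / r 0 \<le> 1 / r 0"
      "- of_int (e 1) * (addr r u + 1 - 1 / r 0) = next_u r e u + sh r 0 + of_int a"
      "\<And>y. hgt (r 0) (addr r u + 1 - 1 / r 0) y = hgt (r 0) (addr r u + 1) y"
      using shift_large[OF Suc.prems l] by metis
    have "deep (Suc m) r e (u + r 0) (rot r e u y)
       = deep m (sh r) (sh e) (next_u r e u + sh r 0) (rot (sh r) (sh e) (next_u r e u) v)"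
      unfolding rot_large[OF Suc.prems l] v_def[symmetric] a(1) a(5)[symmetric]
        deep_branch[OF Suc.prems a(2,3)] deep_cong[OF a(4)] ..
    then show ?thesis using Suc.IH[OF cf_system_sh[OF Suc.prems]] by (simp only: d)
  qed
qed

text \<open>\<open>-3\<close> is \<open>-1 - 2\<close>. Since any uniform lower bound characterises
  the fibre, bounded displacement gives both directions without an inverse of
  \<open>rot\<close>.\<close>

lemma fib_rot_iff:
  assumes "cf_system r e"
  shows "fib r e (u + r 0) (rot r e u y) \<longleftrightarrow> fib r e u y"
proof
  assume "fib r e (u + r 0) (rot r e u y)"
  then have "-3 \<le> deep m r e u y" for m
    using deep_rot_dist[OF assms, of m u y] unfolding fib_def by (smt (verit))
  then show "fib r e u y" by (rule fib_bounded_below[OF assms])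
next
  assume "fib r e u y"
  then have "-3 \<le> deep m r e (u + r 0) (rot r e u y)" for m
    using deep_rot_dist[OF assms, of m u y] unfolding fib_def by (smt (verit))
  then show "fib r e (u + r 0) (rot r e u y)" by (rule fib_bounded_below[OF assms])
qed

text \<open>Equal images force equal heights, or again equal images, one level deeper. Contraction
  on the way up improves the trivial bound \<open>4 = 2 + 2\<close> by the factor \<open>2/3\<close>
  per level.\<close>

lemma rot_inj_approx:
  assumes "cf_system r e" "rot r e u y = rot r e u y'"
  shows "\<bar>y - y'\<bar> \<le> 4 * (2/3)^m"
  using assms
proof (induction m arbitrary: r e u y y')
  case 0
  then show ?case using rot_dist[of r e u y] rot_dist[of r e u y'] by simp
next
  case (Suc m)
  note r = cf_systemD[OF Suc.prems(1), of 0]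
  define v where "v = hgt_inv (r 0) (addr r u) y"
  define v' where "v' = hgt_inv (r 0) (addr r u) y'"
  have inj: "z = z'" if "hgt (r 0) x z = hgt (r 0) x z'" for x z z'
    using hgt_inv_eq[OF r(1,2) that] hgt_inv_eq[OF r(1,2) refl, of x z'] by simp
  have "\<bar>v - v'\<bar> \<le> 4 * (2/3)^m"
  proof (cases "addr r u + 1 \<le> 1 / r 0")
    case True
    have "v = v'"
      using Suc.prems(2) unfolding rot_small[OF Suc.prems(1) True] v_def[symmetric] v'_def[symmetric]
      by (rule inj)
    then show ?thesis by simp
  next
    case False
    then have l: "1 / r 0 \<le> addr r u + 1" by simp
    have "rot (sh r) (sh e) (next_u r e u) v = rot (sh r) (sh e) (next_u r e u) v'"
      using Suc.prems(2) unfolding rot_large[OF Suc.prems(1) l] v_def[symmetric] v'_def[symmetric]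
      by (rule inj)
    then show ?thesis using Suc.IH[OF cf_system_sh[OF Suc.prems(1)]] by blast
  qed
  moreover have "\<bar>y - y'\<bar> \<le> 2/3 * \<bar>v - v'\<bar>"
    using hgt_lipschitz_y[OF r(1,2), of "addr r u" v v'] hgt_inv[OF r(1,2)]
    by (simp add: v_def v'_def)
  ultimately show ?case by simp
qed

lemma rot_inj:
  assumes "cf_system r e" "rot r e u y = rot r e u y'"
  shows "y = y'"
proof -
  have "(\<lambda>m. 4 * (2/3::real)^m) \<longlonglongrightarrow> 4 * 0"
    by (intro tendsto_intros LIMSEQ_power_zero) auto
  then have "\<bar>y - y'\<bar> \<le> 4 * 0"
    by (rule LIMSEQ_le_const) (use rot_inj_approx[OF assms] in auto)
  then show ?thesis by simp
qed

section \<open>Joint continuity\<close>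

text \<open>Pointwise in the index, without uniformity: the depth up to which the signs agree may
  grow along the filter. Contraction makes up for this.\<close>

definition sys_tendsto :: "('i \<Rightarrow> nat \<Rightarrow> real) \<Rightarrow> ('i \<Rightarrow> nat \<Rightarrow> int) \<Rightarrow> (nat \<Rightarrow> real) \<Rightarrow> (nat \<Rightarrow> int) \<Rightarrow> 'i filter \<Rightarrow> bool"
  where "sys_tendsto R E r e F \<longleftrightarrow>
    (\<forall>n. ((\<lambda>i. R i n) \<longlongrightarrow> r n) F) \<and> (\<forall>n. \<forall>\<^sub>F i in F. E i n = e n)"

lemma sys_tendsto_const [simp]: "sys_tendsto (\<lambda>_. r) (\<lambda>_. e) r e F"
  by (simp add: sys_tendsto_def)

lemma sys_tendsto_sh:
  "sys_tendsto R E r e F \<Longrightarrow> sys_tendsto (\<lambda>i. sh (R i)) (\<lambda>i. sh (E i)) (sh r) (sh e) F"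
  by (simp add: sys_tendsto_def sh_def)

lemma sys_tendstoD:
  assumes "sys_tendsto R E r e F"
  shows "((\<lambda>i. R i n) \<longlongrightarrow> r n) F" "((\<lambda>i. real_of_int (E i n)) \<longlongrightarrow> real_of_int (e n)) F"
proof -
  show "((\<lambda>i. R i n) \<longlongrightarrow> r n) F" using assms by (simp add: sys_tendsto_def)
  have "\<forall>\<^sub>F i in F. E i n = e n" using assms by (simp add: sys_tendsto_def)
  then have "\<forall>\<^sub>F i in F. real_of_int (E i n) = real_of_int (e n)" by eventually_elim simp
  then show "((\<lambda>i. real_of_int (E i n)) \<longlongrightarrow> real_of_int (e n)) F" by (rule tendsto_eventually)
qed

text \<open>The address jumps where \<open>U\<close> crosses an integer. Near the limit only two
  integer parts occur, and by \<open>pull_branch\<close> both branch formulas tend to the same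
  value.\<close>

lemma pull_tendsto:
  assumes "sys_tendsto R E r e F" "cf_system r e" "(U \<longlongrightarrow> u) F" "(T \<longlongrightarrow> t) F"
  shows "((\<lambda>i. pull m (R i) (E i) (U i) (T i)) \<longlongrightarrow> pull m r e u t) F"
  using assms
proof (induction m arbitrary: R E r e U u)
  case (Suc m)
  note r = cf_systemD[OF Suc.prems(2), of 0]
  \<comment> \<open>The recursion with the integer part \<open>k\<close> prescribed; unlike
    \<open>addr\<close> it depends continuously on \<open>U i\<close>.\<close>
  define G where "G k i = hgt (R i 0) ((U i - of_int k) / R i 0) (pull m (sh (R i)) (sh (E i))
      (- of_int (E i 1) * ((U i - of_int k) / R i 0)) (T i))" for k :: int and i
  have G: "(G k \<longlongrightarrow> pull (Suc m) r e u t) F" if k: "of_int k \<le> u" "u \<le> of_int k + 1" for k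
  proof -
    define x where "x = (u - of_int k) / r 0"
    have x: "0 \<le> x" "x \<le> 1 / r 0" "u = of_int k + r 0 * x"
      using r k by (auto simp: x_def divide_right_mono)
    have "(G k \<longlongrightarrow> hgt (r 0) x (pull m (sh r) (sh e) (- of_int (e 1) * x) t)) F"
      unfolding G_def x_def
      by (intro tendsto_hgt Suc.IH tendsto_intros sys_tendsto_sh cf_system_sh Suc.prems r
          sys_tendstoD[OF Suc.prems(1)])
    then show ?thesis unfolding x(3) pull_branch[OF Suc.prems(2) x(1,2)] .
  qed
  have p: "pull (Suc m) (R i) (E i) (U i) (T i) = G \<lfloor>U i\<rfloor> i" for i
    by (simp add: G_def addr_def next_u_def frac_def)
  \<comment> \<open>\<open>\<lceil>u\<rceil> - 1\<close> equals \<open>\<lfloor>u\<rfloor>\<close>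
    unless \<open>u\<close> is an integer, when it is the integer part just below
    \<open>u\<close>.\<close>
  have "((\<lambda>i. if \<lfloor>U i\<rfloor> = \<lfloor>u\<rfloor> then G \<lfloor>u\<rfloor> i else G (\<lceil>u\<rceil> - 1) i) \<longlongrightarrow> pull (Suc m) r e u t) F"
    by (intro filterlim_If tendsto_mono[OF inf_le1] G) linarith+
  moreover have "\<forall>\<^sub>F i in F. (if \<lfloor>U i\<rfloor> = \<lfloor>u\<rfloor> then G \<lfloor>u\<rfloor> i else G (\<lceil>u\<rceil> - 1) i)
      = pull (Suc m) (R i) (E i) (U i) (T i)"
  proof -
    have "\<forall>\<^sub>F i in F. of_int (\<lceil>u\<rceil> - 1) < U i" "\<forall>\<^sub>F i in F. U i < of_int (\<lfloor>u\<rfloor> + 1)"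
      by (rule order_tendstoD[OF Suc.prems(3)]; linarith)+
    then show ?thesis
    proof eventually_elim
      case (elim i)
      then have "\<lfloor>U i\<rfloor> = \<lfloor>u\<rfloor> \<or> \<lfloor>U i\<rfloor> = \<lceil>u\<rceil> - 1" by linarith
      then show ?case by (auto simp: p simp del: pull.simps)
    qed
  qed
  ultimately show ?case by (rule Lim_transform_eventually)
qed simp

text \<open>The inverse has no formula in which to pass to the limit. Bounds on \<open>deep\<close>
  are turned by \<open>deep_le_iff\<close> into bounds on \<open>pull\<close> at a fixed test
  height, where \<open>pull_tendsto\<close> applies.\<close>

lemma deep_tendsto:
  assumes "sys_tendsto R E r e F" "cf_system r e" "\<forall>\<^sub>F i in F. cf_system (R i) (E i)"
    "(U \<longlongrightarrow> u) F" "(V \<longlongrightarrow> y) F"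
  shows "((\<lambda>i. deep m (R i) (E i) (U i) (V i)) \<longlongrightarrow> deep m r e u y) F"
proof (rule order_tendstoI)
  note P = pull_tendsto[OF assms(1,2,4) tendsto_const, of m]
  fix a assume a: "a < deep m r e u y"
  \<comment> \<open>A midpoint, because \<open>deep_le_iff\<close> yields only a weak inequality
    against the test height.\<close>
  define b where "b = (a + deep m r e u y) / 2"
  have b: "a < b" "b < deep m r e u y" using a by (auto simp: b_def)
  have "pull m r e u b < pull m r e u (deep m r e u y)" using b assms(2) by (intro pull_strict_mono)
  then have "pull m r e u b < y" using pull_deep[OF assms(2)] by simp
  then have "\<forall>\<^sub>F i in F. 0 < V i - pull m (R i) (E i) (U i) b"
    by (intro order_tendstoD[OF tendsto_diff[OF assms(5) P]]) auto
  with assms(3) show "\<forall>\<^sub>F i in F. a < deep m (R i) (E i) (U i) (V i)"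
  proof eventually_elim
    case (elim i)
    then have "b \<le> deep m (R i) (E i) (U i) (V i)" by (subst deep_le_iff) auto
    then show ?case using b by simp
  qed
next
  note P = pull_tendsto[OF assms(1,2,4) tendsto_const, of m]
  fix a assume "deep m r e u y < a"
  then have "y < pull m r e u a" using deep_le_iff[OF assms(2), of a m u y] by simp
  then have "\<forall>\<^sub>F i in F. 0 < pull m (R i) (E i) (U i) a - V i"
    by (intro order_tendstoD[OF tendsto_diff[OF P assms(5)]]) auto
  with assms(3) show "\<forall>\<^sub>F i in F. deep m (R i) (E i) (U i) (V i) < a"
  proof eventually_elim
    case (elim i)
    then show ?case using deep_le_iff[of "R i" "E i" a m "U i" "V i"] by simp
  qed
qed

text \<open>Uniform approximation: one depth \<open>m\<close> serves the limit system and all nearby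
  ones, and at that depth everything is a finite composition.\<close>

lemma rot_tendsto:
  assumes "sys_tendsto R E r e F" "cf_system r e" "\<forall>\<^sub>F i in F. cf_system (R i) (E i)"
    "(U \<longlongrightarrow> u) F" "(V \<longlongrightarrow> y) F"
  shows "((\<lambda>i. rot (R i) (E i) (U i) (V i)) \<longlongrightarrow> rot r e u y) F"
proof (rule tendstoI)
  fix \<epsilon> :: real assume "0 < \<epsilon>"
  have "(\<lambda>m. 6 * (2/3::real)^m) \<longlonglongrightarrow> 6 * 0" by (intro tendsto_intros LIMSEQ_power_zero) auto
  then have "\<forall>\<^sub>F m in sequentially. 6 * (2/3::real)^m < \<epsilon>/3"
    by (rule order_tendstoD) (use \<open>0 < \<epsilon>\<close> in simp)
  then obtain m where m: "6 * (2/3::real)^m < \<epsilon>/3" by (auto simp: eventually_sequentially)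
  have "((\<lambda>i. pull m (R i) (E i) (U i + R i 0) (deep m (R i) (E i) (U i) (V i)))
      \<longlongrightarrow> pull m r e (u + r 0) (deep m r e u y)) F"
    by (intro pull_tendsto tendsto_intros deep_tendsto assms sys_tendstoD[OF assms(1)])
  then have "\<forall>\<^sub>F i in F. dist (pull m (R i) (E i) (U i + R i 0) (deep m (R i) (E i) (U i) (V i)))
      (pull m r e (u + r 0) (deep m r e u y)) < \<epsilon>/3"
    using \<open>0 < \<epsilon>\<close> by (intro tendstoD) auto
  with assms(3) show "\<forall>\<^sub>F i in F. dist (rot (R i) (E i) (U i) (V i)) (rot r e u y) < \<epsilon>"
  proof eventually_elim
    case (elim i)
    then show ?case
      using rot_limit(2)[OF elim(1), of "U i" "V i" m] rot_limit(2)[OF assms(2), of u y m] m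
      unfolding dist_real_def by linarith
  qed
qed

lemma rot_surj:
  assumes "cf_system r e"
  shows "\<exists>y. rot r e u y = v"
proof -
  have "isCont (rot r e u) y" for y
    unfolding isCont_def
    using rot_tendsto[of "\<lambda>_. r" "\<lambda>_. e" r e "at y" "\<lambda>_. u" u "\<lambda>y. y" y] assms by simp
  moreover have "rot r e u (v - 2) \<le> v" "v \<le> rot r e u (v + 2)"
    using rot_dist[OF assms, of u "v - 2"] rot_dist[OF assms, of u "v + 2"] by auto
  ultimately show ?thesis using IVT[of "rot r e u" "v - 2" v "v + 2"] by auto
qed

section \<open>The orbit of the marked point\<close>

text \<open>The point 1 has position \<open>0\<close> and height \<open>0\<close>; these are the
  heights of its images under T, over the positions \<open>k * r 0\<close>.\<close>

primrec orbit :: "(nat \<Rightarrow> real) \<Rightarrow> (nat \<Rightarrow> int) \<Rightarrow> nat \<Rightarrow> real" where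
  "orbit r e 0 = 0"
| "orbit r e (Suc k) = rot r e (of_nat k * r 0) (orbit r e k)"

lemma orbit_tendsto:
  assumes "sys_tendsto R E r e F" "cf_system r e" "\<forall>\<^sub>F i in F. cf_system (R i) (E i)"
  shows "((\<lambda>i. orbit (R i) (E i) k) \<longlongrightarrow> orbit r e k) F"
proof (induction k)
  case (Suc k)
  then show ?case
    unfolding orbit.simps by (intro rot_tendsto assms tendsto_intros sys_tendstoD[OF assms(1)])
qed simp

lemma deep_mono:
  assumes "cf_system r e" "y \<le> y'"
  shows "deep m r e u y \<le> deep m r e u y'"
  using assms pull_deep[OF assms(1), of m u y] by (simp add: deep_le_iff)

lemma rot_mono:
  assumes "cf_system r e" "y \<le> y'"
  shows "rot r e u y \<le> rot r e u y'"
  by (rule LIMSEQ_le[OF rot_limit(1)[OF assms(1)] rot_limit(1)[OF assms(1)]])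
    (use pull_mono[OF assms(1) deep_mono[OF assms]] in blast)

text \<open>Over \<open>0\<close> all addresses are \<open>0\<close> and the vertical maps fix
  height \<open>0\<close>, so the image of \<open>-1\<close> from depth \<open>m\<close> is within
  \<open>(2/3)^m\<close> of \<open>0\<close>. In the model this says that 1 is the tip of its
  ray.\<close>

lemma fib_0_iff:
  assumes "cf_system r e"
  shows "fib r e 0 y \<longleftrightarrow> 0 \<le> y"
proof
  assume f: "fib r e 0 y"
  have "- ((2/3)^m) \<le> y" for m
  proof -
    have "pull m r e 0 (-1) \<le> y"
      using f deep_le_iff[OF assms, of "-1" m 0 y] by (simp add: fib_def)
    then show ?thesis using pull_lipschitz[OF assms, of m 0 "-1" 0] by simp
  qed
  moreover have "(\<lambda>m. - ((2/3::real)^m)) \<longlonglongrightarrow> - 0"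
    by (intro tendsto_intros LIMSEQ_power_zero) auto
  ultimately have "- 0 \<le> y" by (intro LIMSEQ_le_const2[where a = y]) auto
  then show "0 \<le> y" by simp
qed (use fib_mono[OF assms fib_0[OF assms]] in auto)

text \<open>\<open>rot\<close> is an increasing bijection of lines that carries fibres onto fibres,
  so tips go to tips.\<close>

lemma fib_orbit_iff:
  assumes "cf_system r e"
  shows "fib r e (of_nat k * r 0) y \<longleftrightarrow> orbit r e k \<le> y"
proof (induction k arbitrary: y)
  case (Suc k)
  obtain z where z: "rot r e (of_nat k * r 0) z = y" using rot_surj[OF assms] by blast
  have "fib r e (of_nat (Suc k) * r 0) y \<longleftrightarrow> fib r e (of_nat k * r 0) z"
    using fib_rot_iff[OF assms, of "of_nat k * r 0" z] z by (simp add: algebra_simps)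
  also have "\<dots> \<longleftrightarrow> orbit r e k \<le> z" by (rule Suc.IH)
  also have "\<dots> \<longleftrightarrow> orbit r e (Suc k) \<le> y"
    using rot_mono[OF assms, of "orbit r e k" z "of_nat k * r 0"]
      rot_mono[OF assms, of z "orbit r e k" "of_nat k * r 0"]
      rot_inj[OF assms, of "of_nat k * r 0" "orbit r e k" z] z
    by (cases "orbit r e k \<le> z") auto
  finally show ?case .
qed (simp add: fib_0_iff[OF assms])

lemma closed_segment_trans:
  fixes x b x' z :: real
  assumes "z \<in> closed_segment x b" "b \<in> closed_segment x x'"
  shows "z \<in> closed_segment x x'"
  using assms by (auto simp: closed_segment_eq_real_ivl split: if_splits)

lemma segment_affine_iff:
  fixes a c x z b :: real
  assumes "0 < c"
  shows "a + c * z \<in> closed_segment (a + c * x) (a + c * b) \<longleftrightarrow> z \<in> closed_segment x b"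
  using assms by (auto simp: closed_segment_eq_real_ivl)

text \<open>Moving the position at depth \<open>m\<close> towards an integer moves \<open>u\<close> and
  all intermediate addresses monotonically. If an address leaves \<open>[0, 1/r]\<close> on
  the way, the motion is stopped at the end point, which already belongs to the orbit of
  \<open>0\<close>. Stating the estimate along the whole segment lets the induction stop
  early.\<close>

lemma orbit_point_near:
  assumes "cf_system r e" "\<sigma> \<in> {1, -1::int}"
  shows "\<exists>u'. (\<exists>(k::nat) l::int. u' = of_nat k * r 0 + of_int l) \<and> fib r e u' (pull m r e u' 0)
    \<and> 0 \<le> of_int \<sigma> * (u' - u)
    \<and> (\<forall>v\<in>closed_segment u u'. \<forall>t. 4 * \<bar>v - u\<bar> + \<bar>pull m r e v t - pull m r e u t\<bar> \<le> 4 * (2/3)^m)"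
  using assms
proof (induction m arbitrary: r e u \<sigma>)
  case 0
  define u' :: real where "u' = of_int (if \<sigma> = 1 then \<lceil>u\<rceil> else \<lfloor>u\<rfloor>)"
  have d: "\<bar>u' - u\<bar> \<le> 1" "0 \<le> of_int \<sigma> * (u' - u)" using 0(2) unfolding u'_def by auto linarith+
  have "4 * \<bar>v - u\<bar> \<le> 4" if "v \<in> closed_segment u u'" for v
    using that d by (auto simp: closed_segment_eq_real_ivl split: if_splits)
  moreover have "fib r e u' 0"
    using fib_cong[of u' 0 "if \<sigma> = 1 then \<lceil>u\<rceil> else \<lfloor>u\<rfloor>" r e 0] fib_0[OF 0(1)] by (simp add: u'_def)
  moreover have "u' = of_nat 0 * r 0 + of_int (if \<sigma> = 1 then \<lceil>u\<rceil> else \<lfloor>u\<rfloor>)" by (simp add: u'_def)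
  ultimately show ?case using d(2)
    by (intro exI[of _ u'] conjI ballI allI) (auto simp only: pull.simps diff_self abs_zero power_0 add_0_right mult_1_right)
next
  case (Suc m)
  note sys = Suc.prems(1)
  note r = cf_systemD[OF sys, of 0]
  define x where "x = addr r u"
  have x: "0 \<le> x" "x < 1 / r 0" "u = of_int \<lfloor>u\<rfloor> + r 0 * x"
    using addr_bounds[OF sys] addr_eq[OF sys, of u] by (auto simp: x_def)
  have e1: "e 1 = 1 \<or> e 1 = -1" using cf_systemD(4)[OF sys] .
  then have e2: "real_of_int (e 1) * real_of_int (e 1) = 1" by auto
  then have e3: "real_of_int (e 1) * (real_of_int (e 1) * z) = z" for z
    by (metis mult.assoc mult_1)
  \<comment> \<open>Passing to the next level multiplies addresses by \<open>- e 1\<close>, so the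
    side on which the target is sought changes with it.\<close>
  have "- e 1 * \<sigma> \<in> {1, -1}" using e1 Suc.prems(2) by auto
  from Suc.IH[OF cf_system_sh[OF sys] this, of "next_u r e u"]
  obtain w k l where w: "w = of_nat k * sh r 0 + of_int l" "fib (sh r) (sh e) w (pull m (sh r) (sh e) w 0)"
    "0 \<le> of_int (- e 1 * \<sigma>) * (w - next_u r e u)"
    "\<And>v t. v \<in> closed_segment (next_u r e u) w \<Longrightarrow>
      4 * \<bar>v - next_u r e u\<bar> + \<bar>pull m (sh r) (sh e) v t - pull m (sh r) (sh e) (next_u r e u) t\<bar> \<le> 4 * (2/3)^m"
    by blast
  define x' where "x' = - of_int (e 1) * w"
  have w': "w = - of_int (e 1) * x'" using e3[of w] by (simp add: x'_def)
  \<comment> \<open>\<open>x'\<close> clamped to the range of addresses; at a clamped end the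
    position is an integer.\<close>
  define b where "b = (if x' < 0 then 0 else if 1 / r 0 < x' then 1 / r 0 else x')"
  have b: "b \<in> closed_segment x x'" "0 \<le> b" "b \<le> 1 / r 0"
    using x r by (auto simp: b_def closed_segment_eq_real_ivl)
  define u' where "u' = of_int \<lfloor>u\<rfloor> + r 0 * b"
  have "0 \<le> of_int \<sigma> * (x' - x)"
    using w(3) e1 unfolding w' next_u_def x_def[symmetric] by (elim disjE) (simp_all add: algebra_simps)
  then have "0 \<le> of_int \<sigma> * (b - x)"
    using b(1) Suc.prems(2) by (auto simp: closed_segment_eq_real_ivl split: if_splits)
  moreover have "u' - u = r 0 * (b - x)" using x(3) by (simp add: u'_def algebra_simps)
  ultimately have side: "0 \<le> of_int \<sigma> * (u' - u)"
    using mult_nonneg_nonneg[of "r 0" "of_int \<sigma> * (b - x)"] r by (simp add: mult.left_commute)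
  have est: "4 * \<bar>v - u\<bar> + \<bar>pull (Suc m) r e v t - pull (Suc m) r e u t\<bar> \<le> 4 * (2/3)^Suc m"
    if "v \<in> closed_segment u u'" for v t
  proof -
    define z where "z = (v - of_int \<lfloor>u\<rfloor>) / r 0"
    have v: "v = of_int \<lfloor>u\<rfloor> + r 0 * z" using r by (simp add: z_def)
    have zb: "z \<in> closed_segment x b"
      using that x(3) segment_affine_iff[OF r(1)] unfolding v u'_def by metis
    then have z: "0 \<le> z" "z \<le> 1 / r 0" using b x by (auto simp: closed_segment_eq_real_ivl split: if_splits)
    have zx: "z \<in> closed_segment x x'" using closed_segment_trans[OF zb b(1)] .
    then have "- of_int (e 1) * z \<in> closed_segment (next_u r e u) w"
      unfolding next_u_def x_def[symmetric] w' using e1 by (auto simp: closed_segment_eq_real_ivl split: if_splits)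
    note 1 = w(4)[OF this, of t]
    define p where "p = pull m (sh r) (sh e) (- of_int (e 1) * z) t"
    define q where "q = pull m (sh r) (sh e) (next_u r e u) t"
    have "\<bar>- of_int (e 1) * z - next_u r e u\<bar> = \<bar>z - x\<bar>"
      unfolding next_u_def x_def[symmetric] using e1 by auto
    with 1 have 1: "4 * \<bar>z - x\<bar> + \<bar>p - q\<bar> \<le> 4 * (2/3)^m" by (simp add: p_def q_def)
    have "pull (Suc m) r e v t = hgt (r 0) z p" unfolding v p_def by (rule pull_branch[OF sys z])
    moreover have "pull (Suc m) r e u t = hgt (r 0) x q" by (simp add: x_def q_def)
    moreover have "\<bar>hgt (r 0) z p - hgt (r 0) z q\<bar> \<le> 2/3 * \<bar>p - q\<bar>" by (rule hgt_lipschitz_y[OF r(1,2)])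
    moreover have "\<bar>hgt (r 0) z q - hgt (r 0) x q\<bar> \<le> 2/3 * \<bar>z - x\<bar>" by (rule hgt_lipschitz_x[OF r(1,2)])
    moreover have "\<bar>v - u\<bar> \<le> 1/2 * \<bar>z - x\<bar>"
    proof -
      have "v - u = r 0 * (z - x)" using x(3) v by (simp add: algebra_simps)
      then have "\<bar>v - u\<bar> = r 0 * \<bar>z - x\<bar>" using r by (simp add: abs_mult)
      also have "\<dots> \<le> 1/2 * \<bar>z - x\<bar>" using r by (intro mult_right_mono) auto
      finally show ?thesis .
    qed
    \<comment> \<open>The weight \<open>4\<close> balances here: a unit of address costs
      \<open>2/3\<close> in height and at most \<open>1/2\<close> in position, as
      \<open>r 0 \<le> 1/2\<close>, and \<open>2/3 + 4 * (1/2) = 2/3 * 4\<close>.\<close>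
    ultimately have "4 * \<bar>v - u\<bar> + \<bar>pull (Suc m) r e v t - pull (Suc m) r e u t\<bar>
       \<le> 2/3 * (4 * \<bar>z - x\<bar> + \<bar>p - q\<bar>)" by argo
    also have "\<dots> \<le> 2/3 * (4 * (2/3)^m)" using 1 by (intro mult_left_mono) auto
    finally show ?thesis by simp
  qed
  have "(\<exists>(k::nat) l::int. u' = of_nat k * r 0 + of_int l) \<and> fib r e u' (pull (Suc m) r e u' 0)"
  proof (cases "b = x'")
    case True
    obtain a :: int where a: "of_int (e 1) * (1 / r 0) = of_int a + r 1"
      using cf_system_int'[OF sys] .
    \<comment> \<open>Rewriting \<open>r 1\<close> through \<open>1 / r 0\<close> exhibits
      \<open>r 0 * x'\<close> as \<open>N * r 0 - k\<close>. Staying at \<open>x' \<ge> 0\<close>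
      forces \<open>N \<ge> 0\<close>, so only forward images of 1 occur.\<close>
    define N where "N = e 1 * a * int k - e 1 * l"
    have "x' = - (real k / r 0) + of_int N"
    proof -
      have r1: "r (Suc 0) = of_int (e 1) * (1 / r 0) - of_int a" using a by simp
      have "x' = - (of_int (e 1) * of_int (e 1)) * (real k / r 0) + of_int (e 1) * of_int a * real k - of_int (e 1) * of_int l"
        unfolding x'_def w(1) sh_def r1 by (simp add: algebra_simps)
      then show ?thesis unfolding e2 N_def by simp
    qed
    then have N: "of_int N = x' + real k / r 0" by simp
    then have N': "r 0 * x' = - real k + of_int N * r 0" using r by (simp add: field_simps)
    have "0 \<le> real k / r 0" using r by simp
    then have "0 \<le> N" using N b(2) True by linarith
    then have "u' = of_nat (nat N) * r 0 + of_int (\<lfloor>u\<rfloor> - int k)"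
      unfolding u'_def True using N' by simp
    moreover have "fib r e u' (pull (Suc m) r e u' 0)"
      unfolding u'_def pull_branch[OF sys b(2,3)] fib_branch[OF sys b(2,3)]
      using w(2) unfolding w' True .
    ultimately show ?thesis by blast
  next
    case False
    then have "b = 0 \<or> b = 1 / r 0" by (auto simp: b_def split: if_splits)
    then have "u' = 0 + of_int \<lfloor>u\<rfloor> \<or> u' = 0 + of_int (\<lfloor>u\<rfloor> + 1)"
      using r by (auto simp: u'_def)
    then obtain j where j: "u' = 0 + of_int j" by blast
    have "u' = of_nat 0 * r 0 + of_int j" using j by simp
    moreover have "fib r e u' (pull (Suc m) r e u' 0)"
      unfolding pull_cong[OF j] pull_0_zero fib_cong[OF j] by (rule fib_0[OF sys])
    ultimately show ?thesis by blast
  qed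
  then show ?case using side est by blast
qed

text \<open>The point is taken down to depth \<open>m\<close>, its height there, at least
  \<open>-1\<close>, is raised to a nonnegative one, and the result is brought up again over a
  nearby orbit position. Raising costs \<open>(2/3)^m\<close> and the change of position
  \<open>4 * (2/3)^m\<close>, hence the \<open>5\<close>.\<close>

lemma orbit_dense:
  assumes "cf_system r e" "fib r e u y" "0 < \<epsilon>"
  shows "\<exists>(k::nat) (l::int) y'. \<bar>of_nat k * r 0 + of_int l - u\<bar> < \<epsilon> \<and> \<bar>y' - y\<bar> < \<epsilon> \<and> orbit r e k \<le> y'"
proof -
  have "(\<lambda>m. 5 * (2/3::real)^m) \<longlonglongrightarrow> 5 * 0" by (intro tendsto_intros LIMSEQ_power_zero) auto
  then have "\<forall>\<^sub>F m in sequentially. 5 * (2/3::real)^m < \<epsilon>"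
    by (rule order_tendstoD) (use assms(3) in simp)
  then obtain m where m: "5 * (2/3::real)^m < \<epsilon>" by (auto simp: eventually_sequentially)
  define t where "t = deep m r e u y"
  define t' where "t' = max t 0"
  have t: "-1 \<le> t" using assms(2) by (simp add: t_def fib_def)
  obtain u' k l where u': "u' = of_nat k * r 0 + of_int l" "fib r e u' (pull m r e u' 0)"
     "4 * \<bar>u' - u\<bar> + \<bar>pull m r e u' t' - pull m r e u t'\<bar> \<le> 4 * (2/3)^m"
    using orbit_point_near[OF assms(1), of 1 m u] ends_in_segment by (metis insertI1)
  have "\<bar>pull m r e u t' - pull m r e u t\<bar> \<le> (2/3)^m * \<bar>t' - t\<bar>"
    by (rule pull_lipschitz[OF assms(1)])
  also have "\<dots> \<le> (2/3)^m * 1" using t by (intro mult_left_mono) (auto simp: t'_def)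
  finally have 1: "\<bar>pull m r e u t' - y\<bar> \<le> (2/3)^m" by (simp add: t_def pull_deep[OF assms(1)])
  have "fib r e u' (pull m r e u' t')"
    by (rule fib_mono[OF assms(1) u'(2)]) (auto intro: pull_mono[OF assms(1)] simp: t'_def)
  then have "orbit r e k \<le> pull m r e u' t'"
    using fib_cong[OF u'(1)] fib_orbit_iff[OF assms(1)] by simp
  moreover define p where "p = (2/3::real)^m"
  then have "0 \<le> p" by simp
  then have "\<bar>u' - u\<bar> < \<epsilon>" "\<bar>pull m r e u' t' - y\<bar> < \<epsilon>"
    using 1 u'(3) m unfolding p_def[symmetric] by argo+
  ultimately show ?thesis using u'(1) by blast
qed

section \<open>Nearest-integer continued fractions\<close>

lemma infdist_Ints: "infdist x \<int> = min (frac x) (1 - frac x)" for x :: real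
proof (rule antisym)
  have "infdist x \<int> \<le> dist x (of_int \<lfloor>x\<rfloor>)" by (rule infdist_le) simp
  moreover have "infdist x \<int> \<le> dist x (of_int (\<lfloor>x\<rfloor> + 1))" by (rule infdist_le) (rule Ints_of_int)
  ultimately show "infdist x \<int> \<le> min (frac x) (1 - frac x)"
    using frac_ge_0[of x] frac_lt_1[of x] by (auto simp: dist_real_def frac_def)
  show "min (frac x) (1 - frac x) \<le> infdist x \<int>"
    unfolding infdist_notempty[OF ex_in_conv[THEN iffD1, OF exI, OF Ints_0]]
  proof (rule cINF_greatest)
    fix a :: real assume "a \<in> \<int>"
    then obtain k where k: "a = of_int k" by (auto elim: Ints_cases)
    have "k \<le> \<lfloor>x\<rfloor> \<or> \<lfloor>x\<rfloor> + 1 \<le> k" by linarith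
    then have "of_int k \<le> real_of_int \<lfloor>x\<rfloor> \<or> real_of_int \<lfloor>x\<rfloor> + 1 \<le> of_int k" by linarith
    then show "min (frac x) (1 - frac x) \<le> dist x a"
      using frac_ge_0[of x] frac_lt_1[of x] unfolding k dist_real_def frac_def by linarith
  qed (use Ints_0 in blast)
qed

lemma irrational_frac:
  fixes x :: real
  assumes "x \<notin> \<rat>"
  shows "0 < frac x" "frac x < 1" "frac x \<noteq> 1/2"
proof -
  have "x \<notin> \<int>" using assms Ints_subset_Rats by blast
  then show "0 < frac x" by (simp add: frac_gt_0_iff)
  show "frac x < 1" by (rule frac_lt_1)
  show "frac x \<noteq> 1/2"
  proof
    assume "frac x = 1/2"
    then have "x = of_int \<lfloor>x\<rfloor> + 1/2" by (simp add: frac_def)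
    moreover have "of_int \<lfloor>x\<rfloor> + 1/2 \<in> (\<rat> :: real set)" by (intro Rats_add) auto
    ultimately show False using assms by simp
  qed
qed

lemma irrational_infdist:
  fixes x :: real
  assumes "x \<notin> \<rat>"
  shows "0 < infdist x \<int>" "infdist x \<int> < 1/2" "infdist x \<int> \<notin> \<rat>"
proof -
  show "0 < infdist x \<int>" "infdist x \<int> < 1/2"
    using irrational_frac[OF assms] by (auto simp: infdist_Ints min_def)
  have "frac x \<notin> \<rat>" using assms by (metis Rats_add Rats_of_int diff_add_cancel frac_def)
  moreover from this have "1 - frac x \<notin> \<rat>" by (metis Rats_1 Rats_diff diff_diff_eq2 add_diff_cancel_left')
  ultimately show "infdist x \<int> \<notin> \<rat>" by (auto simp: infdist_Ints min_def)
qed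

text \<open>With the other sign \<open>2 * frac x\<close> would be an integer, which an irrational
  \<open>x\<close> excludes; so the descriptions in \<open>near_int\<close> and
  \<open>near_sgn\<close> have unique solutions.\<close>

lemma nearest_decomposition:
  fixes x :: real
  assumes "x \<notin> \<rat>" "e \<in> {1, -1::int}"
  shows "x = of_int a + of_int e * infdist x \<int> \<longleftrightarrow>
    (if frac x < 1/2 then a = \<lfloor>x\<rfloor> \<and> e = 1 else a = \<lfloor>x\<rfloor> + 1 \<and> e = -1)"
proof -
  define f where "f = frac x"
  have f: "0 < f" "f < 1" "f \<noteq> 1/2" using irrational_frac[OF assms(1)] by (auto simp: f_def)
  have x: "x = of_int \<lfloor>x\<rfloor> + f" by (simp add: f_def frac_def)
  have no: "2 * f \<noteq> of_int k" for k :: int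
  proof
    assume k: "2 * f = of_int k"
    then have "0 < k" "k < 2" using f by linarith+
    then have "k = 1" by simp
    then show False using k f(3) by (simp add: field_simps)
  qed
  show ?thesis
  proof (cases "f < 1/2")
    case True
    then have d: "infdist x \<int> = f" by (simp add: infdist_Ints f_def min_def)
    have "x = of_int a + f \<longleftrightarrow> a = \<lfloor>x\<rfloor>" using x by linarith
    moreover have "x \<noteq> of_int a - f" using no[of "a - \<lfloor>x\<rfloor>"] x by linarith
    ultimately show ?thesis using True assms(2) by (auto simp: d f_def[symmetric])
  next
    case False
    then have d: "infdist x \<int> = 1 - f" by (simp add: infdist_Ints f_def min_def)
    have "x = of_int a - (1 - f) \<longleftrightarrow> a = \<lfloor>x\<rfloor> + 1" using x by linarith
    moreover have "x \<noteq> of_int a + (1 - f)" using no[of "a - \<lfloor>x\<rfloor> + 1"] x by linarith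
    ultimately show ?thesis using False assms(2) by (auto simp: d f_def[symmetric])
  qed
qed

lemma near_sgn_eq:
  assumes "x \<notin> \<rat>"
  shows "near_sgn x = (if frac x < 1/2 then 1 else -1)"
  unfolding near_sgn_def
proof (rule the_equality)
  fix e :: int assume "e \<in> {1, -1} \<and> (\<exists>a::int. x = of_int a + of_int e * infdist x \<int>)"
  then show "e = (if frac x < 1/2 then 1 else -1)"
    using nearest_decomposition[OF assms, of e] by (auto simp only: split: if_splits)
next
  have "\<exists>a::int. x = of_int a + of_int (if frac x < 1/2 then 1 else -1) * infdist x \<int>"
    by (subst nearest_decomposition[OF assms]) auto
  then show "(if frac x < 1/2 then 1 else -1) \<in> {1, -1::int} \<and>
      (\<exists>a::int. x = of_int a + of_int (if frac x < 1/2 then 1 else -1) * infdist x \<int>)" by auto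
qed

lemma near_int_eq:
  assumes "x \<notin> \<rat>"
  shows "near_int x = (if frac x < 1/2 then \<lfloor>x\<rfloor> else \<lfloor>x\<rfloor> + 1)"
  unfolding near_int_def
proof (rule the_equality)
  fix a :: int assume "\<exists>e\<in>{1, -1::int}. x = of_int a + of_int e * infdist x \<int>"
  then show "a = (if frac x < 1/2 then \<lfloor>x\<rfloor> else \<lfloor>x\<rfloor> + 1)"
    using nearest_decomposition[OF assms, of _ a] by (metis (full_types))
next
  show "\<exists>e\<in>{1, -1::int}. x = of_int (if frac x < 1/2 then \<lfloor>x\<rfloor> else \<lfloor>x\<rfloor> + 1) + of_int e * infdist x \<int>"
    by (rule bexI[of _ "if frac x < 1/2 then 1 else -1"], subst nearest_decomposition[OF assms]) auto
qed

lemma near_decomp: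
  assumes "x \<notin> \<rat>"
  shows "x = of_int (near_int x) + of_int (near_sgn x) * infdist x \<int>"
  using nearest_decomposition[OF assms, of "near_sgn x" "near_int x"]
  by (simp add: near_sgn_eq[OF assms] near_int_eq[OF assms] split: if_splits)

lemma near_sgn_cases: "x \<notin> \<rat> \<Longrightarrow> near_sgn x = 1 \<or> near_sgn x = -1"
  by (simp add: near_sgn_eq)

lemma cf_rem_irrational:
  assumes "\<alpha> \<notin> \<rat>"
  shows "cf_rem \<alpha> n \<notin> \<rat>"
proof (induction n)
  case (Suc n)
  then have "1 / cf_rem \<alpha> n \<notin> \<rat>" by (metis Rats_1 Rats_divide divide_divide_eq_right div_by_1 mult_1)
  then show ?case by (simp add: irrational_infdist)
qed (simp add: assms irrational_infdist)

lemma inverse_cf_rem_irrational: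
  assumes "\<alpha> \<notin> \<rat>"
  shows "1 / cf_rem \<alpha> n \<notin> \<rat>"
  using cf_rem_irrational[OF assms] by (metis Rats_1 Rats_divide divide_divide_eq_right div_by_1 mult_1)

lemma cf_rem_bounds:
  assumes "\<alpha> \<notin> \<rat>"
  shows "0 < cf_rem \<alpha> n" "cf_rem \<alpha> n < 1/2"
proof -
  obtain x :: real where "x \<notin> \<rat>" "cf_rem \<alpha> n = infdist x \<int>"
  proof (cases n)
    case 0
    then show thesis using that[OF assms] by simp
  next
    case (Suc m)
    then show thesis using that[OF inverse_cf_rem_irrational[OF assms, of m]] by simp
  qed
  then show "0 < cf_rem \<alpha> n" "cf_rem \<alpha> n < 1/2" using irrational_infdist[of x] by simp_all
qed

lemma cf_sgn_cases:
  assumes "\<alpha> \<notin> \<rat>"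
  shows "cf_sgn \<alpha> n = 1 \<or> cf_sgn \<alpha> n = -1"
  using near_sgn_cases[OF assms] near_sgn_cases[OF inverse_cf_rem_irrational[OF assms]]
  by (cases n) (simp_all del: cf_rem.simps)

lemma cf_quot:
  assumes "\<alpha> \<notin> \<rat>"
  shows "1 / cf_rem \<alpha> n = of_int (cf_quot \<alpha> n) + of_int (cf_sgn \<alpha> (Suc n)) * cf_rem \<alpha> (Suc n)"
  unfolding cf_quot_def cf_sgn.simps cf_rem.simps
  by (rule near_decomp) (rule inverse_cf_rem_irrational[OF assms])

abbreviation cf_rem_from :: "real \<Rightarrow> nat \<Rightarrow> nat \<Rightarrow> real" where
  "cf_rem_from \<alpha> n \<equiv> \<lambda>i. cf_rem \<alpha> (n + i)"

abbreviation cf_sgn_from :: "real \<Rightarrow> nat \<Rightarrow> nat \<Rightarrow> int" where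
  "cf_sgn_from \<alpha> n \<equiv> \<lambda>i. cf_sgn \<alpha> (n + i)"

lemma sh_from [simp]:
  "sh (cf_rem_from \<alpha> n) = cf_rem_from \<alpha> (Suc n)" "sh (cf_sgn_from \<alpha> n) = cf_sgn_from \<alpha> (Suc n)"
  by (simp_all add: sh_def fun_eq_iff)

lemma cf_system_from:
  assumes "\<alpha> \<notin> \<rat>"
  shows "cf_system (cf_rem_from \<alpha> n) (cf_sgn_from \<alpha> n)"
  unfolding cf_system_def
proof (intro allI conjI)
  fix i
  show "0 < cf_rem_from \<alpha> n i" "cf_rem_from \<alpha> n i \<le> 1/2" "cf_sgn_from \<alpha> n i \<in> {1, -1}"
    using cf_rem_bounds[OF assms, of "n + i"] cf_sgn_cases[OF assms, of "n + i"] by auto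
  show "\<exists>a::int. 1 / cf_rem_from \<alpha> n i = of_int a + of_int (cf_sgn_from \<alpha> n (Suc i)) * cf_rem_from \<alpha> n (Suc i)"
    unfolding add_Suc_right by (rule exI, rule cf_quot[OF assms])
qed

lemma cf_system_cf:
  assumes "\<alpha> \<notin> \<rat>"
  shows "cf_system (cf_rem \<alpha>) (cf_sgn \<alpha>)"
  using cf_system_from[OF assms, of 0] by simp

section \<open>Symmetries of the expansion and its continuity in \<alpha>\<close>

lemma infdist_Ints_plus_int: "infdist (x + of_int k) \<int> = infdist x \<int>" for x :: real
  by (simp add: infdist_Ints frac_def)

lemma infdist_Ints_minus: "infdist (- x) \<int> = infdist x \<int>" for x :: real
proof (cases "x \<in> \<int>")
  case True
  then have "frac x = 0" by simp
  then show ?thesis using True by (simp add: infdist_Ints frac_neg del: frac_eq_0_iff)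
qed (simp add: infdist_Ints frac_neg min.commute)

lemma cf_rem_plus_one: "cf_rem (\<alpha> + 1) = cf_rem \<alpha>"
proof
  show "cf_rem (\<alpha> + 1) n = cf_rem \<alpha> n" for n
    using infdist_Ints_plus_int[of \<alpha> 1] by (induction n) simp_all
qed

lemma cf_rem_minus: "cf_rem (- \<alpha>) = cf_rem \<alpha>"
proof
  show "cf_rem (- \<alpha>) n = cf_rem \<alpha> n" for n
    using infdist_Ints_minus[of \<alpha>] by (induction n) simp_all
qed

lemma cf_sgn_plus_one:
  assumes "\<alpha> \<notin> \<rat>"
  shows "cf_sgn (\<alpha> + 1) = cf_sgn \<alpha>"
proof
  fix n
  have "\<alpha> + 1 \<notin> \<rat>" using assms by (metis Rats_1 Rats_diff add_diff_cancel_right')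
  then show "cf_sgn (\<alpha> + 1) n = cf_sgn \<alpha> n"
    using assms by (cases n) (simp_all add: near_sgn_eq cf_rem_plus_one frac_def)
qed

text \<open>Only the sign with index 0 flips, and it does not enter the height coordinates: hence
  the symmetry under conjugation.\<close>

lemma cf_sgn_minus:
  assumes "\<alpha> \<notin> \<rat>"
  shows "cf_sgn (- \<alpha>) = (cf_sgn \<alpha>)(0 := - cf_sgn \<alpha> 0)"
proof
  fix n
  have "- \<alpha> \<notin> \<rat>" using assms by (metis Rats_minus_iff)
  moreover have "frac (- \<alpha>) = 1 - frac \<alpha>" using irrational_frac[OF assms] by (auto simp: frac_neg)
  ultimately show "cf_sgn (- \<alpha>) n = ((cf_sgn \<alpha>)(0 := - cf_sgn \<alpha> 0)) n"
    using assms irrational_frac[OF assms] by (cases n) (auto simp: near_sgn_eq cf_rem_minus)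
qed

lemma cf_rem_0_small:
  assumes "\<bar>\<alpha>\<bar> \<le> 1/2"
  shows "cf_rem \<alpha> 0 = \<bar>\<alpha>\<bar>"
proof -
  have *: "infdist x \<int> = x" if "0 \<le> x" "x \<le> 1/2" for x :: real
  proof -
    have "frac x = x" using that by (simp add: frac_eq)
    then show ?thesis using that by (simp add: infdist_Ints)
  qed
  show ?thesis using *[of "\<bar>\<alpha>\<bar>"] assms infdist_Ints_minus[of \<alpha>] by (cases "0 \<le> \<alpha>") auto
qed

lemma cf_sgn_0_small:
  assumes "\<alpha> \<notin> \<rat>" "0 < \<alpha>" "\<alpha> < 1/2"
  shows "cf_sgn \<alpha> 0 = 1"
proof -
  have "frac \<alpha> = \<alpha>" using assms by (simp add: frac_eq)
  then show ?thesis using assms by (simp add: near_sgn_eq)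
qed

lemma cf_inverse:
  assumes "0 < \<alpha>" "\<alpha> < 1/2"
  shows "cf_rem (1 / \<alpha>) = sh (cf_rem \<alpha>)" "cf_sgn (1 / \<alpha>) = sh (cf_sgn \<alpha>)"
proof -
  have 0: "cf_rem \<alpha> 0 = \<alpha>" using assms by (subst cf_rem_0_small) auto
  have "cf_rem (1 / \<alpha>) n = sh (cf_rem \<alpha>) n" for n
    by (induction n) (simp_all add: sh_def 0 del: cf_rem.simps(1), simp_all add: 0 cf_rem.simps(1)[of "1/\<alpha>"])
  then show *: "cf_rem (1 / \<alpha>) = sh (cf_rem \<alpha>)" by blast
  show "cf_sgn (1 / \<alpha>) = sh (cf_sgn \<alpha>)"
  proof
    fix n
    show "cf_sgn (1 / \<alpha>) n = sh (cf_sgn \<alpha>) n"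
    proof (cases n)
      case 0
      then show ?thesis using \<open>cf_rem \<alpha> 0 = \<alpha>\<close> by (simp add: sh_def del: cf_rem.simps)
    qed (simp add: sh_def * del: cf_rem.simps)
  qed
qed

text \<open>An irrational lies strictly inside a half-unit interval on which the integer part and
  the nearer side are constant.\<close>

lemma near_sgn_eventually:
  assumes "(f \<longlongrightarrow> x) F" "x \<notin> \<rat>" "\<forall>\<^sub>F i in F. f i \<notin> \<rat>"
  shows "\<forall>\<^sub>F i in F. near_sgn (f i) = near_sgn x"
proof -
  note x = irrational_frac[OF assms(2)]
  define a where "a = (if frac x < 1/2 then real_of_int \<lfloor>x\<rfloor> else of_int \<lfloor>x\<rfloor> + 1/2)"
  have "a < x" "x < a + 1/2" using x by (auto simp: a_def frac_def)
  then have "\<forall>\<^sub>F i in F. a < f i" "\<forall>\<^sub>F i in F. f i < a + 1/2"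
    using order_tendstoD[OF assms(1)] by auto
  with assms(3) show ?thesis
  proof eventually_elim
    case (elim i)
    have "\<lfloor>f i\<rfloor> = \<lfloor>x\<rfloor>" using elim unfolding a_def by (auto split: if_splits) linarith+
    then have "frac (f i) < 1/2 \<longleftrightarrow> frac x < 1/2"
      using elim by (auto simp: a_def frac_def split: if_splits)
    then show ?case using near_sgn_eq elim(1) assms(2) by simp
  qed
qed

lemma cf_rem_tendsto:
  assumes "\<alpha> \<notin> \<rat>" "(A \<longlongrightarrow> \<alpha>) F"
  shows "((\<lambda>i. cf_rem (A i) n) \<longlongrightarrow> cf_rem \<alpha> n) F"
proof (induction n)
  case (Suc n)
  then show ?case
    unfolding cf_rem.simps
    by (intro tendsto_infdist tendsto_intros) (use cf_rem_bounds[OF assms(1), of n] in auto)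
qed (auto intro!: tendsto_infdist assms)

lemma cf_tendsto:
  assumes "\<alpha> \<notin> \<rat>" "(A \<longlongrightarrow> \<alpha>) F" "\<forall>\<^sub>F i in F. A i \<notin> \<rat>"
  shows "sys_tendsto (\<lambda>i. cf_rem (A i)) (\<lambda>i. cf_sgn (A i)) (cf_rem \<alpha>) (cf_sgn \<alpha>) F"
proof -
  have "\<forall>\<^sub>F i in F. cf_sgn (A i) n = cf_sgn \<alpha> n" for n
  proof (cases n)
    case 0
    then show ?thesis using near_sgn_eventually[OF assms(2,1,3)] by simp
  next
    case (Suc m)
    have "((\<lambda>i. 1 / cf_rem (A i) m) \<longlongrightarrow> 1 / cf_rem \<alpha> m) F"
      by (intro tendsto_intros cf_rem_tendsto assms) (use cf_rem_bounds[OF assms(1), of m] in auto)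
    moreover have "\<forall>\<^sub>F i in F. 1 / cf_rem (A i) m \<notin> \<rat>"
      using assms(3) by eventually_elim (rule inverse_cf_rem_irrational)
    ultimately show ?thesis
      using near_sgn_eventually[OF _ inverse_cf_rem_irrational[OF assms(1)]] Suc by simp
  qed
  then show ?thesis unfolding sys_tendsto_def using cf_rem_tendsto[OF assms(1,2)] by blast
qed

section \<open>The sets in terms of heights\<close>

lemma YY_eq:
  assumes "\<alpha> \<notin> \<rat>" "-1 \<le> Im w"
  shows "Re (YY \<alpha> n w) = - (of_int (cf_sgn \<alpha> n) * cf_rem \<alpha> n * Re w)"
    "Im (YY \<alpha> n w) = hgt (cf_rem \<alpha> n) (Re w) (Im w)"
  using cf_sgn_cases[OF assms(1), of n] Y_eq_hgt[of "cf_rem \<alpha> n" w] cf_rem_bounds[OF assms(1), of n] assms(2)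
  by (auto simp: YY_def)

lemma sgn_sq: "s = 1 \<or> s = -1 \<Longrightarrow> of_int s * (of_int s * x) = (x :: real)" for s :: int
  by auto

text \<open>The j-fold image of the line at height \<open>-1\<close> is a graph over the circle, and
  this is the region above it. \<open>n\<close> is the level of the outermost map, so
  \<open>I_step \<alpha> j n\<close> belongs to \<open>above \<alpha> j (Suc n)\<close>.\<close>

definition above :: "real \<Rightarrow> nat \<Rightarrow> nat \<Rightarrow> complex \<Rightarrow> bool" where
  "above \<alpha> j n w \<longleftrightarrow> pull j (cf_rem_from \<alpha> n) (cf_sgn_from \<alpha> n) (- of_int (cf_sgn \<alpha> n) * Re w) (-1) \<le> Im w"

lemma above_YY_iff:
  assumes irr: "\<alpha> \<notin> \<rat>" and v: "-1 \<le> Im v" "0 \<le> Re v" "Re v \<le> 1 / cf_rem \<alpha> n"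
  shows "above \<alpha> (Suc j) n (YY \<alpha> n v + of_int l) \<longleftrightarrow> above \<alpha> j (Suc n) v"
proof -
  note sys = cf_system_from[OF irr, of n] and s = cf_sgn_cases[OF irr, of n]
  have u: "- of_int (cf_sgn \<alpha> n) * Re (YY \<alpha> n v + of_int l)
      = of_int (- cf_sgn \<alpha> n * l) + cf_rem_from \<alpha> n 0 * Re v"
    using s by (auto simp: YY_eq[OF irr v(1)])
  have "pull (Suc j) (cf_rem_from \<alpha> n) (cf_sgn_from \<alpha> n) (- of_int (cf_sgn \<alpha> n) * Re (YY \<alpha> n v + of_int l)) (-1)
    = hgt (cf_rem \<alpha> n) (Re v)
       (pull j (cf_rem_from \<alpha> (Suc n)) (cf_sgn_from \<alpha> (Suc n)) (- of_int (cf_sgn \<alpha> (Suc n)) * Re v) (-1))"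
    unfolding u using pull_branch[OF sys v(2), of j "- cf_sgn \<alpha> n * l" "-1"] v(3) by simp
  moreover have "hgt (cf_rem \<alpha> n) (Re v) a \<le> hgt (cf_rem \<alpha> n) (Re v) b \<longleftrightarrow> a \<le> b" for a b
    using hgt_strict_mono[OF cf_systemD(1,2)[OF sys, of 0]]
    by (metis add_0_right less_le_not_le linorder_le_cases order_less_le)
  ultimately show ?thesis
    unfolding above_def by (simp add: YY_eq[OF irr v(1)])
qed

lemma above_ge_minus_one:
  assumes "\<alpha> \<notin> \<rat>" "above \<alpha> j n w"
  shows "-1 \<le> Im w"
  using assms pull_ge_minus_one[OF cf_system_from[OF assms(1)]] unfolding above_def
  by (meson order.refl order_trans)

text \<open>Increasing maps on vertical lines carry regions above graphs to such regions, and only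
  real parts remain to be described. The predicate \<open>P\<close> handles the whole interval,
  \<open>K_part\<close> and \<open>J_part\<close> at once.\<close>

lemma image_YY:
  assumes irr: "\<alpha> \<notin> \<rat>"
  shows "(\<lambda>v. YY \<alpha> n v + of_int l) ` {v. 0 \<le> Re v \<and> Re v \<le> 1 / cf_rem \<alpha> n \<and> P (Re v) \<and> above \<alpha> j (Suc n) v}
    = {w. (\<exists>x. 0 \<le> x \<and> x \<le> 1 / cf_rem \<alpha> n \<and> P x \<and> Re w = of_int l - of_int (cf_sgn \<alpha> n) * cf_rem \<alpha> n * x)
        \<and> above \<alpha> (Suc j) n w}" (is "?f ` ?A = ?B")
proof (intro equalityI subsetI)
  fix w assume "w \<in> ?f ` ?A"
  then obtain v where v: "w = ?f v" "v \<in> ?A" by blast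
  then have v1: "-1 \<le> Im v" using above_ge_minus_one[OF irr] by blast
  then have "above \<alpha> (Suc j) n w" using v above_YY_iff[OF irr v1] by simp
  then show "w \<in> ?B" using v YY_eq(1)[OF irr v1, of n] by (auto intro!: exI[of _ "Re v"])
next
  fix w assume "w \<in> ?B"
  then obtain x where x: "0 \<le> x" "x \<le> 1 / cf_rem \<alpha> n" "P x"
    "Re w = of_int l - of_int (cf_sgn \<alpha> n) * cf_rem \<alpha> n * x" and w: "above \<alpha> (Suc j) n w" by blast
  note sys = cf_system_from[OF irr, of n]
  have r: "0 < cf_rem \<alpha> n" "cf_rem \<alpha> n \<le> 1/2" using cf_rem_bounds[OF irr, of n] by auto
  define y where "y = hgt_inv (cf_rem \<alpha> n) x (Im w)"
  have h: "hgt (cf_rem \<alpha> n) x y = Im w" unfolding y_def by (rule hgt_inv[OF r])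
  have u: "- of_int (cf_sgn \<alpha> n) * Re w = of_int (- cf_sgn \<alpha> n * l) + cf_rem_from \<alpha> n 0 * x"
    using cf_sgn_cases[OF irr, of n] by (auto simp: x(4))
  have "hgt (cf_rem \<alpha> n) x (pull j (cf_rem_from \<alpha> (Suc n)) (cf_sgn_from \<alpha> (Suc n)) (- of_int (cf_sgn \<alpha> (Suc n)) * x) (-1)) \<le> Im w"
    using w unfolding above_def u using pull_branch[OF sys x(1), of j "- cf_sgn \<alpha> n * l" "-1"] x(2) by simp
  then have a: "above \<alpha> j (Suc n) (Complex x y)"
    unfolding above_def h[symmetric] using hgt_strict_mono[OF r] by (simp add: not_le[symmetric]) (meson not_le)
  then have "-1 \<le> Im (Complex x y)" by (rule above_ge_minus_one[OF irr])
  then have "w = ?f (Complex x y)"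
    using YY_eq[OF irr, of "Complex x y" n] x(4) h by (simp add: complex_eq_iff)
  moreover have "Complex x y \<in> ?A" using x a by simp
  ultimately show "w \<in> ?f ` ?A" by blast
qed

lemma unit_branch_iff:
  fixes r X c s :: real
  assumes r: "0 < r" and s: "s = 1 \<or> s = -1"
  shows "(\<exists>x. 0 \<le> x \<and> x \<le> 1 / r \<and> X = c - s * r * x) \<longleftrightarrow> 0 \<le> s * (c - X) \<and> s * (c - X) \<le> 1"
    "(\<exists>x. 0 \<le> x \<and> x \<le> 1 / r \<and> x \<le> 1 / r - 1 \<and> X = c - s * r * x)
      \<longleftrightarrow> 0 \<le> s * (c - X) \<and> s * (c - X) \<le> 1 - r"
    "r \<le> 1 \<Longrightarrow> (\<exists>x. 0 \<le> x \<and> x \<le> 1 / r \<and> 1 / r - 1 \<le> x \<and> X = c - s * r * x)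
      \<longleftrightarrow> 1 - r \<le> s * (c - X) \<and> s * (c - X) \<le> 1"
proof -
  have eq: "X = c - s * r * x \<longleftrightarrow> x = s * (c - X) / r" for x
    using r s by (auto simp: field_simps)
  have d: "1 / r - 1 = (1 - r) / r" using r by (simp add: field_simps)
  define t where "t = s * (c - X)"
  have dc: "a / r \<le> b / r \<longleftrightarrow> a \<le> b" "0 \<le> a / r \<longleftrightarrow> 0 \<le> a" for a b
    using r by (simp_all add: divide_le_cancel zero_le_divide_iff)
  show "(\<exists>x. 0 \<le> x \<and> x \<le> 1 / r \<and> X = c - s * r * x) \<longleftrightarrow> 0 \<le> s * (c - X) \<and> s * (c - X) \<le> 1"
    using r unfolding eq d t_def[symmetric] by (auto simp: dc)
  show "(\<exists>x. 0 \<le> x \<and> x \<le> 1 / r \<and> x \<le> 1 / r - 1 \<and> X = c - s * r * x)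
      \<longleftrightarrow> 0 \<le> s * (c - X) \<and> s * (c - X) \<le> 1 - r"
    using r unfolding eq d t_def[symmetric] by (auto simp: dc)
  show "(\<exists>x. 0 \<le> x \<and> x \<le> 1 / r \<and> 1 / r - 1 \<le> x \<and> X = c - s * r * x)
      \<longleftrightarrow> 1 - r \<le> s * (c - X) \<and> s * (c - X) \<le> 1" if "r \<le> 1"
    using that r unfolding eq d t_def[symmetric] by (auto simp: dc)
qed

text \<open>For \<open>e = -1\<close> the pieces are \<open>[l, l + 1]\<close> with
  \<open>0 \<le> l \<le> a - 2\<close>, then \<open>[a - 1, a - r]\<close>; for \<open>e = 1\<close>
  they are \<open>[l - 1, l]\<close> with \<open>1 \<le> l \<le> a\<close>, then
  \<open>[a, a + r]\<close>. Either way they tile \<open>[0, a + e * r]\<close>.\<close>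

lemma branches_cover:
  fixes a :: int and e :: int and r X :: real
  assumes r: "0 < r" "r < 1/2" and a: "2 < of_int a + of_int e * r" and e: "e = 1 \<or> e = -1"
  shows "(0 \<le> X \<and> X \<le> of_int a + of_int e * r) \<longleftrightarrow>
    (if e = -1 then
       (\<exists>l\<in>{0..a - 2}. \<exists>x. 0 \<le> x \<and> x \<le> 1 / r \<and> X = of_int l - of_int e * r * x)
       \<or> (\<exists>x. 0 \<le> x \<and> x \<le> 1 / r \<and> x \<le> 1 / r - 1 \<and> X = of_int (a - 1) - of_int e * r * x)
     else
       (\<exists>l\<in>{1..a}. \<exists>x. 0 \<le> x \<and> x \<le> 1 / r \<and> X = of_int l - of_int e * r * x)
       \<or> (\<exists>x. 0 \<le> x \<and> x \<le> 1 / r \<and> 1 / r - 1 \<le> x \<and> X = of_int (a + 1) - of_int e * r * x))"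
proof -
  have s: "real_of_int e = 1 \<or> real_of_int e = -1" using e by auto
  have r1: "r \<le> 1" using r by simp
  show ?thesis unfolding unit_branch_iff(1,2)[OF r(1) s] unit_branch_iff(3)[OF r(1) s r1]
  proof (cases "e = -1")
    case True
    have "2 < real_of_int a" using True r a by simp
    then have a3: "3 \<le> a" by linarith
    have "(0 \<le> X \<and> X \<le> of_int a - r) \<longleftrightarrow> (\<exists>l\<in>{0..a - 2}. 0 \<le> X - of_int l \<and> X - of_int l \<le> 1)
       \<or> (0 \<le> X - of_int (a - 1) \<and> X - of_int (a - 1) \<le> 1 - r)" (is "?L \<longleftrightarrow> ?R")
    proof
      assume L: ?L
      show ?R
      proof (cases "X \<le> of_int (a - 1)")
        case True
        \<comment> \<open>The \<open>min\<close> assigns the end point \<open>X = a - 1\<close> to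
          the last full piece.\<close>
        have "min \<lfloor>X\<rfloor> (a - 2) \<in> {0..a - 2}" using L a3 by simp
        moreover have "0 \<le> X - of_int (min \<lfloor>X\<rfloor> (a - 2)) \<and> X - of_int (min \<lfloor>X\<rfloor> (a - 2)) \<le> 1"
          using True unfolding min_def by (cases "\<lfloor>X\<rfloor> \<le> a - 2") (simp_all, linarith+)
        ultimately show ?thesis by blast
      qed (use L in auto)
    next
      assume ?R
      then show ?L
      proof (elim disjE bexE conjE)
        fix l assume l: "l \<in> {0..a - 2}" "0 \<le> X - of_int l" "X - of_int l \<le> 1"
        then have "0 \<le> real_of_int l" "real_of_int l \<le> of_int (a - 2)" by (simp, simp only: of_int_le_iff atLeastAtMost_iff)
        then show ?thesis using l r by auto
      qed (use a3 in auto)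
    qed
    then show "(0 \<le> X \<and> X \<le> of_int a + of_int e * r) \<longleftrightarrow>
     (if e = -1 then (\<exists>l\<in>{0..a - 2}. 0 \<le> of_int e * (of_int l - X) \<and> of_int e * (of_int l - X) \<le> 1)
        \<or> (0 \<le> of_int e * (of_int (a - 1) - X) \<and> of_int e * (of_int (a - 1) - X) \<le> 1 - r)
      else (\<exists>l\<in>{1..a}. 0 \<le> of_int e * (of_int l - X) \<and> of_int e * (of_int l - X) \<le> 1)
        \<or> (1 - r \<le> of_int e * (of_int (a + 1) - X) \<and> of_int e * (of_int (a + 1) - X) \<le> 1))"
      using True by simp
  next
    case False
    then have e1: "e = 1" using e by simp
    then have "3/2 < real_of_int a" using r a by simp
    then have a2: "2 \<le> a" by linarith
    have "(0 \<le> X \<and> X \<le> of_int a + r) \<longleftrightarrow> (\<exists>l\<in>{1..a}. 0 \<le> of_int l - X \<and> of_int l - X \<le> 1)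
       \<or> (1 - r \<le> of_int (a + 1) - X \<and> of_int (a + 1) - X \<le> 1)" (is "?L \<longleftrightarrow> ?R")
    proof
      assume L: ?L
      show ?R
      proof (cases "X \<le> of_int a")
        case True
        \<comment> \<open>The \<open>max\<close> assigns \<open>X = 0\<close> to the first
          piece.\<close>
        have "max \<lceil>X\<rceil> 1 \<in> {1..a}" using True a2 by (simp add: ceiling_le_iff)
        moreover have "0 \<le> of_int (max \<lceil>X\<rceil> 1) - X \<and> of_int (max \<lceil>X\<rceil> 1) - X \<le> 1"
          using L unfolding max_def by (cases "\<lceil>X\<rceil> \<le> 1") (simp_all, linarith+)
        ultimately show ?thesis by blast
      qed (use L in auto)
    next
      assume ?R
      then show ?L
      proof (elim disjE bexE conjE)
        fix l assume l: "l \<in> {1..a}" "0 \<le> of_int l - X" "of_int l - X \<le> 1"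
        then have "1 \<le> real_of_int l" "real_of_int l \<le> of_int a" by (simp, simp only: of_int_le_iff atLeastAtMost_iff)
        then show ?thesis using l r by auto
      next
        assume "1 - r \<le> of_int (a + 1) - X" "of_int (a + 1) - X \<le> 1"
        moreover have "2 \<le> real_of_int a" using a2 by simp
        ultimately show ?thesis by simp
      qed
    qed
    then show "(0 \<le> X \<and> X \<le> of_int a + of_int e * r) \<longleftrightarrow>
     (if e = -1 then (\<exists>l\<in>{0..a - 2}. 0 \<le> of_int e * (of_int l - X) \<and> of_int e * (of_int l - X) \<le> 1)
        \<or> (0 \<le> of_int e * (of_int (a - 1) - X) \<and> of_int e * (of_int (a - 1) - X) \<le> 1 - r)
      else (\<exists>l\<in>{1..a}. 0 \<le> of_int e * (of_int l - X) \<and> of_int e * (of_int l - X) \<le> 1)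
        \<or> (1 - r \<le> of_int e * (of_int (a + 1) - X) \<and> of_int e * (of_int (a + 1) - X) \<le> 1))"
      using e1 by simp
  qed
qed

lemma Un_UN_Collect_conj_iff:
  "w \<in> (\<Union>l\<in>L. {w. P l w \<and> A w}) \<union> {w. Q w \<and> A w} \<longleftrightarrow> ((\<exists>l\<in>L. P l w) \<or> Q w) \<and> A w"
  by blast

lemma mem_if_conj_iff:
  assumes "w \<in> A \<longleftrightarrow> P \<and> R" "w \<in> B \<longleftrightarrow> Q \<and> R"
  shows "w \<in> (if b then A else B) \<longleftrightarrow> (if b then P else Q) \<and> R"
  using assms by simp

text \<open>The pieces tile the interval of real parts, and the condition on heights is the same on
  all of them because \<open>above\<close> refers to the point and not to the branch through which
  it was reached.\<close>

lemma I_step_eq: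
  assumes irr: "\<alpha> \<notin> \<rat>"
  shows "I_step \<alpha> j n = {w. 0 \<le> Re w \<and> Re w \<le> 1 / cf_rem \<alpha> n \<and> above \<alpha> j (Suc n) w}"
proof (induction j arbitrary: n)
  case 0
  show ?case by (auto simp: above_def)
next
  case (Suc j)
  let ?r = "cf_rem \<alpha> (Suc n)" and ?e = "cf_sgn \<alpha> (Suc n)"
  have K: "(\<lambda>v. YY \<alpha> (Suc n) v + of_int l) ` K_part ?r (I_step \<alpha> j (Suc n))
      = {w. (\<exists>x. 0 \<le> x \<and> x \<le> 1 / ?r \<and> x \<le> 1 / ?r - 1 \<and> Re w = of_int l - of_int ?e * ?r * x)
        \<and> above \<alpha> (Suc j) (Suc n) w}" for l
    unfolding image_YY[OF irr, of "Suc n" l "\<lambda>x. x \<le> 1 / ?r - 1" j, symmetric]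
    by (rule arg_cong[of _ _ "image _"]) (auto simp: K_part_def Suc.IH)
  have J: "(\<lambda>v. YY \<alpha> (Suc n) v + of_int l) ` J_part ?r (I_step \<alpha> j (Suc n))
      = {w. (\<exists>x. 0 \<le> x \<and> x \<le> 1 / ?r \<and> 1 / ?r - 1 \<le> x \<and> Re w = of_int l - of_int ?e * ?r * x)
        \<and> above \<alpha> (Suc j) (Suc n) w}" for l
    unfolding image_YY[OF irr, of "Suc n" l "\<lambda>x. 1 / ?r - 1 \<le> x" j, symmetric]
    by (rule arg_cong[of _ _ "image _"]) (auto simp: J_part_def Suc.IH)
  have I: "(\<lambda>v. YY \<alpha> (Suc n) v + of_int l) ` I_step \<alpha> j (Suc n)
      = {w. (\<exists>x. 0 \<le> x \<and> x \<le> 1 / ?r \<and> Re w = of_int l - of_int ?e * ?r * x)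
        \<and> above \<alpha> (Suc j) (Suc n) w}" for l
    using image_YY[OF irr, of "Suc n" l "\<lambda>_. True" j] unfolding Suc.IH by (simp only: simp_thms)
  have gt: "2 < 1 / cf_rem \<alpha> n" using cf_rem_bounds[OF irr, of n] by (simp add: field_simps)
  define a where "a = cf_quot \<alpha> n"
  define r where "r = ?r"
  define e where "e = ?e"
  have q: "1 / cf_rem \<alpha> n = of_int a + of_int e * r"
    unfolding a_def r_def e_def by (rule cf_quot[OF irr])
  show ?case
  proof (rule set_eqI)
    fix w
    have c: "w \<in> I_step \<alpha> (Suc j) n \<longleftrightarrow> (if e = -1 then
       (\<exists>l\<in>{0..a - 2}. \<exists>x. 0 \<le> x \<and> x \<le> 1 / r \<and> Re w = of_int l - of_int e * r * x)
       \<or> (\<exists>x. 0 \<le> x \<and> x \<le> 1 / r \<and> x \<le> 1 / r - 1 \<and> Re w = of_int (a - 1) - of_int e * r * x)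
     else
       (\<exists>l\<in>{1..a}. \<exists>x. 0 \<le> x \<and> x \<le> 1 / r \<and> Re w = of_int l - of_int e * r * x)
       \<or> (\<exists>x. 0 \<le> x \<and> x \<le> 1 / r \<and> 1 / r - 1 \<le> x \<and> Re w = of_int (a + 1) - of_int e * r * x))
       \<and> above \<alpha> (Suc j) (Suc n) w"
      unfolding I_step.simps(2) a_def[symmetric]
      unfolding K[of "a - 1"] J[of "a + 1"] I
      unfolding r_def[symmetric] e_def[symmetric]
      by (rule mem_if_conj_iff) (simp_all only: Un_UN_Collect_conj_iff)
    show "w \<in> I_step \<alpha> (Suc j) n \<longleftrightarrow> w \<in> {w. 0 \<le> Re w \<and> Re w \<le> 1 / cf_rem \<alpha> n \<and> above \<alpha> (Suc j) (Suc n) w}"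
      unfolding c q
        branches_cover[OF cf_rem_bounds[OF irr, of "Suc n", folded r_def] gt[unfolded q] cf_sgn_cases[OF irr, of "Suc n", folded e_def], symmetric]
      by blast
  qed
qed

text \<open>The sets are intersected from \<open>j = 1\<close> on, while \<open>fib\<close> starts
  at depth 0; the case \<open>j = 1\<close> supplies the missing one.\<close>

lemma above_all_iff_fib:
  assumes irr: "\<alpha> \<notin> \<rat>"
  shows "(\<forall>j\<ge>1. above \<alpha> j n w) \<longleftrightarrow>
    fib (cf_rem_from \<alpha> n) (cf_sgn_from \<alpha> n) (- of_int (cf_sgn \<alpha> n) * Re w) (Im w)"
proof -
  have "above \<alpha> 0 n w" if "above \<alpha> 1 n w"
    using above_ge_minus_one[OF irr that] by (simp add: above_def)
  then have "(\<forall>j\<ge>1. above \<alpha> j n w) \<longleftrightarrow> (\<forall>j. above \<alpha> j n w)"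
    by (metis less_one linorder_not_le order_refl)
  then show ?thesis
    unfolding above_def fib_def deep_le_iff[OF cf_system_from[OF irr]] .
qed

lemma I_set_eq:
  assumes irr: "\<alpha> \<notin> \<rat>"
  shows "I_set \<alpha> n = {w. 0 \<le> Re w \<and> Re w \<le> 1 / cf_rem \<alpha> n \<and>
    fib (cf_rem_from \<alpha> (Suc n)) (cf_sgn_from \<alpha> (Suc n)) (- of_int (cf_sgn \<alpha> (Suc n)) * Re w) (Im w)}"
  unfolding I_set_def I_step_eq[OF irr] above_all_iff_fib[OF irr, symmetric] by auto

lemma K_set_eq:
  assumes irr: "\<alpha> \<notin> \<rat>"
  shows "K_set \<alpha> n = {w \<in> I_set \<alpha> n. Re w \<le> 1 / cf_rem \<alpha> n - 1}"
  unfolding K_set_def K_part_def I_set_def by (auto simp: I_step_eq[OF irr])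

lemma I_top_eq:
  assumes irr: "\<alpha> \<notin> \<rat>"
  shows "I_top \<alpha> = {w. 0 \<le> Re w \<and> Re w \<le> 1 \<and>
    fib (cf_rem \<alpha>) (cf_sgn \<alpha>) (- of_int (cf_sgn \<alpha> 0) * Re w) (Im w)}"
proof -
  \<comment> \<open>The shift \<open>(e + 1) / 2\<close> is the integer 1 or 0 that puts the real
    parts of the image into \<open>[0, 1]\<close>.\<close>
  define l :: int where "l = (if cf_sgn \<alpha> 0 = 1 then 1 else 0)"
  note s = cf_sgn_cases[OF irr, of 0] and r = cf_rem_bounds[OF irr, of 0]
  have sh: "YY_shift \<alpha> 0 = (\<lambda>w. YY \<alpha> 0 w + of_int l)"
    using s by (auto simp: YY_shift_def l_def fun_eq_iff)
  have im: "YY_shift \<alpha> 0 ` I_step \<alpha> j 0 = {w. 0 \<le> Re w \<and> Re w \<le> 1 \<and> above \<alpha> (Suc j) 0 w}" for j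
  proof -
    have I: "(\<lambda>v. YY \<alpha> 0 v + of_int l) ` I_step \<alpha> j 0
      = {w. (\<exists>x. 0 \<le> x \<and> x \<le> 1 / cf_rem \<alpha> 0 \<and> Re w = of_int l - of_int (cf_sgn \<alpha> 0) * cf_rem \<alpha> 0 * x)
        \<and> above \<alpha> (Suc j) 0 w}"
      using image_YY[OF irr, of 0 l "\<lambda>_. True" j] unfolding I_step_eq[OF irr] by (simp only: simp_thms)
    have "(\<exists>x. 0 \<le> x \<and> x \<le> 1 / cf_rem \<alpha> 0 \<and> X = of_int l - of_int (cf_sgn \<alpha> 0) * cf_rem \<alpha> 0 * x)
        \<longleftrightarrow> 0 \<le> X \<and> X \<le> 1" for X
    proof
      assume "\<exists>x. 0 \<le> x \<and> x \<le> 1 / cf_rem \<alpha> 0 \<and> X = of_int l - of_int (cf_sgn \<alpha> 0) * cf_rem \<alpha> 0 * x"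
      then obtain x where x: "0 \<le> x" "x \<le> 1 / cf_rem \<alpha> 0" "X = of_int l - of_int (cf_sgn \<alpha> 0) * cf_rem \<alpha> 0 * x" by blast
      then have "0 \<le> cf_rem \<alpha> 0 * x" "cf_rem \<alpha> 0 * x \<le> 1" using r by (auto simp: field_simps simp del: cf_rem.simps)
      then show "0 \<le> X \<and> X \<le> 1" using s x(3) by (auto simp: l_def simp del: cf_rem.simps cf_sgn.simps)
    next
      assume X: "0 \<le> X \<and> X \<le> 1"
      show "\<exists>x. 0 \<le> x \<and> x \<le> 1 / cf_rem \<alpha> 0 \<and> X = of_int l - of_int (cf_sgn \<alpha> 0) * cf_rem \<alpha> 0 * x"
        using s X r
        by (intro exI[of _ "(if cf_sgn \<alpha> 0 = 1 then 1 - X else X) / cf_rem \<alpha> 0"])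
          (auto simp: l_def divide_right_mono simp del: cf_rem.simps cf_sgn.simps)
    qed
    then show ?thesis unfolding sh I by blast
  qed
  have "w \<in> I_top \<alpha> \<longleftrightarrow> 0 \<le> Re w \<and> Re w \<le> 1 \<and> (\<forall>j\<ge>1. above \<alpha> j 0 w)" for w
    unfolding I_top_def im by auto
  then show ?thesis unfolding above_all_iff_fib[OF irr] by auto
qed

section \<open>Trajectories\<close>

primrec iter_u :: "nat \<Rightarrow> (nat \<Rightarrow> real) \<Rightarrow> (nat \<Rightarrow> int) \<Rightarrow> real \<Rightarrow> real" where
  "iter_u 0 r e u = u"
| "iter_u (Suc m) r e u = iter_u m (sh r) (sh e) (next_u r e u)"

lemma sh_shift: "(\<lambda>i. sh f (m + i)) = (\<lambda>i. f (Suc m + i))"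
  by (simp add: sh_def)

lemma sh_apply: "sh f m = f (Suc m)"
  by (simp add: sh_def)

text \<open>Trajectories grow at the deep end, while \<open>pull\<close>, \<open>deep\<close> and
  \<open>iter_u\<close> recurse at the top. This and the next two lemmas exchange the
  directions.\<close>

lemma iter_u_Suc: "iter_u (Suc m) r e u = next_u (\<lambda>i. r (m + i)) (\<lambda>i. e (m + i)) (iter_u m r e u)"
proof (induction m arbitrary: r e u)
  case (Suc m)
  have "iter_u (Suc (Suc m)) r e u = iter_u (Suc m) (sh r) (sh e) (next_u r e u)" by simp
  also have "\<dots> = next_u (\<lambda>i. sh r (m + i)) (\<lambda>i. sh e (m + i)) (iter_u m (sh r) (sh e) (next_u r e u))"
    by (rule Suc.IH)
  finally show ?case unfolding sh_shift by simp
qed simp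

lemma pull_Suc_right:
  "pull (Suc m) r e u t = pull m r e u (hgt (r m) (addr (\<lambda>i. r (m + i)) (iter_u m r e u)) t)"
proof (induction m arbitrary: r e u)
  case (Suc m)
  have "pull (Suc (Suc m)) r e u t = hgt (r 0) (addr r u) (pull (Suc m) (sh r) (sh e) (next_u r e u) t)" by simp
  also have "\<dots> = pull (Suc m) r e u
     (hgt (sh r m) (addr (\<lambda>i. sh r (m + i)) (iter_u m (sh r) (sh e) (next_u r e u))) t)"
    unfolding Suc.IH by simp
  finally show ?case unfolding sh_shift sh_apply[of r m] by simp
qed simp

lemma deep_Suc_right:
  "deep (Suc m) r e u y = hgt_inv (r m) (addr (\<lambda>i. r (m + i)) (iter_u m r e u)) (deep m r e u y)"
proof (induction m arbitrary: r e u y)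
  case (Suc m)
  have "deep (Suc (Suc m)) r e u y
     = deep (Suc m) (sh r) (sh e) (next_u r e u) (hgt_inv (r 0) (addr r u) y)" by simp
  also have "\<dots> = hgt_inv (sh r m) (addr (\<lambda>i. sh r (m + i)) (iter_u m (sh r) (sh e) (next_u r e u)))
     (deep m (sh r) (sh e) (next_u r e u) (hgt_inv (r 0) (addr r u) y))"
    by (rule Suc.IH)
  finally show ?case unfolding sh_shift sh_apply[of r m] by simp
qed simp

lemma fib_next:
  assumes "cf_system r e" "fib r e u y"
  shows "fib (sh r) (sh e) (next_u r e u) (hgt_inv (r 0) (addr r u) y)"
  unfolding fib_def
proof
  fix m
  show "-1 \<le> deep m (sh r) (sh e) (next_u r e u) (hgt_inv (r 0) (addr r u) y)"
    using assms(2)[unfolded fib_def, rule_format, of "Suc m"] by simp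
qed

lemma fib_iter:
  assumes "cf_system r e" "fib r e u y"
  shows "fib (\<lambda>i. r (m + i)) (\<lambda>i. e (m + i)) (iter_u m r e u) (deep m r e u y)"
  using assms
proof (induction m arbitrary: r e u y)
  case (Suc m)
  show ?case
    using Suc.IH[OF cf_system_sh[OF Suc.prems(1)] fib_next[OF Suc.prems]] unfolding sh_shift by simp
qed simp

text \<open>As long as every earlier level carries, each level receives the rotation step of its own
  system, up to an integer.\<close>

lemma iter_u_shift:
  assumes "cf_system r e" "\<forall>i<m. 1 / r i \<le> addr (\<lambda>k. r (i + k)) (iter_u i r e u) + 1"
  shows "\<exists>k::int. iter_u m r e (u + r 0) = iter_u m r e u + r m + of_int k"
  using assms
proof (induction m arbitrary: r e u)
  case 0
  show ?case by (intro exI[of _ 0]) simp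
next
  case (Suc m)
  note sys = Suc.prems(1)
  have "1 / r 0 \<le> addr r u + 1" using Suc.prems(2)[rule_format, of 0] by simp
  then obtain a :: int where a: "u + r 0 = of_int (\<lfloor>u\<rfloor> + 1) + r 0 * (addr r u + 1 - 1 / r 0)"
    "0 \<le> addr r u + 1 - 1 / r 0" "- of_int (e 1) * (addr r u + 1 - 1 / r 0) = next_u r e u + sh r 0 + of_int a"
    using shift_large[OF sys] by metis
  have "addr r (u + r 0) = addr r u + 1 - 1 / r 0"
  proof -
    have "1 < 1 / r 0" using cf_systemD[OF sys, of 0] by (simp add: field_simps)
    then have "addr r u + 1 - 1 / r 0 < 1 / r 0" using addr_bounds(2)[OF sys, of u] by linarith
    then show ?thesis using addr_of[OF sys a(2), of "\<lfloor>u\<rfloor> + 1"] a(1) by simp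
  qed
  then have n: "next_u r e (u + r 0) = (next_u r e u + sh r 0) + of_int a"
    unfolding next_u_def[of r e "u + r 0"] using a(3) by simp
  \<comment> \<open>For \<open>m = 0\<close> nothing is reduced modulo 1 any more and the integer
    \<open>a\<close> survives; otherwise \<open>next_u\<close> absorbs it.\<close>
  have c: "iter_u m (sh r) (sh e) (next_u r e (u + r 0)) = iter_u m (sh r) (sh e) (next_u r e u + sh r 0) + of_int (if m = 0 then a else 0)"
    using next_u_cong[OF n, of "sh r" "sh e"] by (cases m) (simp_all add: n)
  have "\<forall>i<m. 1 / sh r i \<le> addr (\<lambda>k. sh r (i + k)) (iter_u i (sh r) (sh e) (next_u r e u)) + 1"
  proof (intro allI impI)
    fix i assume "i < m"
    then show "1 / sh r i \<le> addr (\<lambda>k. sh r (i + k)) (iter_u i (sh r) (sh e) (next_u r e u)) + 1"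
      using Suc.prems(2)[rule_format, of "Suc i"] unfolding sh_shift sh_apply[of r i] by simp
  qed
  from Suc.IH[OF cf_system_sh[OF sys] this]
  obtain k :: int where "iter_u m (sh r) (sh e) (next_u r e u + sh r 0) = iter_u m (sh r) (sh e) (next_u r e u) + sh r m + of_int k" ..
  then have "iter_u (Suc m) r e (u + r 0) = iter_u (Suc m) r e u + r (Suc m) + of_int (k + (if m = 0 then a else 0))"
    using c by (simp add: sh_apply)
  then show ?case by blast
qed

text \<open>The levels before \<open>m\<close> carry and level \<open>m\<close> does not, so the
  limit is already attained at depth \<open>Suc m\<close>. This is the first alternative in the
  definition of \<open>T_lift\<close>.\<close>

lemma rot_eq_pull:
  assumes "cf_system r e" "\<forall>i<m. 1 / r i \<le> addr (\<lambda>k. r (i + k)) (iter_u i r e u) + 1"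
    "addr (\<lambda>k. r (m + k)) (iter_u m r e u) + 1 \<le> 1 / r m"
  shows "rot r e u y = pull (Suc m) r e (u + r 0) (deep (Suc m) r e u y)"
  using assms
proof (induction m arbitrary: r e u y)
  case 0
  then have "addr r u + 1 \<le> 1 / r 0" by simp
  then show ?case using rot_small[OF 0(1)] pull_shift_small[OF 0(1), of u 0] by simp
next
  case (Suc m)
  note sys = Suc.prems(1)
  have l: "1 / r 0 \<le> addr r u + 1" using Suc.prems(2)[rule_format, of 0] by simp
  have 1: "\<forall>i<m. 1 / sh r i \<le> addr (\<lambda>k. sh r (i + k)) (iter_u i (sh r) (sh e) (next_u r e u)) + 1"
  proof (intro allI impI)
    fix i assume "i < m"
    then show "1 / sh r i \<le> addr (\<lambda>k. sh r (i + k)) (iter_u i (sh r) (sh e) (next_u r e u)) + 1"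
      using Suc.prems(2)[rule_format, of "Suc i"] unfolding sh_shift sh_apply[of r i] by simp
  qed
  have 2: "addr (\<lambda>k. sh r (m + k)) (iter_u m (sh r) (sh e) (next_u r e u)) + 1 \<le> 1 / sh r m"
    using Suc.prems(3) unfolding sh_shift sh_apply[of r m] by simp
  show ?case
    unfolding rot_large[OF sys l] pull_shift_large[OF sys l] Suc.IH[OF cf_system_sh[OF sys] 1 2]
    by simp
qed

text \<open>Both half-open conventions, one for each sign, round the position down.\<close>

lemma traj_int_eq:
  assumes "cf_sgn \<alpha> n = 1 \<or> cf_sgn \<alpha> n = -1"
  shows "traj_int \<alpha> n x = - cf_sgn \<alpha> n * \<lfloor>- of_int (cf_sgn \<alpha> n) * Re x\<rfloor>"
  unfolding traj_int_def
proof (rule the_equality)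
  show "if cf_sgn \<alpha> n = - 1
     then 0 \<le> Re (x - of_int (- cf_sgn \<alpha> n * \<lfloor>- of_int (cf_sgn \<alpha> n) * Re x\<rfloor>)) \<and>
          Re (x - of_int (- cf_sgn \<alpha> n * \<lfloor>- of_int (cf_sgn \<alpha> n) * Re x\<rfloor>)) < 1
     else - 1 < Re (x - of_int (- cf_sgn \<alpha> n * \<lfloor>- of_int (cf_sgn \<alpha> n) * Re x\<rfloor>)) \<and>
          Re (x - of_int (- cf_sgn \<alpha> n * \<lfloor>- of_int (cf_sgn \<alpha> n) * Re x\<rfloor>)) \<le> 0"
    using assms by (cases "cf_sgn \<alpha> n = -1") (simp_all, linarith+)
  fix l
  assume "if cf_sgn \<alpha> n = - 1 then 0 \<le> Re (x - of_int l) \<and> Re (x - of_int l) < 1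
      else - 1 < Re (x - of_int l) \<and> Re (x - of_int l) \<le> 0"
  then show "l = - cf_sgn \<alpha> n * \<lfloor>- of_int (cf_sgn \<alpha> n) * Re x\<rfloor>"
    using assms by (cases "cf_sgn \<alpha> n = -1") (simp_all, linarith+)
qed

lemma traj_next_eq:
  fixes \<alpha> :: real and n :: nat
  assumes irr: "\<alpha> \<notin> \<rat>"
  defines "r \<equiv> cf_rem_from \<alpha> n" and "e \<equiv> cf_sgn_from \<alpha> n"
  assumes f: "fib r e (- of_int (cf_sgn \<alpha> n) * Re x) (Im x)"
  shows "traj_next \<alpha> n x = Complex (addr r (- of_int (cf_sgn \<alpha> n) * Re x))
     (hgt_inv (r 0) (addr r (- of_int (cf_sgn \<alpha> n) * Re x)) (Im x))" (is "_ = ?z")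
proof -
  have sys: "cf_system r e" unfolding r_def e_def by (rule cf_system_from[OF irr])
  define u where "u = - of_int (cf_sgn \<alpha> n) * Re x"
  note s = cf_sgn_cases[OF irr, of n] and r0 = cf_systemD[OF sys, of 0]
  have [simp]: "r 0 = cf_rem \<alpha> n" by (simp add: r_def)
  have z: "?z = Complex (addr r u) (hgt_inv (r 0) (addr r u) (Im x))" by (simp add: u_def)
  have fn: "fib (sh r) (sh e) (next_u r e u) (Im ?z)"
    using fib_next[OF sys f] unfolding u_def[symmetric] by simp
  have l: "traj_int \<alpha> n x = - cf_sgn \<alpha> n * \<lfloor>u\<rfloor>" unfolding u_def by (rule traj_int_eq[OF s])
  have ru: "Re x = - of_int (cf_sgn \<alpha> n) * u" using s by (auto simp: u_def)
  have au: "u = of_int \<lfloor>u\<rfloor> + cf_rem \<alpha> n * addr r u" using addr_eq[OF sys, of u] by simp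
  show ?thesis
    unfolding traj_next_def
  proof (rule the_equality)
    have "?z \<in> I_set \<alpha> n"
      using fn addr_bounds[OF sys, of u] unfolding I_set_eq[OF irr] z
      by (simp add: r_def e_def next_u_def less_imp_le)
    moreover have "YY \<alpha> n ?z + of_int (traj_int \<alpha> n x) = x"
    proof -
      have "Re x = - (of_int (cf_sgn \<alpha> n) * cf_rem \<alpha> n * addr r u) + of_int (traj_int \<alpha> n x)"
        unfolding l ru by (subst au) (use s in \<open>auto simp: algebra_simps\<close>)
      then show ?thesis
        using YY_eq[OF irr fib_ge[OF fn], of n] hgt_inv[OF r0(1,2)]
        unfolding z by (simp add: complex_eq_iff)
    qed
    ultimately show "?z \<in> I_set \<alpha> n \<and> YY \<alpha> n ?z + of_int (traj_int \<alpha> n x) = x" by blast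
  next
    fix v assume v: "v \<in> I_set \<alpha> n \<and> YY \<alpha> n v + of_int (traj_int \<alpha> n x) = x"
    then have "-1 \<le> Im v" unfolding I_set_eq[OF irr] by (blast dest: fib_ge)
    note Y = YY_eq[OF irr this, of n]
    have "Re x = - (of_int (cf_sgn \<alpha> n) * cf_rem \<alpha> n * Re v) + of_int (traj_int \<alpha> n x)"
      using v Y(1) by (metis Re_complex_of_real of_real_of_int_eq plus_complex.sel(1))
    then have "u = cf_rem \<alpha> n * Re v + of_int \<lfloor>u\<rfloor>"
      unfolding l using s ru by auto
    then have "cf_rem \<alpha> n * Re v = cf_rem \<alpha> n * addr r u" using au by linarith
    then have R: "Re v = addr r u" using r0 by simp
    have "Im x = hgt (cf_rem \<alpha> n) (Re v) (Im v)"
      using v Y(2) by (metis Im_complex_of_real of_real_of_int_eq plus_complex.sel(2) add.right_neutral)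
    then have "hgt_inv (r 0) (addr r u) (Im x) = Im v"
      using hgt_inv_eq[OF r0(1,2)] R by simp
    then show "v = ?z" unfolding z using R by (simp add: complex_eq_iff)
  qed
qed

text \<open>\<open>w\<close> itself precedes level 0. Hence entry \<open>n\<close> has as real part
  the address at depth \<open>n\<close>, but as height what is left after inverting
  \<open>Suc n\<close> maps.\<close>

lemma traj_eq:
  assumes irr: "\<alpha> \<notin> \<rat>" and f: "fib (cf_rem \<alpha>) (cf_sgn \<alpha>) (- of_int (cf_sgn \<alpha> 0) * Re w) (Im w)"
  defines "u \<equiv> - of_int (cf_sgn \<alpha> 0) * Re w"
  shows "traj \<alpha> w n = Complex (addr (cf_rem_from \<alpha> n) (iter_u n (cf_rem \<alpha>) (cf_sgn \<alpha>) u))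
      (deep (Suc n) (cf_rem \<alpha>) (cf_sgn \<alpha>) u (Im w))"
proof (induction n)
  case 0
  show ?case using traj_next_eq[OF irr, of 0 w] f by (simp add: u_def)
next
  case (Suc n)
  note sys = cf_system_cf[OF irr]
  define x where "x = traj \<alpha> w n"
  have u: "- of_int (cf_sgn \<alpha> (Suc n)) * Re x = iter_u (Suc n) (cf_rem \<alpha>) (cf_sgn \<alpha>) u"
    unfolding x_def Suc.IH iter_u_Suc next_u_def by simp
  have "fib (cf_rem_from \<alpha> (Suc n)) (cf_sgn_from \<alpha> (Suc n)) (- of_int (cf_sgn \<alpha> (Suc n)) * Re x) (Im x)"
    unfolding u using fib_iter[OF sys f[folded u_def], of "Suc n"] unfolding x_def Suc.IH by simp
  from traj_next_eq[OF irr this]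
  have "traj \<alpha> w (Suc n) = Complex (addr (cf_rem_from \<alpha> (Suc n)) (iter_u (Suc n) (cf_rem \<alpha>) (cf_sgn \<alpha>) u))
     (hgt_inv (cf_rem \<alpha> (Suc n)) (addr (cf_rem_from \<alpha> (Suc n)) (iter_u (Suc n) (cf_rem \<alpha>) (cf_sgn \<alpha>) u)) (Im x))"
    unfolding u by (simp add: x_def)
  then show ?case
    unfolding deep_Suc_right[of "Suc n"] by (simp add: x_def Suc.IH)
qed

lemma traj_in_I_set:
  assumes irr: "\<alpha> \<notin> \<rat>" and f: "fib (cf_rem \<alpha>) (cf_sgn \<alpha>) (- of_int (cf_sgn \<alpha> 0) * Re w) (Im w)"
  shows "traj \<alpha> w n \<in> I_set \<alpha> n" "-1 \<le> Im (traj \<alpha> w n)"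
    "0 \<le> Re (traj \<alpha> w n)" "Re (traj \<alpha> w n) < 1 / cf_rem \<alpha> n"
proof -
  define u where "u = - of_int (cf_sgn \<alpha> 0) * Re w"
  have "fib (cf_rem_from \<alpha> (Suc n)) (cf_sgn_from \<alpha> (Suc n)) (- of_int (cf_sgn \<alpha> (Suc n)) * Re (traj \<alpha> w n)) (Im (traj \<alpha> w n))"
    using fib_iter[OF cf_system_cf[OF irr] f, of "Suc n"]
    unfolding traj_eq[OF irr f] iter_u_Suc next_u_def
    by (simp del: cf_rem.simps cf_sgn.simps deep.simps)
  moreover show b: "0 \<le> Re (traj \<alpha> w n)" "Re (traj \<alpha> w n) < 1 / cf_rem \<alpha> n"
    unfolding traj_eq[OF irr f]
    using addr_bounds[OF cf_system_from[OF irr, of n]] by simp_all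
  ultimately show "traj \<alpha> w n \<in> I_set \<alpha> n" "-1 \<le> Im (traj \<alpha> w n)"
    unfolding I_set_eq[OF irr] by (auto dest: fib_ge)
qed

section \<open>The lifted map\<close>

lemma YY_shift_eq:
  assumes "\<alpha> \<notin> \<rat>" "-1 \<le> Im w"
  shows "Re (YY_shift \<alpha> n w) = - (of_int (cf_sgn \<alpha> n) * cf_rem \<alpha> n * Re w) + (of_int (cf_sgn \<alpha> n) + 1) / 2"
    "Im (YY_shift \<alpha> n w) = hgt (cf_rem \<alpha> n) (Re w) (Im w)"
  using YY_eq[OF assms] by (simp_all add: YY_shift_def del: cf_rem.simps cf_sgn.simps)

lemma hgt_addr_shift:
  assumes "cf_system r e"
  shows "hgt (r 0) (addr r (u + r 0 + of_int k)) t = hgt (r 0) (addr r u + 1) t"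
proof -
  have "pull (Suc 0) r e (u + r 0) t = hgt (r 0) (addr r u + 1) t"
    using pull_shift_small[OF assms, of u 0 t] pull_shift_large[OF assms, of u 0 t]
    by (cases "addr r u + 1 \<le> 1 / r 0") auto
  then show ?thesis using addr_cong[OF refl, of r "u + r 0" k] by simp
qed

context
  fixes \<alpha> :: real and w :: complex and u :: real
  assumes irr: "\<alpha> \<notin> \<rat>"
    and f: "fib (cf_rem \<alpha>) (cf_sgn \<alpha>) (- of_int (cf_sgn \<alpha> 0) * Re w) (Im w)"
  defines "u \<equiv> - of_int (cf_sgn \<alpha> 0) * Re w"
begin

text \<open>The real part after one step of the odometer, reduced by the period on overflow. It may
  equal \<open>1 / cf_rem \<alpha> n\<close>, where \<open>addr\<close> would give
  \<open>0\<close>.\<close>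

definition shifted_re :: "nat \<Rightarrow> real" where
  "shifted_re n = (if Re (traj \<alpha> w n) + 1 \<le> 1 / cf_rem \<alpha> n then Re (traj \<alpha> w n) + 1
     else Re (traj \<alpha> w n) + 1 - 1 / cf_rem \<alpha> n)"

lemma hgt_shifted_re: "hgt (cf_rem \<alpha> n) (shifted_re n) t = hgt (cf_rem \<alpha> n) (Re (traj \<alpha> w n) + 1) t"
  using hgt_periodic[of "cf_rem \<alpha> n" "Re (traj \<alpha> w n) + 1 - 1 / cf_rem \<alpha> n" t] cf_rem_bounds[OF irr, of n]
  by (auto simp: shifted_re_def)

text \<open>Integer parts must match exactly, since \<open>X0\<close> contains no reduction modulo
  1. Overflow at level \<open>n\<close> confines the real part to the last unit below
  \<open>1 / cf_rem \<alpha> n\<close>; this leaves one value for the integer part \<open>f\<close>,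
  and the shift \<open>(e + 1) / 2\<close> fits it.\<close>

lemma shifted_re_Suc:
  assumes "1 / cf_rem \<alpha> n < Re (traj \<alpha> w n) + 1"
  shows "- (of_int (cf_sgn \<alpha> (Suc n)) * cf_rem \<alpha> (Suc n) * shifted_re (Suc n)) + (of_int (cf_sgn \<alpha> (Suc n)) + 1) / 2
     = shifted_re n"
proof -
  define r where "r = cf_rem \<alpha> (Suc n)"
  define e where "e = cf_sgn \<alpha> (Suc n)"
  define x where "x = Re (traj \<alpha> w n)"
  define x' where "x' = Re (traj \<alpha> w (Suc n))"
  define a where "a = cf_quot \<alpha> n"
  have r: "0 < r" "r < 1/2" unfolding r_def by (rule cf_rem_bounds[OF irr])+
  have e: "e = 1 \<or> e = -1" unfolding e_def by (rule cf_sgn_cases[OF irr])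
  have q: "1 / cf_rem \<alpha> n = of_int a + of_int e * r" unfolding a_def e_def r_def by (rule cf_quot[OF irr])
  have x: "of_int a + of_int e * r - 1 < x" "x < of_int a + of_int e * r"
    using assms traj_in_I_set(4)[OF irr f, of n] unfolding q x_def[symmetric] by auto
  have x': "0 \<le> x'" "x' < 1 / r" unfolding x'_def r_def by (rule traj_in_I_set[OF irr f])+
  define z where "z = r * x'"
  have z: "0 \<le> z" "z < 1" using r x' by (auto simp: z_def field_simps)
  have "- of_int e * x = of_int \<lfloor>- of_int e * x\<rfloor> + z"
  proof -
    have "x' = addr (cf_rem_from \<alpha> (Suc n)) (- of_int e * x)"
      unfolding x'_def x_def traj_eq[OF irr f] iter_u_Suc e_def next_u_def by simp
    then show ?thesis
      using addr_eq[OF cf_system_from[OF irr, of "Suc n"], of "- of_int e * x"]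
      by (simp add: z_def r_def del: cf_rem.simps)
  qed
  then obtain f :: int where f: "- of_int e * x = of_int f + z" by blast
  have sn: "shifted_re n = x + 1 - (of_int a + of_int e * r)"
    using assms unfolding shifted_re_def q x_def[symmetric] by simp
  have le: "x' + 1 \<le> 1 / r \<longleftrightarrow> z + r \<le> 1" using r by (simp add: z_def field_simps)
  have sS: "r * shifted_re (Suc n) = (if z + r \<le> 1 then z + r else z + r - 1)"
    unfolding shifted_re_def x'_def[symmetric] r_def[symmetric] le using r by (simp add: z_def algebra_simps)
  have "- (of_int e * (r * shifted_re (Suc n))) + (of_int e + 1) / 2 = shifted_re n"
  proof (cases "e = 1")
    case True
    then have "x = - of_int f - z" using f by simp
    moreover from this have "f = (if z + r \<le> 1 then - a else - a - 1)"
      using x z r True by (auto split: if_splits)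
    ultimately show ?thesis unfolding sn sS using True by auto
  next
    case False
    then have em: "e = -1" using e by simp
    then have "x = of_int f + z" using f by simp
    moreover from this have "f = (if z + r \<le> 1 then a - 1 else a - 2)"
      using x z r em by (auto split: if_splits)
    ultimately show ?thesis unfolding sn sS using em by auto
  qed
  then show ?thesis by (simp add: r_def e_def mult.assoc del: cf_rem.simps cf_sgn.simps)
qed

text \<open>The real part does not depend on \<open>n\<close>, so the limit in \<open>T_lift\<close>
  concerns heights only, where \<open>X0\<close> is \<open>pull\<close> over the rotated
  position.\<close>

lemma X0_eq:
  assumes "\<forall>i<n. 1 / cf_rem \<alpha> i < Re (traj \<alpha> w i) + 1" "-1 \<le> Im z" "Re z = shifted_re n"
  shows "Im (X0 \<alpha> n z) = pull (Suc n) (cf_rem \<alpha>) (cf_sgn \<alpha>) (u + cf_rem \<alpha> 0) (Im z)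
    \<and> Re (X0 \<alpha> n z) = - (of_int (cf_sgn \<alpha> 0) * cf_rem \<alpha> 0 * shifted_re 0) + (of_int (cf_sgn \<alpha> 0) + 1) / 2"
  using assms
proof (induction n arbitrary: z)
  case 0
  have "Re (traj \<alpha> w 0) = addr (cf_rem \<alpha>) u" using traj_eq[OF irr f, of 0] by (simp add: u_def)
  then have "pull (Suc 0) (cf_rem \<alpha>) (cf_sgn \<alpha>) (u + cf_rem \<alpha> 0) (Im z)
     = hgt (cf_rem \<alpha> 0) (Re (traj \<alpha> w 0) + 1) (Im z)"
    using hgt_addr_shift[OF cf_system_cf[OF irr], of u 0 "Im z"] by (simp del: cf_rem.simps)
  then show ?case
    using YY_shift_eq[OF irr 0(2), of 0] 0(3) hgt_shifted_re by (simp del: cf_rem.simps cf_sgn.simps pull.simps)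
next
  case (Suc n)
  define z' where "z' = YY_shift \<alpha> (Suc n) z"
  note z' = YY_shift_eq[OF irr Suc.prems(2), of "Suc n", folded z'_def]
  have Re: "Re z' = shifted_re n"
    unfolding z'(1) Suc.prems(3) by (rule shifted_re_Suc) (use Suc.prems(1) in blast)
  have Im: "Im z' = hgt (cf_rem \<alpha> (Suc n)) (Re (traj \<alpha> w (Suc n)) + 1) (Im z)"
    unfolding z'(2) Suc.prems(3) by (rule hgt_shifted_re)
  have ge: "-1 \<le> Im z'"
    unfolding Im using hgt_gt_minus_one[OF _ _ Suc.prems(2)] cf_rem_bounds[OF irr, of "Suc n"]
    by (simp add: less_imp_le del: cf_rem.simps)
  have "\<forall>i<Suc n. 1 / cf_rem \<alpha> i \<le> addr (cf_rem_from \<alpha> i) (iter_u i (cf_rem \<alpha>) (cf_sgn \<alpha>) u) + 1"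
    using Suc.prems(1) unfolding traj_eq[OF irr f, folded u_def] by (auto intro: less_imp_le)
  from iter_u_shift[OF cf_system_cf[OF irr] this] obtain k :: int where
    k: "iter_u (Suc n) (cf_rem \<alpha>) (cf_sgn \<alpha>) (u + cf_rem \<alpha> 0)
       = iter_u (Suc n) (cf_rem \<alpha>) (cf_sgn \<alpha>) u + cf_rem \<alpha> (Suc n) + of_int k" ..
  have "Im z' = hgt (cf_rem \<alpha> (Suc n)) (addr (cf_rem_from \<alpha> (Suc n))
      (iter_u (Suc n) (cf_rem \<alpha>) (cf_sgn \<alpha>) (u + cf_rem \<alpha> 0))) (Im z)"
    unfolding Im k using hgt_addr_shift[OF cf_system_from[OF irr, of "Suc n"],
        of "iter_u (Suc n) (cf_rem \<alpha>) (cf_sgn \<alpha>) u" k "Im z"]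
    unfolding traj_eq[OF irr f, folded u_def] by (simp del: cf_rem.simps cf_sgn.simps iter_u.simps)
  then have "pull (Suc n) (cf_rem \<alpha>) (cf_sgn \<alpha>) (u + cf_rem \<alpha> 0) (Im z')
     = pull (Suc (Suc n)) (cf_rem \<alpha>) (cf_sgn \<alpha>) (u + cf_rem \<alpha> 0) (Im z)"
    unfolding pull_Suc_right[of "Suc n"] by simp
  moreover have "X0 \<alpha> (Suc n) z = X0 \<alpha> n z'" by (simp add: z'_def)
  ultimately show ?case using Suc.IH[OF _ ge Re] Suc.prems(1) by simp
qed

lemma first_K_iff:
  "first_K \<alpha> w n \<longleftrightarrow> Re (traj \<alpha> w n) + 1 \<le> 1 / cf_rem \<alpha> n \<and> (\<forall>i<n. 1 / cf_rem \<alpha> i < Re (traj \<alpha> w i) + 1)"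
  unfolding first_K_def K_set_eq[OF irr] using traj_in_I_set(1)[OF irr f] by (auto simp: algebra_simps)

text \<open>If the carry stops, \<open>T_lift\<close> is the finite composition of
  \<open>rot_eq_pull\<close>; if it never stops, its limit is the one that defines
  \<open>rot\<close>.\<close>

lemma T_lift_eq:
  "Im (T_lift \<alpha> w) = rot (cf_rem \<alpha>) (cf_sgn \<alpha>) u (Im w)"
  "\<exists>k::int. - of_int (cf_sgn \<alpha> 0) * Re (T_lift \<alpha> w) = u + cf_rem \<alpha> 0 + of_int k"
proof -
  note sys = cf_system_cf[OF irr]
  define R where "R = - (of_int (cf_sgn \<alpha> 0) * cf_rem \<alpha> 0 * shifted_re 0) + (of_int (cf_sgn \<alpha> 0) + 1) / 2"
  have "Im (T_lift \<alpha> w) = rot (cf_rem \<alpha>) (cf_sgn \<alpha>) u (Im w) \<and> Re (T_lift \<alpha> w) = R"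
  proof (cases "\<exists>n. first_K \<alpha> w n")
    case True
    then obtain n where n: "first_K \<alpha> w n" by blast
    have "(THE n. first_K \<alpha> w n) = n"
    proof (rule the_equality)
      show "first_K \<alpha> w n" by (rule n)
      fix m assume "first_K \<alpha> w m"
      with n show "m = n" unfolding first_K_iff by (metis linorder_neqE_nat not_le)
    qed
    then have T: "T_lift \<alpha> w = X0 \<alpha> n (traj \<alpha> w n + 1)" using True by (simp add: T_lift_def)
    have X: "Im (X0 \<alpha> n (traj \<alpha> w n + 1)) = pull (Suc n) (cf_rem \<alpha>) (cf_sgn \<alpha>) (u + cf_rem \<alpha> 0) (Im (traj \<alpha> w n + 1))
      \<and> Re (X0 \<alpha> n (traj \<alpha> w n + 1)) = R"
      unfolding R_def using n traj_in_I_set(2)[OF irr f, of n]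
      by (intro X0_eq) (auto simp: first_K_iff shifted_re_def)
    have "rot (cf_rem \<alpha>) (cf_sgn \<alpha>) u (Im w) =
       pull (Suc n) (cf_rem \<alpha>) (cf_sgn \<alpha>) (u + cf_rem \<alpha> 0) (deep (Suc n) (cf_rem \<alpha>) (cf_sgn \<alpha>) u (Im w))"
      using n unfolding first_K_iff traj_eq[OF irr f, folded u_def]
      by (intro rot_eq_pull sys) (auto intro: less_imp_le)
    then show ?thesis using X unfolding T by (simp add: traj_eq[OF irr f, folded u_def] del: pull.simps deep.simps)
  next
    case False
    have large: "1 / cf_rem \<alpha> n < Re (traj \<alpha> w n) + 1" for n
    proof (induction n rule: less_induct)
      case (less n)
      then show ?case using False first_K_iff[of n] by force
    qed
    have X: "X0 \<alpha> n (traj \<alpha> w n + 1 - of_real (1 / cf_rem \<alpha> n))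
       = Complex R (pull (Suc n) (cf_rem \<alpha>) (cf_sgn \<alpha>) (u + cf_rem \<alpha> 0) (deep (Suc n) (cf_rem \<alpha>) (cf_sgn \<alpha>) u (Im w)))" for n
    proof -
      have "Im (traj \<alpha> w n + 1 - of_real (1 / cf_rem \<alpha> n)) = deep (Suc n) (cf_rem \<alpha>) (cf_sgn \<alpha>) u (Im w)"
        unfolding traj_eq[OF irr f, folded u_def] by (simp del: deep.simps)
      moreover have "-1 \<le> Im (traj \<alpha> w n + 1 - of_real (1 / cf_rem \<alpha> n))"
        using traj_in_I_set(2)[OF irr f, of n] by simp
      moreover have "Re (traj \<alpha> w n + 1 - of_real (1 / cf_rem \<alpha> n)) = shifted_re n"
        using large[of n] by (simp add: shifted_re_def)
      ultimately show ?thesis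
        using X0_eq[of n "traj \<alpha> w n + 1 - of_real (1 / cf_rem \<alpha> n)"] large by (simp add: complex_eq_iff R_def del: cf_rem.simps cf_sgn.simps pull.simps deep.simps)
    qed
    have "(\<lambda>n. X0 \<alpha> n (traj \<alpha> w n + 1 - of_real (1 / cf_rem \<alpha> n))) \<longlonglongrightarrow> Complex R (rot (cf_rem \<alpha>) (cf_sgn \<alpha>) u (Im w))"
      unfolding X by (intro tendsto_Complex tendsto_const LIMSEQ_Suc[OF rot_limit(1)[OF sys]])
    then have "T_lift \<alpha> w = Complex R (rot (cf_rem \<alpha>) (cf_sgn \<alpha>) u (Im w))"
      using False by (simp add: T_lift_def limI)
    then show ?thesis by simp
  qed
  then show "Im (T_lift \<alpha> w) = rot (cf_rem \<alpha>) (cf_sgn \<alpha>) u (Im w)"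
    and "\<exists>k::int. - of_int (cf_sgn \<alpha> 0) * Re (T_lift \<alpha> w) = u + cf_rem \<alpha> 0 + of_int k"
  proof -
    assume *: "Im (T_lift \<alpha> w) = rot (cf_rem \<alpha>) (cf_sgn \<alpha>) u (Im w) \<and> Re (T_lift \<alpha> w) = R"
    then show "Im (T_lift \<alpha> w) = rot (cf_rem \<alpha>) (cf_sgn \<alpha>) u (Im w)" ..
    have "Re (traj \<alpha> w 0) = addr (cf_rem \<alpha>) u" using traj_eq[OF irr f, of 0] by (simp add: u_def)
    then have "u = of_int \<lfloor>u\<rfloor> + cf_rem \<alpha> 0 * Re (traj \<alpha> w 0)" using addr_eq[OF sys, of u] by simp
    then have "cf_rem \<alpha> 0 * shifted_re 0 = u - of_int \<lfloor>u\<rfloor> + cf_rem \<alpha> 0 - of_int (if Re (traj \<alpha> w 0) + 1 \<le> 1 / cf_rem \<alpha> 0 then 0 else 1)"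
      using cf_rem_bounds[OF irr, of 0] by (simp add: shifted_re_def algebra_simps del: cf_rem.simps)
    then have "- of_int (cf_sgn \<alpha> 0) * R = u + cf_rem \<alpha> 0 + of_int (- \<lfloor>u\<rfloor>
        - (if Re (traj \<alpha> w 0) + 1 \<le> 1 / cf_rem \<alpha> 0 then 0 else 1) - (if cf_sgn \<alpha> 0 = 1 then 1 else 0))"
      using cf_sgn_cases[OF irr, of 0] unfolding R_def mult.assoc
      by (elim disjE) (simp_all del: cf_rem.simps cf_sgn.simps)
    then show "\<exists>k::int. - of_int (cf_sgn \<alpha> 0) * Re (T_lift \<alpha> w) = u + cf_rem \<alpha> 0 + of_int k"
      using * by blast
  qed
qed

end

section \<open>Polar coordinates on the model\<close>

definition polar_pt :: "int \<Rightarrow> real \<Rightarrow> real \<Rightarrow> complex" where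
  "polar_pt s u y = of_real (exp (- (2 * pi * y))) * cis (2 * pi * (of_int s * u))"

lemma cmod_polar_pt [simp]: "cmod (polar_pt s u y) = exp (- (2 * pi * y))"
  by (simp add: polar_pt_def norm_mult)

lemma polar_pt_nonzero [simp]: "polar_pt s u y \<noteq> 0"
  by (simp add: polar_pt_def)

lemma ex_polar: "ex w = polar_pt 1 (Re w) (Im w)"
  by (simp add: ex_def exp_eq_polar polar_pt_def)

lemma cnj_polar_pt: "cnj (polar_pt s u y) = polar_pt (- s) u y"
  by (simp add: polar_pt_def cis_cnj)

lemma polar_pt_minus: "polar_pt (- s) u y = polar_pt s (- u) y"
  by (simp add: polar_pt_def)

lemma cnj_ex_polar:
  assumes "s = 1 \<or> s = -1"
  shows "cnj (ex w) = polar_pt s (- of_int s * Re w) (Im w)"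
  using assms by (auto simp: ex_polar cnj_polar_pt polar_pt_minus)

lemma cis_eq_cis_iff: "cis a = cis b \<longleftrightarrow> (\<exists>n::int. b = a + 2 * pi * of_int n)"
proof -
  have "cis a = cis b \<longleftrightarrow> sin b = sin a \<and> cos b = cos a" by (auto simp: complex_eq_iff)
  then show ?thesis by (simp add: sin_cos_eq_iff mult.commute mult.left_commute)
qed

lemma polar_pt_cong:
  assumes "u' = u + of_int k"
  shows "polar_pt s u' y = polar_pt s u y"
proof -
  have "cis (2 * pi * (of_int s * u)) = cis (2 * pi * (of_int s * u'))"
    unfolding cis_eq_cis_iff by (intro exI[of _ "s * k"]) (simp add: assms algebra_simps)
  then show ?thesis by (simp add: polar_pt_def)
qed

lemma polar_pt_eq_iff:
  assumes "s = 1 \<or> s = -1"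
  shows "polar_pt s u y = polar_pt s u' y' \<longleftrightarrow> y = y' \<and> (\<exists>k::int. u' = u + of_int k)"
proof
  assume eq: "polar_pt s u y = polar_pt s u' y'"
  then have "cmod (polar_pt s u y) = cmod (polar_pt s u' y')" by simp
  then have y: "y = y'" unfolding cmod_polar_pt by simp
  then have "cis (2 * pi * (of_int s * u)) = cis (2 * pi * (of_int s * u'))" using eq by (simp add: polar_pt_def)
  then obtain n :: int where "2 * pi * (of_int s * u') = 2 * pi * (of_int s * u) + 2 * pi * of_int n"
    by (auto simp: cis_eq_cis_iff)
  then have "2 * pi * (of_int s * u') = 2 * pi * (of_int s * u + of_int n)" by (simp add: algebra_simps)
  then have "of_int s * u' = of_int s * u + of_int n" by simp
  then have "u' = u + of_int (s * n)" using assms by auto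
  then show "y = y' \<and> (\<exists>k::int. u' = u + of_int k)" using y by blast
next
  assume "y = y' \<and> (\<exists>k::int. u' = u + of_int k)"
  then show "polar_pt s u y = polar_pt s u' y'" using polar_pt_cong by metis
qed

text \<open>The sign with index 0, absent from heights and fibres, returns as the orientation in
  which positions wind around the circle.\<close>

lemma MM_eq:
  assumes irr: "\<alpha> \<notin> \<rat>"
  shows "MM \<alpha> = {polar_pt (cf_sgn \<alpha> 0) u y | u y. fib (cf_rem \<alpha>) (cf_sgn \<alpha>) u y} \<union> {0}"
proof -
  define s where "s = cf_sgn \<alpha> 0"
  have s: "s = 1 \<or> s = -1" unfolding s_def by (rule cf_sgn_cases[OF irr])
  have "{cnj (ex w) | w. w \<in> I_top \<alpha>} = {polar_pt s u y | u y. fib (cf_rem \<alpha>) (cf_sgn \<alpha>) u y}"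
  proof (intro equalityI subsetI)
    fix z assume "z \<in> {cnj (ex w) | w. w \<in> I_top \<alpha>}"
    then show "z \<in> {polar_pt s u y | u y. fib (cf_rem \<alpha>) (cf_sgn \<alpha>) u y}"
      unfolding I_top_eq[OF irr] cnj_ex_polar[OF s] s_def by blast
  next
    fix z assume "z \<in> {polar_pt s u y | u y. fib (cf_rem \<alpha>) (cf_sgn \<alpha>) u y}"
    then obtain u y where u: "z = polar_pt s u y" "fib (cf_rem \<alpha>) (cf_sgn \<alpha>) u y" by blast
    define w where "w = Complex (frac (- of_int s * u)) y"
    have w: "- of_int s * Re w = u + of_int (s * \<lfloor>- of_int s * u\<rfloor>)"
      using s by (auto simp: w_def frac_def)
    have "w \<in> I_top \<alpha>"
      unfolding I_top_eq[OF irr] s_def[symmetric] mem_Collect_eq w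
      using u(2) fib_cong[OF refl, of _ _ u "s * \<lfloor>- of_int s * u\<rfloor>"] frac_lt_1[of "- of_int s * u"]
      by (simp add: w_def less_imp_le)
    moreover have "cnj (ex w) = z"
      unfolding cnj_ex_polar[OF s] w u(1) by (subst polar_pt_eq_iff[OF s]) (auto simp: w_def intro!: exI[of _ "- (s * \<lfloor>- of_int s * u\<rfloor>)"])
    ultimately show "z \<in> {cnj (ex w) | w. w \<in> I_top \<alpha>}" by blast
  qed
  then show ?thesis by (simp add: MM_def s_def)
qed

lemma TT_0: "TT \<alpha> 0 = 0"
  by (simp add: TT_def MM_def)

text \<open>Two lifts of a point differ by an integer, and \<open>rot\<close> depends on the
  position modulo 1 only; this makes the description operator in \<open>TT\<close> well
  defined.\<close>

lemma TT_eq: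
  assumes irr: "\<alpha> \<notin> \<rat>" and f: "fib (cf_rem \<alpha>) (cf_sgn \<alpha>) u y"
  shows "TT \<alpha> (polar_pt (cf_sgn \<alpha> 0) u y)
    = polar_pt (cf_sgn \<alpha> 0) (u + cf_rem \<alpha> 0) (rot (cf_rem \<alpha>) (cf_sgn \<alpha>) u y)"
proof -
  define s where "s = cf_sgn \<alpha> 0"
  have s: "s = 1 \<or> s = -1" unfolding s_def by (rule cf_sgn_cases[OF irr])
  define z where "z = polar_pt s u y"
  have z: "z \<in> MM \<alpha>" "z \<noteq> 0" unfolding MM_eq[OF irr] z_def s_def using f by auto
  then obtain w0 where w0: "w0 \<in> I_top \<alpha>" "z = cnj (ex w0)" by (auto simp: MM_def)
  have T: "cnj (ex (T_lift \<alpha> w)) = polar_pt s (u + cf_rem \<alpha> 0) (rot (cf_rem \<alpha>) (cf_sgn \<alpha>) u y)"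
    if w: "w \<in> I_top \<alpha>" "z = cnj (ex w)" for w
  proof -
    have fw: "fib (cf_rem \<alpha>) (cf_sgn \<alpha>) (- of_int (cf_sgn \<alpha> 0) * Re w) (Im w)"
      using w(1) unfolding I_top_eq[OF irr] by blast
    have "polar_pt s u y = polar_pt s (- of_int s * Re w) (Im w)"
      using w(2) unfolding cnj_ex_polar[OF s] z_def .
    then obtain k :: int where k: "y = Im w" "- of_int s * Re w = u + of_int k"
      unfolding polar_pt_eq_iff[OF s] by blast
    obtain l :: int where l: "- of_int s * Re (T_lift \<alpha> w) = (u + cf_rem \<alpha> 0) + of_int (k + l)"
      using T_lift_eq(2)[OF irr fw] k(2) unfolding s_def by (metis add.assoc add.commute of_int_add)
    show ?thesis
      unfolding cnj_ex_polar[OF s] T_lift_eq(1)[OF irr fw]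
      by (subst polar_pt_eq_iff[OF s])
        (use l k rot_cong[OF k(2), of "cf_rem \<alpha>" "cf_sgn \<alpha>" y] in \<open>auto simp: s_def intro!: exI[of _ "- (k + l)"] simp del: cf_rem.simps cf_sgn.simps\<close>)
  qed
  have "(THE z'. \<exists>w\<in>I_top \<alpha>. z = cnj (ex w) \<and> z' = cnj (ex (T_lift \<alpha> w)))
     = polar_pt s (u + cf_rem \<alpha> 0) (rot (cf_rem \<alpha>) (cf_sgn \<alpha>) u y)"
    by (rule the_equality) (use w0 T in \<open>metis, metis\<close>)
  then show ?thesis using z unfolding s_def[symmetric] z_def[symmetric] by (simp add: TT_def)
qed

section \<open>Compactness, homeomorphism and symmetries\<close>

text \<open>Formal counterpart of the sign with index 0 dropping out of all heights. With
  \<open>cf_sgn_minus\<close> these rules reduce the passage from \<alpha> to -\<alpha> to a change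
  of orientation.\<close>

lemma sh_fun_upd_0 [simp]: "sh (e(0 := c)) = sh e"
  by (simp add: sh_def fun_eq_iff)

lemma next_u_fun_upd_0 [simp]: "next_u r (e(0 := c)) u = next_u r e u"
  by (simp add: next_u_def)

lemma pull_fun_upd_0 [simp]: "pull m r (e(0 := c)) = pull m r e"
  by (cases m) (simp_all add: fun_eq_iff)

lemma deep_fun_upd_0 [simp]: "deep m r (e(0 := c)) = deep m r e"
  by (cases m) (simp_all add: fun_eq_iff)

lemma fib_fun_upd_0 [simp]: "fib r (e(0 := c)) = fib r e"
  by (simp add: fib_def fun_eq_iff)

lemma rot_fun_upd_0 [simp]: "rot r (e(0 := c)) = rot r e"
  by (simp add: rot_def fun_eq_iff)

lemma MM_cases:
  assumes "\<alpha> \<notin> \<rat>" "z \<in> MM \<alpha>" "z \<noteq> 0"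
  obtains u y where "z = polar_pt (cf_sgn \<alpha> 0) u y" "fib (cf_rem \<alpha>) (cf_sgn \<alpha>) u y"
  using assms unfolding MM_eq[OF assms(1)] by blast

lemma polar_pt_in_MM:
  assumes "\<alpha> \<notin> \<rat>"
  shows "polar_pt (cf_sgn \<alpha> 0) u y \<in> MM \<alpha> \<longleftrightarrow> fib (cf_rem \<alpha>) (cf_sgn \<alpha>) u y"
  using polar_pt_eq_iff[OF cf_sgn_cases[OF assms, of 0]] fib_cong unfolding MM_eq[OF assms]
  by (auto simp del: cf_sgn.simps)

lemma zero_in_MM: "0 \<in> MM \<alpha>"
  by (simp add: MM_def)

lemma TT_outside: "z \<notin> MM \<alpha> \<Longrightarrow> TT \<alpha> z = undefined"
  by (simp add: TT_def)

lemma MM_plus_one: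
  assumes "\<alpha> \<notin> \<rat>"
  shows "MM (\<alpha> + 1) = MM \<alpha>"
proof -
  have "\<alpha> + 1 \<notin> \<rat>" using assms by (metis Rats_1 Rats_diff add_diff_cancel_right')
  then show ?thesis
    using assms by (simp add: MM_eq cf_rem_plus_one cf_sgn_plus_one del: cf_rem.simps cf_sgn.simps)
qed

lemma TT_plus_one:
  assumes "\<alpha> \<notin> \<rat>"
  shows "TT (\<alpha> + 1) = TT \<alpha>"
proof
  fix z
  have irr: "\<alpha> + 1 \<notin> \<rat>" using assms by (metis Rats_1 Rats_diff add_diff_cancel_right')
  show "TT (\<alpha> + 1) z = TT \<alpha> z"
  proof (cases "z \<in> MM \<alpha> \<and> z \<noteq> 0")
    case True
    then obtain u y where z: "z = polar_pt (cf_sgn \<alpha> 0) u y" "fib (cf_rem \<alpha>) (cf_sgn \<alpha>) u y"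
      using MM_cases[OF assms] by metis
    then show ?thesis
      using TT_eq[OF irr, of u y] TT_eq[OF assms, of u y]
      by (simp add: cf_rem_plus_one cf_sgn_plus_one[OF assms] del: cf_rem.simps cf_sgn.simps)
  next
    case False
    then show ?thesis using TT_0 TT_outside MM_plus_one[OF assms] by metis
  qed
qed

lemma irrational_minus: "\<alpha> \<notin> \<rat> \<Longrightarrow> - \<alpha> \<notin> \<rat>" for \<alpha> :: real
  by (metis Rats_minus_iff)

lemma MM_minus:
  assumes "\<alpha> \<notin> \<rat>"
  shows "MM (- \<alpha>) = cnj ` MM \<alpha>"
proof -
  have "cf_sgn (- \<alpha>) 0 = - cf_sgn \<alpha> 0" by (simp only: cf_sgn_minus[OF assms] fun_upd_same)
  then have "MM (- \<alpha>) = {cnj (polar_pt (cf_sgn \<alpha> 0) u y) | u y. fib (cf_rem \<alpha>) (cf_sgn \<alpha>) u y} \<union> {0}"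
    unfolding MM_eq[OF irrational_minus[OF assms]] cnj_polar_pt
    by (simp add: cf_rem_minus cf_sgn_minus[OF assms] del: cf_rem.simps cf_sgn.simps)
  also have "\<dots> = cnj ` MM \<alpha>" unfolding MM_eq[OF assms] by auto
  finally show ?thesis .
qed

lemma TT_minus:
  assumes "\<alpha> \<notin> \<rat>" "z \<in> MM (- \<alpha>)"
  shows "TT (- \<alpha>) z = cnj (TT \<alpha> (cnj z))"
proof (cases "z = 0")
  case False
  have s: "cf_sgn (- \<alpha>) 0 = - cf_sgn \<alpha> 0" by (simp only: cf_sgn_minus[OF assms(1)] fun_upd_same)
  obtain u y where z: "z = polar_pt (- cf_sgn \<alpha> 0) u y" "fib (cf_rem \<alpha>) (cf_sgn \<alpha>) u y"
    using MM_cases[OF irrational_minus[OF assms(1)] assms(2) False]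
    by (auto simp: cf_rem_minus cf_sgn_minus[OF assms(1)] simp del: cf_rem.simps cf_sgn.simps)
  have "fib (cf_rem (- \<alpha>)) (cf_sgn (- \<alpha>)) u y"
    using z(2) by (simp add: cf_rem_minus cf_sgn_minus[OF assms(1)] del: cf_rem.simps cf_sgn.simps)
  from TT_eq[OF irrational_minus[OF assms(1)] this]
  show ?thesis
    unfolding z(1) cnj_polar_pt s minus_minus TT_eq[OF assms(1) z(2)]
    by (simp add: cf_rem_minus cf_sgn_minus[OF assms(1)] del: cf_rem.simps cf_sgn.simps)
qed (simp add: TT_0)

lemma tendsto_polar_pt:
  assumes "(U \<longlongrightarrow> u) F" "(V \<longlongrightarrow> y) F"
  shows "((\<lambda>i. polar_pt s (U i) (V i)) \<longlongrightarrow> polar_pt s u y) F"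
  unfolding polar_pt_def cis_conv_exp by (intro tendsto_intros assms)

text \<open>Displacement of heights by at most \<open>2\<close> is a factor
  \<open>exp (4 * pi)\<close> in modulus. It gives continuity at \<open>0\<close>, where polar
  coordinates break down.\<close>

lemma TT_norm_le:
  assumes "\<alpha> \<notin> \<rat>" "z \<in> MM \<alpha>"
  shows "cmod (TT \<alpha> z) \<le> exp (4 * pi) * cmod z"
proof (cases "z = 0")
  case False
  obtain u y where z: "z = polar_pt (cf_sgn \<alpha> 0) u y" "fib (cf_rem \<alpha>) (cf_sgn \<alpha>) u y"
    using MM_cases[OF assms False] .
  have "y - 2 \<le> rot (cf_rem \<alpha>) (cf_sgn \<alpha>) u y"
    using rot_dist[OF cf_system_cf[OF assms(1)], of u y] by linarith
  then have "2 * pi * (y - 2) \<le> 2 * pi * rot (cf_rem \<alpha>) (cf_sgn \<alpha>) u y" by simp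
  then show ?thesis
    unfolding z(1) TT_eq[OF assms(1) z(2)] by (simp add: algebra_simps flip: exp_add)
qed (simp add: TT_0)

lemma polar_pt_surj:
  assumes "s = 1 \<or> s = -1" "z \<noteq> 0"
  obtains u where "z = polar_pt s u (- ln (cmod z) / (2 * pi))"
proof -
  have "exp (- (2 * pi * (- ln (cmod z) / (2 * pi)))) = cmod z" using assms(2) by simp
  moreover have "2 * pi * (of_int s * (of_int s * Arg z / (2 * pi))) = Arg z" using assms(1) by auto
  ultimately have "polar_pt s (of_int s * Arg z / (2 * pi)) (- ln (cmod z) / (2 * pi)) = of_real (cmod z) * cis (Arg z)"
    unfolding polar_pt_def by (simp only:)
  also have "\<dots> = z" using rcis_cmod_Arg[of z] by (simp add: rcis_def)
  finally show thesis using that by metis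
qed

text \<open>Positions are measured from \<open>u\<close> by \<open>Arg (Z i / z)\<close>, whose
  argument tends to 1 and so stays away from the branch cut.\<close>

lemma polar_pt_lift:
  assumes s: "s = 1 \<or> s = -1" and "(Z \<longlongrightarrow> polar_pt s u y) F"
  obtains U V where "(U \<longlongrightarrow> u) F" "(V \<longlongrightarrow> y) F" "\<forall>\<^sub>F i in F. Z i = polar_pt s (U i) (V i)"
proof -
  define z where "z = polar_pt s u y"
  have z: "z \<noteq> 0" by (simp add: z_def)
  define U where "U i = u + of_int s * (Arg (Z i / z) / (2 * pi))" for i
  define V where "V i = - ln (cmod (Z i)) / (2 * pi)" for i
  have Zz: "(Z \<longlongrightarrow> z) F" using assms(2) by (simp add: z_def)
  have "((\<lambda>i. Arg (Z i / z)) \<longlongrightarrow> Arg (z / z)) F"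
  proof (rule tendsto_compose[OF continuous_at_Arg[unfolded isCont_def]])
    show "((\<lambda>i. Z i / z) \<longlongrightarrow> z / z) F" by (intro tendsto_divide Zz tendsto_const z)
  qed (use z in simp)
  then have "(U \<longlongrightarrow> u + of_int s * (0 / (2 * pi))) F"
    unfolding U_def by (intro tendsto_intros) (use z in \<open>auto simp: Arg_1\<close>)
  then have U: "(U \<longlongrightarrow> u) F" by simp
  have "(V \<longlongrightarrow> - ln (cmod z) / (2 * pi)) F"
    unfolding V_def by (intro tendsto_intros Zz) (use z in auto)
  then have V: "(V \<longlongrightarrow> y) F" by (simp add: z_def)
  have "\<forall>\<^sub>F i in F. Z i \<noteq> 0" using Zz z by (rule tendsto_imp_eventually_ne)
  then have "\<forall>\<^sub>F i in F. Z i = polar_pt s (U i) (V i)"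
  proof eventually_elim
    case (elim i)
    have "polar_pt s (U i) (V i) = of_real (cmod (Z i)) * (cis (2 * pi * (of_int s * u)) * cis (Arg (Z i / z)))"
    proof -
      have "2 * pi * (of_int s * U i) = 2 * pi * (of_int s * u) + Arg (Z i / z)"
        using s by (auto simp: U_def algebra_simps)
      moreover have "exp (- (2 * pi * V i)) = cmod (Z i)" using elim by (simp add: V_def)
      ultimately show ?thesis unfolding polar_pt_def by (simp only: cis_mult)
    qed
    also have "cis (2 * pi * (of_int s * u)) = z / of_real (cmod z)"
      by (simp add: z_def) (simp add: polar_pt_def)
    also have "cis (Arg (Z i / z)) = (Z i / z) / of_real (cmod (Z i / z))"
      using rcis_cmod_Arg[of "Z i / z"] elim z
      by (metis divide_eq_0_iff nonzero_mult_div_cancel_left norm_eq_zero of_real_eq_0_iff rcis_def)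
    also have "of_real (cmod (Z i)) * (z / of_real (cmod z) * ((Z i / z) / of_real (cmod (Z i / z)))) = Z i"
      using elim z by (simp add: norm_divide)
    finally show ?case by simp
  qed
  with U V show thesis by (rule that)
qed

text \<open>With constant \<open>A\<close> this gives closedness of \<open>MM \<alpha>\<close> and
  continuity of \<open>TT \<alpha>\<close>; with varying \<open>A\<close>, the upper half of
  Hausdorff continuity.\<close>

lemma MM_TT_limit:
  assumes irr: "\<alpha> \<notin> \<rat>" and A: "(A \<longlongrightarrow> \<alpha>) F" "\<forall>\<^sub>F i in F. A i \<notin> \<rat>"
    and Z: "(Z \<longlongrightarrow> z) F" "\<forall>\<^sub>F i in F. Z i \<in> MM (A i)" and F: "F \<noteq> bot"
  shows "z \<in> MM \<alpha>" "((\<lambda>i. TT (A i) (Z i)) \<longlongrightarrow> TT \<alpha> z) F"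
proof -
  have "z \<in> MM \<alpha> \<and> ((\<lambda>i. TT (A i) (Z i)) \<longlongrightarrow> TT \<alpha> z) F"
  proof (cases "z = 0")
    case True
    have "((\<lambda>i. exp (4 * pi) * cmod (Z i)) \<longlongrightarrow> exp (4 * pi) * cmod 0) F"
      by (intro tendsto_intros Z(1)[unfolded True])
    then have "((\<lambda>i. exp (4 * pi) * cmod (Z i)) \<longlongrightarrow> 0) F" by simp
    moreover have "\<forall>\<^sub>F i in F. norm (TT (A i) (Z i)) \<le> exp (4 * pi) * cmod (Z i)"
      using A(2) Z(2) by eventually_elim (rule TT_norm_le)
    ultimately have "((\<lambda>i. TT (A i) (Z i)) \<longlongrightarrow> 0) F"
      by (rule Lim_null_comparison[rotated])
    then show ?thesis using True by (simp add: TT_0 zero_in_MM)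
  next
    case False
    define s where "s = cf_sgn \<alpha> 0"
    have s: "s = 1 \<or> s = -1" unfolding s_def by (rule cf_sgn_cases[OF irr])
    note sys = cf_system_cf[OF irr] and st = cf_tendsto[OF irr A]
    obtain u y where z: "z = polar_pt s u y" using polar_pt_surj[OF s False] by metis
    obtain U V where U: "(U \<longlongrightarrow> u) F" "(V \<longlongrightarrow> y) F" "\<forall>\<^sub>F i in F. Z i = polar_pt s (U i) (V i)"
      using polar_pt_lift[OF s Z(1)[unfolded z]] .
    have "\<forall>\<^sub>F i in F. cf_sgn (A i) 0 = s" using st by (simp add: sys_tendsto_def s_def del: cf_sgn.simps)
    with U(3) A(2) Z(2) have ev: "\<forall>\<^sub>F i in F. cf_sgn (A i) 0 = s \<and> A i \<notin> \<rat> \<and>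
       Z i = polar_pt s (U i) (V i) \<and> fib (cf_rem (A i)) (cf_sgn (A i)) (U i) (V i)"
      by eventually_elim (metis polar_pt_in_MM)
    have sysA: "\<forall>\<^sub>F i in F. cf_system (cf_rem (A i)) (cf_sgn (A i))"
      using A(2) by eventually_elim (rule cf_system_cf)
    \<comment> \<open>Membership is a family of weak inequalities between continuous quantities, one
      for each depth, and survives the limit.\<close>
    have "-1 \<le> deep m (cf_rem \<alpha>) (cf_sgn \<alpha>) u y" for m
      by (rule tendsto_lowerbound[OF deep_tendsto[OF st sys sysA U(1,2)] _ F])
        (use ev in eventually_elim, simp add: fib_def del: cf_rem.simps cf_sgn.simps)
    then have fib: "fib (cf_rem \<alpha>) (cf_sgn \<alpha>) u y" by (simp add: fib_def)
    then have "z \<in> MM \<alpha>" unfolding z s_def polar_pt_in_MM[OF irr] .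
    have "((\<lambda>i. polar_pt s (U i + cf_rem (A i) 0) (rot (cf_rem (A i)) (cf_sgn (A i)) (U i) (V i)))
      \<longlongrightarrow> polar_pt s (u + cf_rem \<alpha> 0) (rot (cf_rem \<alpha>) (cf_sgn \<alpha>) u y)) F"
      by (intro tendsto_polar_pt tendsto_intros rot_tendsto[OF st sys sysA] U sys_tendstoD[OF st])
    moreover have "\<forall>\<^sub>F i in F. polar_pt s (U i + cf_rem (A i) 0) (rot (cf_rem (A i)) (cf_sgn (A i)) (U i) (V i))
       = TT (A i) (Z i)"
      using ev by eventually_elim (metis TT_eq)
    ultimately have "((\<lambda>i. TT (A i) (Z i)) \<longlongrightarrow> polar_pt s (u + cf_rem \<alpha> 0) (rot (cf_rem \<alpha>) (cf_sgn \<alpha>) u y)) F"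
      by (rule Lim_transform_eventually)
    then show ?thesis using \<open>z \<in> MM \<alpha>\<close> unfolding z s_def TT_eq[OF irr fib] by blast
  qed
  then show "z \<in> MM \<alpha>" "((\<lambda>i. TT (A i) (Z i)) \<longlongrightarrow> TT \<alpha> z) F" by auto
qed

lemma MM_bounded:
  assumes "\<alpha> \<notin> \<rat>" "z \<in> MM \<alpha>"
  shows "cmod z \<le> exp (2 * pi)"
proof (cases "z = 0")
  case False
  obtain u y where z: "z = polar_pt (cf_sgn \<alpha> 0) u y" "fib (cf_rem \<alpha>) (cf_sgn \<alpha>) u y"
    using MM_cases[OF assms False] .
  have "2 * pi * (-1) \<le> 2 * pi * y" using fib_ge[OF z(2)] by (intro mult_left_mono) auto
  then show ?thesis unfolding z(1) by simp
qed simp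

lemma compact_MM:
  assumes "\<alpha> \<notin> \<rat>"
  shows "compact (MM \<alpha>)"
proof -
  have "bounded (MM \<alpha>)" using MM_bounded[OF assms] by (auto simp: bounded_iff)
  moreover have "closed (MM \<alpha>)"
    unfolding closed_sequential_limits
    using MM_TT_limit(1)[OF assms tendsto_const, of sequentially] assms by auto
  ultimately show ?thesis by (simp add: compact_eq_bounded_closed)
qed

lemma starlike_MM:
  assumes irr: "\<alpha> \<notin> \<rat>"
  shows "starlike_about_0 (MM \<alpha>)"
  unfolding starlike_about_0_def
proof (intro ballI)
  fix z and \<rho> :: real assume z: "z \<in> MM \<alpha>" and \<rho>: "\<rho> \<in> {0..1}"
  show "of_real \<rho> * z \<in> MM \<alpha>"
  proof (cases "z = 0 \<or> \<rho> = 0")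
    case False
    then obtain u y where u: "z = polar_pt (cf_sgn \<alpha> 0) u y" "fib (cf_rem \<alpha>) (cf_sgn \<alpha>) u y"
      using MM_cases[OF irr z] by metis
    have \<rho>: "0 < \<rho>" "\<rho> \<le> 1" using \<rho> False by auto
    have "exp (- (2 * pi * (y - ln \<rho> / (2 * pi)))) = exp (- (2 * pi * y) + ln \<rho>)"
      by (simp add: algebra_simps)
    also have "\<dots> = \<rho> * exp (- (2 * pi * y))" using \<rho> by (simp only: exp_add exp_ln mult.commute)
    finally have "of_real \<rho> * z = polar_pt (cf_sgn \<alpha> 0) u (y - ln \<rho> / (2 * pi))"
      unfolding u(1) by (simp add: polar_pt_def del: cf_sgn.simps)
    moreover have "y \<le> y - ln \<rho> / (2 * pi)" using \<rho> by (simp add: divide_nonpos_pos)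
    ultimately show ?thesis
      using fib_mono[OF cf_system_cf[OF irr] u(2)] polar_pt_in_MM[OF irr] by simp
  qed (auto simp: zero_in_MM)
qed

lemma one_in_MM:
  assumes "\<alpha> \<notin> \<rat>"
  shows "1 \<in> MM \<alpha>"
  using fib_0[OF cf_system_cf[OF assms]] polar_pt_in_MM[OF assms, of 0 0] by (simp add: polar_pt_def)

section \<open>Bijectivity, homeomorphism and rotation\<close>

lemma TT_image:
  assumes irr: "\<alpha> \<notin> \<rat>"
  shows "TT \<alpha> ` MM \<alpha> = MM \<alpha>"
proof (intro equalityI subsetI)
  fix z assume "z \<in> TT \<alpha> ` MM \<alpha>"
  then obtain v where v: "v \<in> MM \<alpha>" "z = TT \<alpha> v" by blast
  show "z \<in> MM \<alpha>"
  proof (cases "v = 0")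
    case False
    obtain u y where u: "v = polar_pt (cf_sgn \<alpha> 0) u y" "fib (cf_rem \<alpha>) (cf_sgn \<alpha>) u y"
      using MM_cases[OF irr v(1) False] .
    show ?thesis
      unfolding v(2) u(1) TT_eq[OF irr u(2)] polar_pt_in_MM[OF irr] fib_rot_iff[OF cf_system_cf[OF irr]]
      by (rule u(2))
  qed (use v in \<open>simp add: TT_0\<close>)
next
  fix z assume z: "z \<in> MM \<alpha>"
  show "z \<in> TT \<alpha> ` MM \<alpha>"
  proof (cases "z = 0")
    case True
    then show ?thesis using zero_in_MM TT_0 by (metis imageI)
  next
    case False
    obtain v y where v: "z = polar_pt (cf_sgn \<alpha> 0) v y" "fib (cf_rem \<alpha>) (cf_sgn \<alpha>) v y"
      using MM_cases[OF irr z False] .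
    define u where "u = v - cf_rem \<alpha> 0"
    have uv: "v = u + cf_rem \<alpha> 0" by (simp add: u_def)
    obtain x where x: "rot (cf_rem \<alpha>) (cf_sgn \<alpha>) u x = y" using rot_surj[OF cf_system_cf[OF irr]] by blast
    have "fib (cf_rem \<alpha>) (cf_sgn \<alpha>) u x"
      using v(2) unfolding uv x[symmetric] fib_rot_iff[OF cf_system_cf[OF irr]] .
    then have "polar_pt (cf_sgn \<alpha> 0) u x \<in> MM \<alpha>" "TT \<alpha> (polar_pt (cf_sgn \<alpha> 0) u x) = z"
      using TT_eq[OF irr] polar_pt_in_MM[OF irr] by (simp_all only: v(1) uv x)
    then show ?thesis by blast
  qed
qed

lemma TT_nonzero:
  assumes "\<alpha> \<notin> \<rat>" "z \<in> MM \<alpha>" "z \<noteq> 0"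
  shows "TT \<alpha> z \<noteq> 0"
  by (rule MM_cases[OF assms]) (simp only: TT_eq[OF assms(1)] polar_pt_nonzero not_False_eq_True)

lemma TT_inj:
  assumes irr: "\<alpha> \<notin> \<rat>"
  shows "inj_on (TT \<alpha>) (MM \<alpha>)"
proof (rule inj_onI)
  fix z z' assume z: "z \<in> MM \<alpha>" "z' \<in> MM \<alpha>" and eq: "TT \<alpha> z = TT \<alpha> z'"
  note s = cf_sgn_cases[OF irr, of 0]
  show "z = z'"
  proof (cases "z = 0 \<or> z' = 0")
    case True
    then show ?thesis using TT_nonzero[OF irr] z eq TT_0 by metis
  next
    case False
    obtain u y where u: "z = polar_pt (cf_sgn \<alpha> 0) u y" "fib (cf_rem \<alpha>) (cf_sgn \<alpha>) u y"
      using MM_cases[OF irr z(1)] False by metis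
    obtain u' y' where u': "z' = polar_pt (cf_sgn \<alpha> 0) u' y'" "fib (cf_rem \<alpha>) (cf_sgn \<alpha>) u' y'"
      using MM_cases[OF irr z(2)] False by metis
    obtain k :: int where k: "rot (cf_rem \<alpha>) (cf_sgn \<alpha>) u y = rot (cf_rem \<alpha>) (cf_sgn \<alpha>) u' y'"
      "u' + cf_rem \<alpha> 0 = u + cf_rem \<alpha> 0 + of_int k"
      using eq unfolding u(1) u'(1) TT_eq[OF irr u(2)] TT_eq[OF irr u'(2)] polar_pt_eq_iff[OF s] by blast
    then have k': "u' = u + of_int k" by simp
    then have "y = y'" using k(1) rot_inj[OF cf_system_cf[OF irr]] rot_cong[OF k'] by metis
    then show ?thesis unfolding u(1) u'(1) polar_pt_eq_iff[OF s] using k' by blast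
  qed
qed

lemma TT_homeomorphism:
  assumes irr: "\<alpha> \<notin> \<rat>"
  shows "\<exists>g. homeomorphism (MM \<alpha>) (MM \<alpha>) (TT \<alpha>) g"
proof -
  have "continuous_on (MM \<alpha>) (TT \<alpha>)"
    unfolding continuous_on_def
  proof
    fix z assume "z \<in> MM \<alpha>"
    show "(TT \<alpha> \<longlongrightarrow> TT \<alpha> z) (at z within MM \<alpha>)"
    proof (cases "at z within MM \<alpha> = bot")
      case False
      show ?thesis
        using MM_TT_limit(2)[OF irr tendsto_const _ tendsto_ident_at _ False] irr
        by (simp add: eventually_at_filter)
    qed simp
  qed
  then show ?thesis
    using homeomorphism_compact[OF compact_MM[OF irr] _ TT_image[OF irr] TT_inj[OF irr]] by blast
qed

lemma polar_pt_rotate: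
  assumes irr: "\<alpha> \<notin> \<rat>"
  shows "cis (2 * pi * (of_int (cf_sgn \<alpha> 0) * (u + cf_rem \<alpha> 0))) = cis (2 * pi * (of_int (cf_sgn \<alpha> 0) * u + \<alpha>))"
proof -
  have "\<alpha> = of_int (near_int \<alpha>) + of_int (cf_sgn \<alpha> 0) * cf_rem \<alpha> 0"
    using near_decomp[OF irr] by simp
  then have *: "of_int (cf_sgn \<alpha> 0) * u + \<alpha> = of_int (cf_sgn \<alpha> 0) * (u + cf_rem \<alpha> 0) + of_int (near_int \<alpha>)"
    by (simp add: algebra_simps del: cf_rem.simps cf_sgn.simps)
  show ?thesis
    unfolding cis_eq_cis_iff * by (rule exI, rule distrib_left)
qed

lemma TT_tangential:
  assumes irr: "\<alpha> \<notin> \<rat>"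
  shows "tangential_rotation \<alpha> (MM \<alpha>) (TT \<alpha>)"
  unfolding tangential_rotation_def
proof (intro exI[of _ "\<lambda>\<rho> \<theta>. cmod (TT \<alpha> (of_real \<rho> * cis (2 * pi * \<theta>)))"] conjI allI impI)
  fix \<rho> \<theta> :: real assume \<rho>: "0 \<le> \<rho>" and z: "of_real \<rho> * cis (2 * pi * \<theta>) \<in> MM \<alpha>"
  note s = cf_sgn_cases[OF irr, of 0]
  show "TT \<alpha> (of_real \<rho> * cis (2 * pi * \<theta>))
    = of_real (cmod (TT \<alpha> (of_real \<rho> * cis (2 * pi * \<theta>)))) * cis (2 * pi * (\<theta> + \<alpha>))"
  proof (cases "\<rho> = 0")
    case False
    define u where "u = of_int (cf_sgn \<alpha> 0) * \<theta>"
    define y where "y = - ln \<rho> / (2 * pi)"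
    have su: "of_int (cf_sgn \<alpha> 0) * u = \<theta>" using sgn_sq[OF s] by (simp add: u_def)
    have zp: "of_real \<rho> * cis (2 * pi * \<theta>) = polar_pt (cf_sgn \<alpha> 0) u y"
      unfolding polar_pt_def su using \<rho> False by (simp add: y_def)
    then have f: "fib (cf_rem \<alpha>) (cf_sgn \<alpha>) u y" using z polar_pt_in_MM[OF irr] by simp
    show ?thesis
      unfolding zp TT_eq[OF irr f] cmod_polar_pt
      unfolding polar_pt_def polar_pt_rotate[OF irr] su ..
  qed (simp add: TT_0)
qed simp

section \<open>Hausdorff continuity\<close>

text \<open>Instead of \<open>z\<close>, a nearby point over an orbit position is followed: there
  the fibre is a half-line whose tip depends continuously on \<alpha>.\<close>

lemma MM_limit_point_approx:
  assumes irr: "\<alpha> \<notin> \<rat>" and A: "A \<longlonglongrightarrow> \<alpha>" "\<And>i. A i \<notin> \<rat>" and z: "z \<in> MM \<alpha>" and \<epsilon>: "0 < \<epsilon>"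
  obtains p P where "dist p z < \<epsilon>" "P \<longlonglongrightarrow> p" "\<forall>\<^sub>F i in sequentially. P i \<in> MM (A i)"
proof (cases "z = 0")
  case True
  show thesis by (rule that[of 0 "\<lambda>_. 0"]) (use True \<epsilon> zero_in_MM in auto)
next
  case False
  note sys = cf_system_cf[OF irr]
  have st: "sys_tendsto (\<lambda>i. cf_rem (A i)) (\<lambda>i. cf_sgn (A i)) (cf_rem \<alpha>) (cf_sgn \<alpha>) sequentially"
    using cf_tendsto[OF irr A(1)] A(2) by simp
  define s where "s = cf_sgn \<alpha> 0"
  obtain u y where u: "z = polar_pt s u y" "fib (cf_rem \<alpha>) (cf_sgn \<alpha>) u y"
    using MM_cases[OF irr z False] unfolding s_def .
  have "\<forall>n. \<exists>v. \<exists>(k::nat) (l::int). \<bar>of_nat k * cf_rem \<alpha> 0 + of_int l - u\<bar> < 1 / real (Suc n) \<and> \<bar>v - y\<bar> < 1 / real (Suc n)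
      \<and> orbit (cf_rem \<alpha>) (cf_sgn \<alpha>) k \<le> v"
  proof
    fix n
    show "\<exists>v. \<exists>(k::nat) (l::int). \<bar>of_nat k * cf_rem \<alpha> 0 + of_int l - u\<bar> < 1 / real (Suc n) \<and> \<bar>v - y\<bar> < 1 / real (Suc n)
      \<and> orbit (cf_rem \<alpha>) (cf_sgn \<alpha>) k \<le> v"
      using orbit_dense[OF sys u(2), of "1 / real (Suc n)"] by auto
  qed
  then obtain v k l where vkl: "\<And>n. \<bar>of_nat (k n :: nat) * cf_rem \<alpha> 0 + of_int (l n :: int) - u\<bar> < 1 / real (Suc n)"
     "\<And>n. \<bar>v n - y\<bar> < 1 / real (Suc n)" "\<And>n. orbit (cf_rem \<alpha>) (cf_sgn \<alpha>) (k n) \<le> v n"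
    by metis
  have lim: "f \<longlonglongrightarrow> a" if "\<And>n. \<bar>f n - a\<bar> < 1 / real (Suc n)" for f and a :: real
  proof -
    have "(\<lambda>n. 1 / real (Suc n)) \<longlonglongrightarrow> 0" by (rule LIMSEQ_Suc[OF lim_1_over_n])
    then have "(\<lambda>n. f n - a) \<longlonglongrightarrow> 0"
    proof (rule Lim_null_comparison[rotated])
      show "\<forall>\<^sub>F n in sequentially. norm (f n - a) \<le> 1 / real (Suc n)"
        unfolding real_norm_def by (intro always_eventually allI less_imp_le that)
    qed
    then show ?thesis by (simp add: LIM_zero_iff)
  qed
  have "(\<lambda>n. polar_pt s (of_nat (k n) * cf_rem \<alpha> 0 + of_int (l n)) (v n)) \<longlonglongrightarrow> z"
    unfolding u(1) by (intro tendsto_polar_pt lim vkl)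
  then have "\<forall>\<^sub>F n in sequentially. dist (polar_pt s (of_nat (k n) * cf_rem \<alpha> 0 + of_int (l n)) (v n)) z < \<epsilon>"
    using \<epsilon> by (rule tendstoD)
  then obtain n where n: "dist (polar_pt s (of_nat (k n) * cf_rem \<alpha> 0 + of_int (l n)) (v n)) z < \<epsilon>"
    by (auto simp: eventually_sequentially)
  \<comment> \<open>The excess over the tip is kept constant, so that \<open>P i\<close> belongs to
    the model of \<open>A i\<close> and its height tends to \<open>v n\<close>.\<close>
  define P where "P i = polar_pt s (of_nat (k n) * cf_rem (A i) 0 + of_int (l n))
     (orbit (cf_rem (A i)) (cf_sgn (A i)) (k n) + (v n - orbit (cf_rem \<alpha>) (cf_sgn \<alpha>) (k n)))" for i
  have sysA: "cf_system (cf_rem (A i)) (cf_sgn (A i))" for i by (rule cf_system_cf[OF A(2)])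
  have "P \<longlonglongrightarrow> polar_pt s (of_nat (k n) * cf_rem \<alpha> 0 + of_int (l n))
     (orbit (cf_rem \<alpha>) (cf_sgn \<alpha>) (k n) + (v n - orbit (cf_rem \<alpha>) (cf_sgn \<alpha>) (k n)))"
    unfolding P_def
    by (intro tendsto_polar_pt tendsto_intros sys_tendstoD[OF st] orbit_tendsto[OF st sys])
      (simp add: sysA)
  then have "P \<longlonglongrightarrow> polar_pt s (of_nat (k n) * cf_rem \<alpha> 0 + of_int (l n)) (v n)" by simp
  moreover have "\<forall>\<^sub>F i in sequentially. P i \<in> MM (A i)"
  proof -
    have "\<forall>\<^sub>F i in sequentially. cf_sgn (A i) 0 = s" using st by (simp add: sys_tendsto_def s_def del: cf_sgn.simps)
    then show ?thesis
    proof eventually_elim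
      case (elim i)
      have "fib (cf_rem (A i)) (cf_sgn (A i)) (of_nat (k n) * cf_rem (A i) 0 + of_int (l n))
         (orbit (cf_rem (A i)) (cf_sgn (A i)) (k n) + (v n - orbit (cf_rem \<alpha>) (cf_sgn \<alpha>) (k n)))"
        unfolding fib_cong[OF refl] fib_orbit_iff[OF sysA] using vkl(3)[of n] by simp
      then show ?case unfolding P_def elim[symmetric] polar_pt_in_MM[OF A(2)] .
    qed
  qed
  ultimately show thesis using n that by blast
qed

text \<open>Otherwise uniformly bounded points of nearby models would accumulate at distance at
  least \<open>\<epsilon>\<close> from \<open>MM \<alpha>\<close>, against joint closedness.\<close>

lemma MM_upper_semicontinuous:
  assumes irr: "\<alpha> \<notin> \<rat>" and \<epsilon>: "0 < \<epsilon>"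
  shows "\<forall>\<^sub>F \<beta> in at \<alpha> within - \<rat>. \<forall>z\<in>MM \<beta>. infdist z (MM \<alpha>) \<le> \<epsilon>"
proof (rule sequentially_imp_eventually_within, intro allI impI, elim conjE)
  fix f assume f: "\<forall>n. f n \<in> - \<rat> \<and> f n \<noteq> \<alpha>" "f \<longlonglongrightarrow> \<alpha>"
  show "\<forall>\<^sub>F n in sequentially. \<forall>z\<in>MM (f n). infdist z (MM \<alpha>) \<le> \<epsilon>"
  proof (rule ccontr)
    assume "\<not> ?thesis"
    then obtain h :: "nat \<Rightarrow> nat" where h: "strict_mono h" "\<forall>n. \<not> (\<forall>z\<in>MM (f (h n)). infdist z (MM \<alpha>) \<le> \<epsilon>)"
      using not_eventually_sequentiallyD by blast
    then have "\<forall>n. \<exists>z. z \<in> MM (f (h n)) \<and> \<epsilon> < infdist z (MM \<alpha>)" by (meson not_le)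
    then obtain Z where Z: "\<And>n. Z n \<in> MM (f (h n))" "\<And>n. \<epsilon> < infdist (Z n) (MM \<alpha>)" by metis
    have "Z n \<in> cball 0 (exp (2 * pi))" for n using MM_bounded[OF _ Z(1)] f(1) by simp
    then obtain z g where g: "strict_mono (g :: nat \<Rightarrow> nat)" "(Z \<circ> g) \<longlonglongrightarrow> z"
      using compact_cball[of "0 :: complex" "exp (2 * pi)"] unfolding compact_def by metis
    have A: "(\<lambda>n. f (h (g n))) \<longlonglongrightarrow> \<alpha>"
      using LIMSEQ_subseq_LIMSEQ[OF f(2) strict_mono_o[OF h(1) g(1)]] by (simp add: o_def)
    have "z \<in> MM \<alpha>"
      by (rule MM_TT_limit(1)[OF irr A _ g(2)]) (use f(1) Z(1) in auto)
    then have "infdist z (MM \<alpha>) = 0" by simp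
    moreover have "(\<lambda>n. infdist ((Z \<circ> g) n) (MM \<alpha>)) \<longlonglongrightarrow> infdist z (MM \<alpha>)" by (intro tendsto_infdist g)
    then have "\<epsilon> \<le> infdist z (MM \<alpha>)"
      by (rule LIMSEQ_le_const) (use Z(2) in \<open>auto intro: less_imp_le\<close>)
    ultimately show False using \<epsilon> by simp
  qed
qed

text \<open>Compactness of \<open>MM \<alpha>\<close> replaces the badly approximated points by one
  limit \<open>z\<close>, so approximating a single point is enough.\<close>

lemma MM_lower_semicontinuous:
  assumes irr: "\<alpha> \<notin> \<rat>" and \<epsilon>: "0 < \<epsilon>"
  shows "\<forall>\<^sub>F \<beta> in at \<alpha> within - \<rat>. \<forall>z\<in>MM \<alpha>. infdist z (MM \<beta>) \<le> \<epsilon>"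
proof (rule sequentially_imp_eventually_within, intro allI impI, elim conjE)
  fix f assume f: "\<forall>n. f n \<in> - \<rat> \<and> f n \<noteq> \<alpha>" "f \<longlonglongrightarrow> \<alpha>"
  show "\<forall>\<^sub>F n in sequentially. \<forall>z\<in>MM \<alpha>. infdist z (MM (f n)) \<le> \<epsilon>"
  proof (rule ccontr)
    assume "\<not> ?thesis"
    then obtain h :: "nat \<Rightarrow> nat" where h: "strict_mono h" "\<forall>n. \<not> (\<forall>z\<in>MM \<alpha>. infdist z (MM (f (h n))) \<le> \<epsilon>)"
      using not_eventually_sequentiallyD by blast
    then have "\<forall>n. \<exists>z. z \<in> MM \<alpha> \<and> \<epsilon> < infdist z (MM (f (h n)))" by (meson not_le)
    then obtain Z where Z: "\<And>n. Z n \<in> MM \<alpha>" "\<And>n. \<epsilon> < infdist (Z n) (MM (f (h n)))" by metis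
    then obtain z g where g: "z \<in> MM \<alpha>" "strict_mono (g :: nat \<Rightarrow> nat)" "(Z \<circ> g) \<longlonglongrightarrow> z"
      using compact_MM[OF irr] unfolding compact_def by metis
    have A: "(\<lambda>n. f (h (g n))) \<longlonglongrightarrow> \<alpha>"
      using LIMSEQ_subseq_LIMSEQ[OF f(2) strict_mono_o[OF h(1) g(2)]] by (simp add: o_def)
    obtain p P where P: "dist p z < \<epsilon>" "P \<longlonglongrightarrow> p" "\<forall>\<^sub>F n in sequentially. P n \<in> MM (f (h (g n)))"
      by (rule MM_limit_point_approx[OF irr A _ g(1) \<epsilon>]) (use f(1) in auto)
    have "(\<lambda>n. dist ((Z \<circ> g) n) (P n)) \<longlonglongrightarrow> dist z p" by (intro tendsto_dist g P)
    then have "\<forall>\<^sub>F n in sequentially. dist ((Z \<circ> g) n) (P n) < \<epsilon>"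
      by (rule order_tendstoD) (use P(1) in \<open>simp add: dist_commute\<close>)
    with P(3) have "\<forall>\<^sub>F n in sequentially. False"
    proof eventually_elim
      case (elim n)
      then show ?case using infdist_le[OF elim(1), of "Z (g n)"] Z(2)[of "g n"] by simp
    qed
    then show False by simp
  qed
qed

lemma hausdorff_distance_bounds:
  assumes "A \<noteq> {}" "B \<noteq> {}" "\<forall>a\<in>A. infdist a B \<le> \<epsilon>" "\<forall>b\<in>B. infdist b A \<le> \<epsilon>"
  shows "0 \<le> hausdorff_distance A B" "hausdorff_distance A B \<le> \<epsilon>"
proof -
  obtain a where a: "a \<in> A" using assms(1) by blast
  have "0 \<le> infdist a B" by (rule infdist_nonneg)
  also have "\<dots> \<le> (SUP a\<in>A. infdist a B)"
    using assms(3) by (intro cSUP_upper a bdd_aboveI2) auto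
  finally show "0 \<le> hausdorff_distance A B" by (simp add: hausdorff_distance_def)
  show "hausdorff_distance A B \<le> \<epsilon>"
    unfolding hausdorff_distance_def using assms by (auto intro!: cSUP_least)
qed

lemma MM_hausdorff_continuous:
  assumes irr: "\<alpha> \<notin> \<rat>"
  shows "((\<lambda>\<beta>. hausdorff_distance (MM \<beta>) (MM \<alpha>)) \<longlongrightarrow> 0) (at \<alpha> within - \<rat>)"
proof (rule tendstoI)
  fix \<epsilon> :: real assume \<epsilon>: "0 < \<epsilon>"
  have "\<forall>\<^sub>F \<beta> in at \<alpha> within - \<rat>. \<forall>z\<in>MM \<beta>. infdist z (MM \<alpha>) \<le> \<epsilon>/2"
    "\<forall>\<^sub>F \<beta> in at \<alpha> within - \<rat>. \<forall>z\<in>MM \<alpha>. infdist z (MM \<beta>) \<le> \<epsilon>/2"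
    by (rule MM_upper_semicontinuous[OF irr half_gt_zero[OF \<epsilon>]])
      (rule MM_lower_semicontinuous[OF irr half_gt_zero[OF \<epsilon>]])
  then show "\<forall>\<^sub>F \<beta> in at \<alpha> within - \<rat>. dist (hausdorff_distance (MM \<beta>) (MM \<alpha>)) 0 < \<epsilon>"
  proof eventually_elim
    case (elim \<beta>)
    have "MM \<beta> \<noteq> {}" "MM \<alpha> \<noteq> {}" using zero_in_MM by blast+
    from hausdorff_distance_bounds[OF this elim] show ?case using \<epsilon> by simp
  qed
qed

section \<open>Renormalisation\<close>

text \<open>Without carries T only moves the first address; the height \<open>y\<close> one level
  down is the same throughout the \<open>j\<close> steps.\<close>

lemma TT_power_small:
  assumes irr: "\<alpha> \<notin> \<rat>" and x: "0 \<le> x" "x + real j \<le> 1 / cf_rem \<alpha> 0"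
    and f: "fib (cf_rem \<alpha>) (cf_sgn \<alpha>) (cf_rem \<alpha> 0 * x) (hgt (cf_rem \<alpha> 0) x y)"
  shows "(TT \<alpha> ^^ j) (polar_pt (cf_sgn \<alpha> 0) (cf_rem \<alpha> 0 * x) (hgt (cf_rem \<alpha> 0) x y))
      = polar_pt (cf_sgn \<alpha> 0) (cf_rem \<alpha> 0 * (x + real j)) (hgt (cf_rem \<alpha> 0) (x + real j) y)
    \<and> fib (cf_rem \<alpha>) (cf_sgn \<alpha>) (cf_rem \<alpha> 0 * (x + real j)) (hgt (cf_rem \<alpha> 0) (x + real j) y)"
  using x(2)
proof (induction j)
  case 0
  then show ?case using f by simp
next
  case (Suc j)
  note sys = cf_system_cf[OF irr]
  note r = cf_systemD[OF sys, of 0]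
  define v where "v = cf_rem \<alpha> 0 * (x + real j)"
  define w where "w = hgt (cf_rem \<alpha> 0) (x + real j) y"
  have IH: "(TT \<alpha> ^^ j) (polar_pt (cf_sgn \<alpha> 0) (cf_rem \<alpha> 0 * x) (hgt (cf_rem \<alpha> 0) x y)) = polar_pt (cf_sgn \<alpha> 0) v w"
    "fib (cf_rem \<alpha>) (cf_sgn \<alpha>) v w"
    using Suc.IH Suc.prems by (simp_all add: v_def w_def del: cf_rem.simps cf_sgn.simps)
  have a: "addr (cf_rem \<alpha>) v = x + real j"
    using addr_of[OF sys, of "x + real j" 0] x(1) Suc.prems by (simp add: v_def del: cf_rem.simps)
  have R: "rot (cf_rem \<alpha>) (cf_sgn \<alpha>) v w = hgt (cf_rem \<alpha> 0) (x + real (Suc j)) y"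
  proof -
    have "rot (cf_rem \<alpha>) (cf_sgn \<alpha>) v w = hgt (cf_rem \<alpha> 0) (x + real j + 1) (hgt_inv (cf_rem \<alpha> 0) (x + real j) w)"
      using rot_small[OF sys, of v w] Suc.prems unfolding a by (simp del: cf_rem.simps)
    also have "hgt_inv (cf_rem \<alpha> 0) (x + real j) w = y"
      by (rule hgt_inv_eq[OF r(1,2)]) (simp only: w_def)
    finally show ?thesis by (simp add: add_ac)
  qed
  have v: "v + cf_rem \<alpha> 0 = cf_rem \<alpha> 0 * (x + real (Suc j))" by (simp add: v_def algebra_simps)
  have "(TT \<alpha> ^^ Suc j) (polar_pt (cf_sgn \<alpha> 0) (cf_rem \<alpha> 0 * x) (hgt (cf_rem \<alpha> 0) x y))
      = TT \<alpha> (polar_pt (cf_sgn \<alpha> 0) v w)" by (simp only: funpow.simps(2) o_apply IH(1))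
  then show ?case
    using TT_eq[OF irr IH(2)] fib_rot_iff[OF sys, of v w] IH(2) unfolding R v by simp
qed

text \<open>The inequality is strict because \<open>phi\<close> inverts \<open>psi\<close> on the
  open half-plane.\<close>

lemma fib_gt:
  assumes "cf_system r e" "fib r e u y"
  shows "-1 < y"
proof -
  have "-1 \<le> deep (Suc 0) r e u y" using assms(2) unfolding fib_def by blast
  then have "-1 < hgt (r 0) (addr r u) (deep (Suc 0) r e u y)"
    by (rule hgt_gt_minus_one[OF cf_systemD(1,2)[OF assms(1)]])
  also have "\<dots> = y" using hgt_inv[OF cf_systemD(1,2)[OF assms(1)]] by simp
  finally show ?thesis .
qed

lemma Arg2pi_polar_pt: "Arg2pi (polar_pt 1 u y) = 2 * pi * frac u"
proof (rule Arg2pi_unique)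
  have "cis (2 * pi * frac u) = cis (2 * pi * u)"
    unfolding cis_eq_cis_iff by (rule exI[of _ "\<lfloor>u\<rfloor>"]) (simp add: frac_def algebra_simps)
  then show "of_real (exp (- (2 * pi * y))) * exp (\<i> * of_real (2 * pi * frac u)) = polar_pt 1 u y"
    by (simp only: polar_pt_def cis_conv_exp[symmetric] of_int_1 mult_1)
qed (use frac_lt_1[of u] in auto)

lemma frac_of_unit: "0 \<le> x \<Longrightarrow> x < 1 \<Longrightarrow> frac (x + of_int k) = (x :: real)"
  by (simp add: frac_unique_iff)

context
  fixes \<alpha> :: real and r :: "nat \<Rightarrow> real" and e :: "nat \<Rightarrow> int"
  assumes irr: "\<alpha> \<notin> \<rat>" and \<alpha>: "0 < \<alpha>" "\<alpha> < 1/2"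
  defines "r \<equiv> sh (cf_rem \<alpha>)" and "e \<equiv> sh (cf_sgn \<alpha>)"
begin

lemma cf_rem_0: "cf_rem \<alpha> 0 = \<alpha>"
  using cf_rem_0_small[of \<alpha>] \<alpha> by simp

lemma cf_sgn_0: "cf_sgn \<alpha> 0 = 1"
  using cf_sgn_0_small[OF irr] \<alpha> by simp

lemma system_alpha: "cf_system (cf_rem \<alpha>) (cf_sgn \<alpha>)"
  by (rule cf_system_cf[OF irr])

lemma system_shift: "cf_system r e"
  unfolding r_def e_def by (rule cf_system_sh[OF system_alpha])

lemma shifted_sgn_cases: "e 0 = 1 \<or> e 0 = -1"
  by (rule cf_systemD(4)[OF system_shift])

text \<open>\<open>psi\<close> in coordinates: \<open>x\<close> is the first address and
  \<open>y\<close> the height one level down.\<close>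

definition chart :: "real \<Rightarrow> real \<Rightarrow> complex" where
  "chart x y = polar_pt 1 (\<alpha> * x) (hgt \<alpha> x y)"

lemma psi_eq_chart:
  assumes "-1 \<le> Im w"
  shows "psi \<alpha> w = chart (Re w) (Im w)"
  using cnj_ex_polar[of 1 "YY \<alpha> 0 w"] YY_eq[OF irr assms, of 0]
  by (simp add: psi_def chart_def cf_rem_0 cf_sgn_0 del: cf_rem.simps cf_sgn.simps)

lemma chart_inj:
  assumes "chart x y = chart x' y'" "0 \<le> x" "x < 1" "0 \<le> x'" "x' < 1"
  shows "x = x'" "y = y'"
proof -
  obtain k :: int where k: "hgt \<alpha> x y = hgt \<alpha> x' y'" "\<alpha> * x' = \<alpha> * x + of_int k"
    using assms(1) unfolding chart_def by (auto simp: polar_pt_eq_iff)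
  have "\<alpha> * x < \<alpha> * 1" "\<alpha> * x' < \<alpha> * 1" using assms \<alpha> by (simp_all only: mult_less_cancel_left_pos)
  then have "\<alpha> * x < 1" "\<alpha> * x' < 1" using \<alpha> by linarith+
  moreover have "0 \<le> \<alpha> * x" "0 \<le> \<alpha> * x'" using assms \<alpha> by auto
  ultimately have "k = 0" using k(2) by linarith
  then show "x = x'" using k(2) \<alpha> by simp
  then show "y = y'"
    using k(1) hgt_strict_mono[of \<alpha> y y' x] hgt_strict_mono[of \<alpha> y' y x] \<alpha>
    by (cases y y' rule: linorder_cases) auto
qed

lemma phi_chart:
  assumes "0 \<le> x" "x < 1" "-1 < y"
  shows "phi \<alpha> (chart x y) = Complex x y"
proof -
  have "inj_on (psi \<alpha>) {w. Im w > -1 \<and> Re w \<in> {0 ..< 1}}"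
  proof (rule inj_onI)
    fix v w assume v: "v \<in> {w. Im w > -1 \<and> Re w \<in> {0 ..< 1}}" and w: "w \<in> {w. Im w > -1 \<and> Re w \<in> {0 ..< 1}}"
      and "psi \<alpha> v = psi \<alpha> w"
    then have "chart (Re v) (Im v) = chart (Re w) (Im w)" by (simp add: psi_eq_chart)
    from chart_inj[OF this] show "v = w" using v w by (simp add: complex_eqI)
  qed
  from the_inv_into_f_f[OF this, of "Complex x y"] show ?thesis
    using assms by (simp add: phi_def psi_eq_chart)
qed

lemma fib_chart:
  assumes "0 \<le> x" "x \<le> 1 / \<alpha>"
  shows "fib (cf_rem \<alpha>) (cf_sgn \<alpha>) (\<alpha> * x) (hgt \<alpha> x y) \<longleftrightarrow> fib r e (- of_int (e 0) * x) y"
  using fib_branch[OF system_alpha assms(1), of 0 y] assms(2)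
  unfolding cf_rem_0 r_def[symmetric] e_def[symmetric] by (simp add: e_def sh_def del: cf_sgn.simps)

lemma two_less_inverse: "2 < 1 / \<alpha>"
  using \<alpha> by (simp add: field_simps)

text \<open>Arguments in \<open>[0, 2 * pi * \<alpha>)\<close> are addresses in
  \<open>[0, 1)\<close>, and one vertical map down the fibre condition is that of the shifted
  system.\<close>

lemma sector_eq:
  "sector \<alpha> (MM \<alpha>) = {chart x y | x y. 0 \<le> x \<and> x < 1 \<and> fib r e (- of_int (e 0) * x) y}"
proof (intro equalityI subsetI)
  fix z assume "z \<in> sector \<alpha> (MM \<alpha>)"
  then have z: "z \<in> MM \<alpha>" "z \<noteq> 0" "Arg2pi z < 2 * pi * \<alpha>" by (auto simp: sector_def)
  obtain u y where u: "z = polar_pt 1 u y" "fib (cf_rem \<alpha>) (cf_sgn \<alpha>) u y"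
    using MM_cases[OF irr z(1,2)] unfolding cf_sgn_0 .
  have fu: "frac u < \<alpha>" using z(3) unfolding u(1) Arg2pi_polar_pt by simp
  define x where "x = frac u / \<alpha>"
  have x: "0 \<le> x" "x < 1" using fu \<alpha> by (auto simp: x_def)
  define y1 where "y1 = hgt_inv \<alpha> x y"
  have y: "hgt \<alpha> x y1 = y" unfolding y1_def by (rule hgt_inv) (use \<alpha> in auto)
  have ux: "u = \<alpha> * x + of_int \<lfloor>u\<rfloor>" using \<alpha> by (simp add: x_def frac_def)
  have "z = chart x y1"
    unfolding chart_def y u(1) by (subst polar_pt_eq_iff) (use ux in \<open>auto intro!: exI[of _ "- \<lfloor>u\<rfloor>"]\<close>)
  moreover have "fib r e (- of_int (e 0) * x) y1"
    using u(2) fib_cong[OF ux] fib_chart[of x y1] x two_less_inverse unfolding y by simp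
  ultimately show "z \<in> {chart x y | x y. 0 \<le> x \<and> x < 1 \<and> fib r e (- of_int (e 0) * x) y}" using x by blast
next
  fix z assume "z \<in> {chart x y | x y. 0 \<le> x \<and> x < 1 \<and> fib r e (- of_int (e 0) * x) y}"
  then obtain x y where z: "z = chart x y" "0 \<le> x" "x < 1" "fib r e (- of_int (e 0) * x) y" by blast
  have "\<alpha> * x < \<alpha> * 1" using z \<alpha> by (intro mult_strict_left_mono) auto
  then have ax: "0 \<le> \<alpha> * x" "\<alpha> * x < \<alpha>" using z \<alpha> by auto
  then have "\<alpha> * x < 1" using \<alpha> by linarith
  then have "frac (\<alpha> * x) = \<alpha> * x" using ax frac_of_unit[of "\<alpha> * x" 0] by simp
  then have "Arg2pi z < 2 * pi * \<alpha>" "0 \<le> Arg2pi z" unfolding z(1) chart_def Arg2pi_polar_pt using ax by auto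
  moreover have "z \<in> MM \<alpha>" "z \<noteq> 0"
    using fib_chart[of x y] z two_less_inverse polar_pt_in_MM[OF irr, of "\<alpha> * x" "hgt \<alpha> x y"] by (auto simp: chart_def cf_sgn_0 simp del: cf_sgn.simps)
  ultimately show "z \<in> sector \<alpha> (MM \<alpha>)" by (simp add: sector_def)
qed

text \<open>The first \<open>n - 1\<close> steps raise the address without a carry. Step
  \<open>n\<close> completes the turn, and its carry is one application of \<open>rot\<close> of the
  shifted system.\<close>

lemma first_return:
  assumes x: "0 \<le> x" "x < 1" and f: "fib r e (- of_int (e 0) * x) y"
  obtains n :: nat where
    "(TT \<alpha> ^^ return_time (sector \<alpha> (MM \<alpha>)) (TT \<alpha>) (chart x y)) (chart x y)
       = chart (x + real n - 1 / \<alpha>) (rot r e (- of_int (e 0) * x) y)"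
    "0 \<le> x + real n - 1 / \<alpha>" "x + real n - 1 / \<alpha> < 1"
proof -
  \<comment> \<open>The least number of steps after which the address reaches
    \<open>1 / \<alpha>\<close>; it is at least 2, in accordance with
    \<open>return_time\<close>.\<close>
  define n where "n = nat \<lceil>1 / \<alpha> - x\<rceil>"
  have gt1: "1 < 1 / \<alpha> - x" using two_less_inverse x by linarith
  then have n: "1 / \<alpha> - x \<le> real n" "real n < 1 / \<alpha> - x + 1" "2 \<le> n"
    unfolding n_def by linarith+
  obtain m where m: "n = Suc m" using n(3) by (cases n) auto
  have fx: "fib (cf_rem \<alpha>) (cf_sgn \<alpha>) (\<alpha> * x) (hgt \<alpha> x y)" using fib_chart[of x y] f x two_less_inverse by simp
  have P: "(TT \<alpha> ^^ j) (chart x y) = polar_pt 1 (\<alpha> * (x + real j)) (hgt \<alpha> (x + real j) y)"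
    "fib (cf_rem \<alpha>) (cf_sgn \<alpha>) (\<alpha> * (x + real j)) (hgt \<alpha> (x + real j) y)"
    if "x + real j \<le> 1 / \<alpha>" for j
    using TT_power_small[OF irr x(1), of j y] that fx unfolding chart_def cf_rem_0 cf_sgn_0 by auto
  define x' where "x' = x + real n - 1 / \<alpha>"
  have x': "0 \<le> x'" "x' < 1" using n by (auto simp: x'_def)
  have a': "\<alpha> * (x + real n) = \<alpha> * x' + of_int 1" using \<alpha> by (simp add: x'_def algebra_simps)
  have h': "hgt \<alpha> (x + real n) t = hgt \<alpha> x' t" for t
    using hgt_periodic[of \<alpha> x' t] \<alpha> by (simp add: x'_def)
  have mle: "x + real m < 1 / \<alpha>" "1 / \<alpha> \<le> x + real m + 1" using n m by auto
  have addr_m: "addr (cf_rem \<alpha>) (\<alpha> * (x + real m)) = x + real m"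
    using addr_of[OF system_alpha, of "x + real m" 0] mle x unfolding cf_rem_0 by simp
  have R: "rot (cf_rem \<alpha>) (cf_sgn \<alpha>) (\<alpha> * (x + real m)) (hgt \<alpha> (x + real m) y)
      = hgt \<alpha> x' (rot r e (- of_int (e 0) * x) y)"
  proof -
    have "rot (cf_rem \<alpha>) (cf_sgn \<alpha>) (\<alpha> * (x + real m)) (hgt \<alpha> (x + real m) y)
       = hgt \<alpha> (x + real m + 1) (rot r e (next_u (cf_rem \<alpha>) (cf_sgn \<alpha>) (\<alpha> * (x + real m)))
          (hgt_inv \<alpha> (x + real m) (hgt \<alpha> (x + real m) y)))"
      using rot_large[OF system_alpha, of "\<alpha> * (x + real m)" "hgt \<alpha> (x + real m) y"] mle(2)
      unfolding addr_m cf_rem_0 r_def[symmetric] e_def[symmetric] by simp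
    also have "hgt_inv \<alpha> (x + real m) (hgt \<alpha> (x + real m) y) = y"
      by (rule hgt_inv_eq) (use \<alpha> in auto)
    \<comment> \<open>The \<open>m\<close> steps without carry have changed the next position by an
      integer only.\<close>
    also have "rot r e (next_u (cf_rem \<alpha>) (cf_sgn \<alpha>) (\<alpha> * (x + real m))) y = rot r e (- of_int (e 0) * x) y"
      by (rule rot_cong[of _ _ "- e 0 * int m"])
        (unfold next_u_def addr_m, simp add: e_def sh_def algebra_simps del: cf_sgn.simps)
    also have "x + real m + 1 = x + real n" by (simp add: m)
    finally show ?thesis unfolding h' .
  qed
  have "(TT \<alpha> ^^ n) (chart x y) = TT \<alpha> (polar_pt 1 (\<alpha> * (x + real m)) (hgt \<alpha> (x + real m) y))"
    using P(1)[of m] mle by (simp add: m)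
  also have "\<dots> = polar_pt 1 (\<alpha> * (x + real m) + \<alpha>) (hgt \<alpha> x' (rot r e (- of_int (e 0) * x) y))"
    using TT_eq[OF irr P(2)[of m]] mle(1) unfolding cf_rem_0 cf_sgn_0 R by simp
  also have "\<dots> = chart x' (rot r e (- of_int (e 0) * x) y)"
  proof -
    have "\<alpha> * (x + real m) + \<alpha> = \<alpha> * x' + of_int 1" using a' by (simp add: m algebra_simps)
    then show ?thesis unfolding chart_def by (subst polar_pt_eq_iff) (auto intro!: exI[of _ "-1"])
  qed
  finally have T: "(TT \<alpha> ^^ n) (chart x y) = chart x' (rot r e (- of_int (e 0) * x) y)" .
  have fR: "fib r e (- of_int (e 0) * x') (rot r e (- of_int (e 0) * x) y)"
  proof -
    have "fib (cf_rem \<alpha>) (cf_sgn \<alpha>) (\<alpha> * (x + real m) + \<alpha>) (hgt \<alpha> x' (rot r e (- of_int (e 0) * x) y))"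
      using fib_rot_iff[OF system_alpha, of "\<alpha> * (x + real m)" "hgt \<alpha> (x + real m) y"] P(2)[of m] mle(1)
      unfolding cf_rem_0 R by simp
    moreover have c: "\<alpha> * (x + real m) + \<alpha> = \<alpha> * x' + of_int 1" using a' by (simp add: m algebra_simps)
    ultimately have "fib (cf_rem \<alpha>) (cf_sgn \<alpha>) (\<alpha> * x') (hgt \<alpha> x' (rot r e (- of_int (e 0) * x) y))"
      using fib_cong[OF c] by blast
    then show ?thesis using fib_chart[of x'] x' two_less_inverse by simp
  qed
  have "return_time (sector \<alpha> (MM \<alpha>)) (TT \<alpha>) (chart x y) = n"
    unfolding return_time_def
  proof (rule Least_equality)
    show "2 \<le> n \<and> (TT \<alpha> ^^ n) (chart x y) \<in> sector \<alpha> (MM \<alpha>)"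
      unfolding T sector_eq using n(3) x' fR by blast
    fix j assume j: "2 \<le> j \<and> (TT \<alpha> ^^ j) (chart x y) \<in> sector \<alpha> (MM \<alpha>)"
    show "n \<le> j"
    proof (rule ccontr)
      assume "\<not> n \<le> j"
      then have "j \<le> m" using m by simp
      then have jle: "x + real j < 1 / \<alpha>" using mle(1) by linarith
      then have lt: "\<alpha> * (x + real j) < 1" using \<alpha> by (simp add: field_simps)
      \<comment> \<open>For \<open>2 \<le> j < n\<close> the address lies strictly between 1 and
        \<open>1 / \<alpha>\<close>, outside the sector.\<close>
      have "\<alpha> * 1 < \<alpha> * (x + real j)" using \<alpha> x j by (intro mult_strict_left_mono) auto
      moreover from this lt have "frac (\<alpha> * (x + real j)) = \<alpha> * (x + real j)"
        using frac_of_unit[of "\<alpha> * (x + real j)" 0] \<alpha> by simp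
      moreover have "Arg2pi ((TT \<alpha> ^^ j) (chart x y)) < 2 * pi * \<alpha>" using j by (simp add: sector_def)
      ultimately show False using P(1)[of j] jle by (simp add: Arg2pi_polar_pt)
    qed
  qed
  then show thesis using that[of n] T x' unfolding x'_def by simp
qed

text \<open>\<open>psi\<close> conjugates and \<open>ex\<close> does not, which reverses the
  orientation: in the coordinate \<open>x\<close>, where the position is \<open>- e 0 * x\<close>,
  the shifted system is the model of \<open>- 1 / \<alpha>\<close> rather than of
  \<open>1 / \<alpha>\<close>.\<close>

lemma MM_inverse: "MM (- 1 / \<alpha>) = {polar_pt 1 x y | x y. 0 \<le> x \<and> x < 1 \<and> fib r e (- of_int (e 0) * x) y} \<union> {0}"
  and TT_inverse: "fib r e (- of_int (e 0) * x) y \<Longrightarrow>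
    TT (- 1 / \<alpha>) (polar_pt 1 x y) = polar_pt 1 (x - 1 / \<alpha>) (rot r e (- of_int (e 0) * x) y)"
proof -
  have i: "1 / \<alpha> \<notin> \<rat>" using inverse_cf_rem_irrational[OF irr, of 0] unfolding cf_rem_0 .
  then have i': "- 1 / \<alpha> \<notin> \<rat>" using irrational_minus[OF i] by simp
  have R: "cf_rem (- 1 / \<alpha>) = r"
    using cf_rem_minus[of "1 / \<alpha>"] cf_inverse(1)[OF \<alpha>] by (simp add: r_def)
  have S: "cf_sgn (- 1 / \<alpha>) = e(0 := - e 0)"
    using cf_sgn_minus[OF i] cf_inverse(2)[OF \<alpha>] by (simp add: e_def)
  have pt: "polar_pt (- e 0) (- of_int (e 0) * x) y = polar_pt 1 x y" for x y
    using shifted_sgn_cases by (auto simp: polar_pt_def)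
  have M: "MM (- 1 / \<alpha>) = {polar_pt (- e 0) u y | u y. fib r e u y} \<union> {0}"
    using MM_eq[OF i'] unfolding R S by simp
  show "MM (- 1 / \<alpha>) = {polar_pt 1 x y | x y. 0 \<le> x \<and> x < 1 \<and> fib r e (- of_int (e 0) * x) y} \<union> {0}"
  proof -
    have "\<exists>x. z = polar_pt 1 x y \<and> 0 \<le> x \<and> x < 1 \<and> fib r e (- of_int (e 0) * x) y"
      if z: "z = polar_pt (- e 0) u y" "fib r e u y" for z u y
    proof -
      define x where "x = frac (- of_int (e 0) * u)"
      have xu: "- of_int (e 0) * x = u + of_int (e 0 * \<lfloor>- of_int (e 0) * u\<rfloor>)"
        using shifted_sgn_cases by (auto simp: x_def frac_def)
      have "0 \<le> x" "x < 1" by (simp_all add: x_def frac_lt_1)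
      moreover have "fib r e (- of_int (e 0) * x) y" unfolding fib_cong[OF xu] by (rule z(2))
      moreover have "z = polar_pt 1 x y"
        unfolding z(1) pt[symmetric] by (rule polar_pt_cong[OF xu, symmetric])
      ultimately show ?thesis by blast
    qed
    then have "{polar_pt (- e 0) u y | u y. fib r e u y}
       = {polar_pt 1 x y | x y. 0 \<le> x \<and> x < 1 \<and> fib r e (- of_int (e 0) * x) y}"
      using pt[symmetric] by blast
    then show ?thesis unfolding M by simp
  qed
  show "TT (- 1 / \<alpha>) (polar_pt 1 x y) = polar_pt 1 (x - 1 / \<alpha>) (rot r e (- of_int (e 0) * x) y)"
    if f: "fib r e (- of_int (e 0) * x) y"
  proof -
    have "TT (- 1 / \<alpha>) (polar_pt 1 x y) = polar_pt (- e 0) (- of_int (e 0) * x + r 0) (rot r e (- of_int (e 0) * x) y)"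
      using TT_eq[OF i', unfolded R S, of "- of_int (e 0) * x" y] f pt[of x y] by simp
    also have "\<dots> = polar_pt 1 (x - of_int (e 0) * r 0) (rot r e (- of_int (e 0) * x) y)"
    proof -
      have "- of_int (e 0) * x + r 0 = - of_int (e 0) * (x - of_int (e 0) * r 0)"
        using shifted_sgn_cases by auto
      then show ?thesis by (simp only: pt)
    qed
    also have "\<dots> = polar_pt 1 (x - 1 / \<alpha>) (rot r e (- of_int (e 0) * x) y)"
    proof -
      have "1 / \<alpha> = of_int (cf_quot \<alpha> 0) + of_int (e 0) * r 0"
        using cf_quot[OF irr, of 0] unfolding cf_rem_0 by (simp add: e_def r_def sh_def)
      then show ?thesis by (subst polar_pt_eq_iff) (auto intro!: exI[of _ "- cf_quot \<alpha> 0"])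
    qed
    finally show ?thesis .
  qed
qed

text \<open>The number of steps enters the real part of the return as an integer and is lost under
  \<open>ex\<close>; what remains is the translation by \<open>- 1 / \<alpha>\<close>.\<close>

lemma return_map_eq: "return_map \<alpha> (model \<alpha>) = model (- 1 / \<alpha>)"
proof -
  define S where "S = sector \<alpha> (MM \<alpha>)"
  define h where "h w = phi \<alpha> ((TT \<alpha> ^^ return_time S (TT \<alpha>) (psi \<alpha> w)) (psi \<alpha> w))" for w
  have phiS: "phi \<alpha> ` S = {Complex x y | x y. 0 \<le> x \<and> x < 1 \<and> fib r e (- of_int (e 0) * x) y}"
  proof -
    have "phi \<alpha> (chart x y) = Complex x y" if "0 \<le> x" "x < 1" "fib r e (- of_int (e 0) * x) y" for x y
      using phi_chart that fib_gt[OF system_shift that(3)] by blast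
    then show ?thesis unfolding S_def sector_eq by (auto simp: image_def) metis+
  qed
  have exh: "ex (h (Complex x y)) = polar_pt 1 (x - 1 / \<alpha>) (rot r e (- of_int (e 0) * x) y)"
    if x: "0 \<le> x" "x < 1" "fib r e (- of_int (e 0) * x) y" for x y
  proof -
    have psi: "psi \<alpha> (Complex x y) = chart x y"
      using psi_eq_chart[of "Complex x y"] fib_gt[OF system_shift x(3)] by simp
    obtain n :: nat where n: "(TT \<alpha> ^^ return_time S (TT \<alpha>) (chart x y)) (chart x y)
       = chart (x + real n - 1 / \<alpha>) (rot r e (- of_int (e 0) * x) y)"
      "0 \<le> x + real n - 1 / \<alpha>" "x + real n - 1 / \<alpha> < 1"
      using first_return[OF x] unfolding S_def .
    have "-1 < rot r e (- of_int (e 0) * x) y"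
      by (rule fib_gt[OF system_shift fib_rot_iff[OF system_shift, THEN iffD2, OF x(3)]])
    then have "h (Complex x y) = Complex (x + real n - 1 / \<alpha>) (rot r e (- of_int (e 0) * x) y)"
      unfolding h_def psi n(1) using phi_chart n(2,3) by simp
    then show ?thesis
      unfolding ex_polar by simp (subst polar_pt_eq_iff, auto intro!: exI[of _ "- int n"])
  qed
  define D where "D = ex ` (phi \<alpha> ` S) \<union> {0}"
  have D: "D = MM (- 1 / \<alpha>)"
  proof -
    have "ex ` (phi \<alpha> ` S) = {ex (Complex x y) | x y. 0 \<le> x \<and> x < 1 \<and> fib r e (- of_int (e 0) * x) y}"
      unfolding phiS by blast
    then show ?thesis unfolding D_def MM_inverse by (simp add: ex_polar)
  qed
  have "return_map \<alpha> (model \<alpha>) = (D, restrict (\<lambda>z. if z = 0 then 0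
       else (THE z'. \<exists>w\<in>phi \<alpha> ` S. z = ex w \<and> z' = ex (h w))) D)"
    unfolding return_map_def model_def Let_def fst_conv snd_conv D_def S_def h_def ..
  also have "restrict (\<lambda>z. if z = 0 then 0
       else (THE z'. \<exists>w\<in>phi \<alpha> ` S. z = ex w \<and> z' = ex (h w))) D = TT (- 1 / \<alpha>)"
  proof
    fix z
    show "restrict (\<lambda>z. if z = 0 then 0
       else (THE z'. \<exists>w\<in>phi \<alpha> ` S. z = ex w \<and> z' = ex (h w))) D z = TT (- 1 / \<alpha>) z"
    proof (cases "z \<in> D \<and> z \<noteq> 0")
      case True
      then obtain x y where z: "z = polar_pt 1 x y" "0 \<le> x" "x < 1" "fib r e (- of_int (e 0) * x) y"
        unfolding D MM_inverse by blast
      have "(THE z'. \<exists>w\<in>phi \<alpha> ` S. z = ex w \<and> z' = ex (h w)) = TT (- 1 / \<alpha>) z"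
      proof (rule the_equality)
        have "Complex x y \<in> phi \<alpha> ` S" "z = ex (Complex x y)" unfolding phiS z(1) ex_polar using z by auto
        moreover have "TT (- 1 / \<alpha>) z = ex (h (Complex x y))"
          unfolding z(1) exh[OF z(2-4)] TT_inverse[OF z(4)] ..
        ultimately show "\<exists>w\<in>phi \<alpha> ` S. z = ex w \<and> TT (- 1 / \<alpha>) z = ex (h w)" by blast
      next
        fix z' assume "\<exists>w\<in>phi \<alpha> ` S. z = ex w \<and> z' = ex (h w)"
        then obtain x' y' where w: "0 \<le> x'" "x' < 1" "fib r e (- of_int (e 0) * x') y'"
          "z = ex (Complex x' y')" "z' = ex (h (Complex x' y'))"
          unfolding phiS by blast
        have "z = polar_pt 1 x' y'" using w(4) by (simp add: ex_polar)
        then show "z' = TT (- 1 / \<alpha>) z" unfolding w(5) exh[OF w(1-3)] using TT_inverse[OF w(3)] by simp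
      qed
      then show ?thesis using True by simp
    next
      case False
      then show ?thesis using D TT_outside TT_0 zero_in_MM by (cases "z = 0") (auto simp: restrict_def)
    qed
  qed
  finally show ?thesis unfolding D model_def .
qed

end

section \<open>From the return map to the operator on maps\<close>

lemma conj_map_model:
  assumes "\<alpha> \<notin> \<rat>"
  shows "conj_map (model \<alpha>) = model (- \<alpha>)"
proof -
  have "restrict (cnj \<circ> TT \<alpha> \<circ> cnj) (MM (- \<alpha>)) = TT (- \<alpha>)"
    using TT_minus[OF assms] TT_outside by (auto simp: restrict_def fun_eq_iff)
  then show ?thesis by (simp add: conj_map_def model_def MM_minus[OF assms])
qed

lemma TT_1_polar:
  assumes "\<alpha> \<notin> \<rat>"
  shows "TT \<alpha> 1 = of_real (cmod (TT \<alpha> 1)) * cis (2 * pi * \<alpha>)" "TT \<alpha> 1 \<noteq> 0"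
proof -
  obtain g where "\<forall>\<rho>\<ge>0. \<forall>\<theta>. of_real \<rho> * cis (2 * pi * \<theta>) \<in> MM \<alpha> \<longrightarrow>
      TT \<alpha> (of_real \<rho> * cis (2 * pi * \<theta>)) = of_real (g \<rho> \<theta>) * cis (2 * pi * (\<theta> + \<alpha>))"
    and g: "\<forall>\<rho> \<theta>. 0 \<le> g \<rho> \<theta>"
    using TT_tangential[OF assms] unfolding tangential_rotation_def by blast
  from this(1)[rule_format, of 1 0] one_in_MM[OF assms]
  have "TT \<alpha> 1 = of_real (g 1 0) * cis (2 * pi * \<alpha>)" by simp
  moreover from this have "cmod (TT \<alpha> 1) = g 1 0" using g by (simp add: norm_mult)
  ultimately show "TT \<alpha> 1 = of_real (cmod (TT \<alpha> 1)) * cis (2 * pi * \<alpha>)" by simp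
  show "TT \<alpha> 1 \<noteq> 0" by (rule TT_nonzero[OF assms one_in_MM[OF assms]]) simp
qed

text \<open>The argument of \<open>TT \<alpha> 1\<close> recovers \<alpha> modulo 1; hence the
  description operator in \<open>Rm\<close> finds the parameter from the map.\<close>

lemma model_inj:
  assumes "\<alpha> \<notin> \<rat>" "-1/2 < \<alpha>" "\<alpha> < 1/2" "\<beta> \<notin> \<rat>" "-1/2 < \<beta>" "\<beta> < 1/2" "model \<alpha> = model \<beta>"
  shows "\<alpha> = \<beta>"
proof -
  have "TT \<alpha> 1 = TT \<beta> 1" using assms(7) by (simp add: model_def)
  then have "cis (2 * pi * \<alpha>) = cis (2 * pi * \<beta>)"
    using TT_1_polar[OF assms(1)] TT_1_polar[OF assms(4)] by (metis mult_cancel_left of_real_eq_0_iff norm_eq_zero)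
  then obtain n :: int where "2 * pi * \<beta> = 2 * pi * \<alpha> + 2 * pi * of_int n" unfolding cis_eq_cis_iff by blast
  then have "2 * pi * \<beta> = 2 * pi * (\<alpha> + of_int n)" by (simp add: distrib_left)
  then have "\<beta> = \<alpha> + of_int n" by simp
  moreover from this have "n = 0" using assms by linarith
  ultimately show ?thesis by simp
qed

lemma Rm_model:
  assumes irr: "\<alpha> \<notin> \<rat>" and \<alpha>: "-1/2 < \<alpha>" "\<alpha> < 1/2"
  shows "Rm (model \<alpha>) = model (- 1 / \<alpha>)"
proof -
  have "(THE \<beta>. \<beta> \<notin> \<rat> \<and> -1/2 < \<beta> \<and> \<beta> < 1/2 \<and> model \<beta> = model \<alpha>) = \<alpha>"
    by (rule the_equality) (use assms model_inj in auto)
  then have R: "Rm (model \<alpha>) = (if \<alpha> > 0 then return_map \<alpha> (model \<alpha>)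
      else conj_map (return_map (- \<alpha>) (model (- \<alpha>))))"
    unfolding Rm_def Let_def by simp
  show ?thesis
  proof (cases "\<alpha> > 0")
    case True
    then show ?thesis unfolding R using return_map_eq[OF irr] \<alpha> by simp
  next
    case False
    have "\<alpha> \<noteq> 0" using irr by auto
    then have a: "0 < - \<alpha>" "- \<alpha> < 1/2" using False \<alpha> by auto
    have i: "- 1 / - \<alpha> \<notin> \<rat>"
    proof -
      have "- 1 / - \<alpha> = 1 / \<alpha>" by simp
      moreover have "1 / \<alpha> \<notin> \<rat>" using irr by (metis Rats_1 Rats_divide divide_divide_eq_right div_by_1 mult_1)
      ultimately show ?thesis by simp
    qed
    have "conj_map (return_map (- \<alpha>) (model (- \<alpha>))) = model (- (- 1 / - \<alpha>))"
      unfolding return_map_eq[OF irrational_minus[OF irr] a] conj_map_model[OF i] ..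
    then show ?thesis unfolding R using False by simp
  qed
qed

lemma model_plus_int:
  assumes "\<alpha> \<notin> \<rat>"
  shows "model (\<alpha> + of_int k) = model \<alpha>"
proof -
  have i: "\<alpha> + of_int k \<notin> \<rat>" for k
    using assms by (metis Rats_diff Rats_of_int add_diff_cancel_right')
  have s: "model (\<beta> + 1) = model \<beta>" if "\<beta> \<notin> \<rat>" for \<beta>
    using that by (simp add: model_def MM_plus_one TT_plus_one)
  show ?thesis
  proof (induction k rule: int_induct[where k = 0])
    case (step1 k)
    then show ?case using s[OF i[of k]] by (simp add: add.assoc)
  next
    case (step2 k)
    then show ?case using s[OF i[of "k - 1"]] by simp
  qed simp
qed

lemma Rm_closed: "Rm \<in> model_class \<rightarrow> model_class"
proof
  fix F assume "F \<in> model_class"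
  then obtain \<beta> where \<beta>: "F = model \<beta>" "\<beta> \<notin> \<rat>" by (auto simp: model_class_def)
  define \<alpha> where "\<alpha> = \<beta> + of_int (- near_int \<beta>)"
  have "\<alpha> = of_int (near_sgn \<beta>) * infdist \<beta> \<int>" using near_decomp[OF \<beta>(2)] by (simp add: \<alpha>_def)
  then have \<alpha>: "-1/2 < \<alpha>" "\<alpha> < 1/2" using irrational_infdist[OF \<beta>(2)] near_sgn_cases[OF \<beta>(2)] by auto
  have irr: "\<alpha> \<notin> \<rat>"
    unfolding \<alpha>_def using \<beta>(2) by (metis Rats_diff Rats_of_int add_diff_cancel_right')
  have "F = model \<alpha>" unfolding \<beta>(1) \<alpha>_def model_plus_int[OF \<beta>(2)] ..
  then have "Rm F = model (- 1 / \<alpha>)" using Rm_model[OF irr \<alpha>] by simp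
  moreover have "- 1 / \<alpha> \<notin> \<rat>"
    using irr by (metis Rats_minus_iff Rats_1 Rats_divide divide_divide_eq_right div_by_1 mult_1 minus_divide_left)
  ultimately show "Rm F \<in> model_class" by (auto simp: model_class_def)
qed

section \<open>Size of the orbit of 1\<close>

lemma exp_hgt:
  assumes "0 < r" "r \<le> 1/2"
  shows "(exp (- (2 * pi * hgt r x 0)))\<^sup>2 = numer r 0 0 / numer r x 0"
proof -
  have p: "0 < numer r 0 0" "0 < numer r x 0" using numer_pos[OF assms] by auto
  have "(exp (- (2 * pi * hgt r x 0)))\<^sup>2 = exp (- (4 * pi * hgt r x 0))"
    by (simp flip: exp_double)
  also have "- (4 * pi * hgt r x 0) = ln (numer r 0 0) - ln (numer r x 0)"
    by (simp add: hgt_def hgt0_def)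
  also have "exp (ln (numer r 0 0) - ln (numer r x 0)) = numer r 0 0 / numer r x 0"
    using p by (simp add: exp_diff)
  finally show ?thesis .
qed

text \<open>As \<open>x \<le> 2\<close> on this range, the cubic remainder \<open>x ^ 3 / 6\<close>
  is at most \<open>2/3 * x\<close>.\<close>

lemma sin_ge_third:
  fixes x :: real
  assumes "0 \<le> x" "x \<le> pi/2"
  shows "x / 3 \<le> sin x"
proof -
  have "(\<Sum>m<3. sin_coeff m * x ^ m) = x"
    by (simp add: eval_nat_numeral sin_coeff_def)
  then have "\<bar>sin x - x\<bar> \<le> inverse (fact 3) * \<bar>x\<bar> ^ 3"
    using Maclaurin_sin_bound[of x 3] by (simp only:)
  then have "\<bar>sin x - x\<bar> \<le> x ^ 3 / 6" using assms by (simp add: fact_numeral)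
  moreover have "x ^ 3 \<le> 4 * x"
  proof -
    have "x\<^sup>2 \<le> 2\<^sup>2" using assms pi_less_4 by (intro power_mono) auto
    then have "x * x\<^sup>2 \<le> x * 4" using assms by (intro mult_left_mono) auto
    then show ?thesis by (simp add: power3_eq_cube power2_eq_square)
  qed
  ultimately show ?thesis by linarith
qed

text \<open>\<open>numer\<close> is \<open>(1 - q)\<^sup>2 + 4 * q * (sin \<psi>)\<^sup>2\<close>.
  The first term is of order \<open>r\<^sup>2\<close>, the second of order \<open>r\<^sup>2\<close>
  times the squared distance of \<open>k\<close> from the ends of \<open>[0, 1 / r]\<close>, up to
  an offset \<open>1/2\<close>. \<open>729 = 3^6\<close> bounds \<open>exp 6\<close>, and
  \<open>3 * pi * r \<le> 6\<close>.\<close>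

lemma numer_int_bounds:
  assumes r: "0 < r" "r \<le> 1/2" and k: "real k \<le> 1 / r"
  defines "D \<equiv> min (real k) (1 / r - real k)"
  shows "numer r (real k) 0 \<le> 160 * r\<^sup>2 * (1 + D)\<^sup>2" "r\<^sup>2 * (1 + D)\<^sup>2 / 729 \<le> numer r (real k) 0"
proof -
  define q where "q = exp (- 3 * pi * r)"
  define \<psi> where "\<psi> = pi * r * (real k + 1/2)"
  have D: "0 \<le> D" using k by (simp add: D_def)
  have q: "0 < q" "q \<le> 1" using r by (auto simp: q_def)
  have q1: "1 - q \<le> 3 * pi * r" using exp_ge_add_one_self[of "- 3 * pi * r"] by (simp add: q_def)
  have q2: "3/2 * r \<le> 1 - q" using exp_gap[of r 0] r by (simp add: q_def)
  have q3: "1/729 \<le> q"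
  proof -
    have "exp (1::real) ^ 6 \<le> 3 ^ 6" using exp_le by (intro power_mono) auto
    then have "exp (6::real) \<le> 729" by (simp flip: exp_of_nat_mult)
    then have "1/729 \<le> exp (- 6 :: real)" by (simp add: exp_minus field_simps)
    also have "\<dots> \<le> q"
    proof -
      have "pi * r \<le> 4 * (1/2)" using pi_less_4 r by (intro mult_mono) auto
      then show ?thesis by (simp add: q_def)
    qed
    finally show ?thesis .
  qed
  have N: "numer r (real k) 0 = (1 - q)\<^sup>2 + 4 * q * (sin \<psi>)\<^sup>2"
  proof -
    have "cos (pi * r * (2 * real k + 1)) = 1 - 2 * (sin \<psi>)\<^sup>2"
      using cos_double_sin[of \<psi>] by (simp add: \<psi>_def algebra_simps)
    then show ?thesis
      unfolding numer_def q_def[symmetric] by (simp only:) (simp add: power2_eq_square algebra_simps)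
  qed
  have refl: "\<bar>sin \<psi>\<bar> = \<bar>sin (pi * r * (1 / r - real k - 1/2))\<bar>"
  proof -
    have "pi * r * (1 / r - real k - 1/2) = pi - \<psi>" using r by (simp add: \<psi>_def field_simps)
    then show ?thesis by simp
  qed
  have "\<bar>sin \<psi>\<bar> \<le> pi * r * (D + 1/2)"
  proof (cases "real k \<le> 1 / r - real k")
    case True
    have "\<bar>sin \<psi>\<bar> \<le> \<bar>\<psi>\<bar>" by (rule abs_sin_x_le_abs_x)
    also have "\<dots> = pi * r * (D + 1/2)" using True r by (simp add: \<psi>_def D_def)
    finally show ?thesis .
  next
    case False
    have "\<bar>sin \<psi>\<bar> \<le> \<bar>pi * r * (1 / r - real k - 1/2)\<bar>" unfolding refl by (rule abs_sin_x_le_abs_x)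
    also have "\<dots> = pi * r * \<bar>D - 1/2\<bar>" using False r by (simp add: D_def abs_mult)
    also have "\<dots> \<le> pi * r * (D + 1/2)" using D r by (intro mult_left_mono) auto
    finally show ?thesis .
  qed
  then have "\<bar>sin \<psi>\<bar>\<^sup>2 \<le> (pi * r * (D + 1/2))\<^sup>2" by (intro power_mono) auto
  then have "4 * q * (sin \<psi>)\<^sup>2 \<le> 4 * 1 * (pi * r * (D + 1/2))\<^sup>2"
    using q by (intro mult_mono) auto
  moreover have "(1 - q)\<^sup>2 \<le> (3 * pi * r)\<^sup>2" using q q1 by (intro power_mono) auto
  moreover have "(3 * pi * r)\<^sup>2 + 4 * 1 * (pi * r * (D + 1/2))\<^sup>2 = (pi * r)\<^sup>2 * (9 + 4 * (D + 1/2)\<^sup>2)"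
    by (simp add: power2_eq_square field_simps)
  ultimately have "numer r (real k) 0 \<le> (pi * r)\<^sup>2 * (9 + 4 * (D + 1/2)\<^sup>2)"
    unfolding N by (metis add_mono)
  also have "\<dots> \<le> (4 * r)\<^sup>2 * (10 * (1 + D)\<^sup>2)"
  proof (rule mult_mono)
    show "(pi * r)\<^sup>2 \<le> (4 * r)\<^sup>2" using pi_less_4 r by (intro power_mono mult_right_mono) auto
    show "9 + 4 * (D + 1/2)\<^sup>2 \<le> 10 * (1 + D)\<^sup>2" using D by (simp add: power2_eq_square algebra_simps)
  qed auto
  finally show "numer r (real k) 0 \<le> 160 * r\<^sup>2 * (1 + D)\<^sup>2" by (simp add: power_mult_distrib)
  show "r\<^sup>2 * (1 + D)\<^sup>2 / 729 \<le> numer r (real k) 0"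
  \<comment> \<open>For small \<open>D\<close> the first term alone suffices; for
    \<open>D > 2\<close> the offset \<open>1/2\<close> is absorbed by passing from \<open>D\<close>
    to \<open>3/4 * D\<close>.\<close>
  proof (cases "D \<le> 2")
    case True
    have aux: "a / 729 \<le> b" if "a \<le> c * 9" "9/4 * c \<le> b" "0 \<le> b" for a b c :: real
      using that by linarith
    have "(1 + D)\<^sup>2 \<le> 3\<^sup>2" using D True by (intro power_mono) auto
    then have 1: "r\<^sup>2 * (1 + D)\<^sup>2 \<le> r\<^sup>2 * 9" by (intro mult_left_mono) auto
    have "(3/2 * r)\<^sup>2 \<le> (1 - q)\<^sup>2" using q2 r by (intro power_mono) auto
    moreover have "(3/2 * r)\<^sup>2 = 9/4 * r\<^sup>2" by (simp add: power2_eq_square)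
    ultimately have 2: "9/4 * r\<^sup>2 \<le> (1 - q)\<^sup>2" by simp
    have "r\<^sup>2 * (1 + D)\<^sup>2 / 729 \<le> (1 - q)\<^sup>2" by (rule aux[OF 1 2]) simp
    also have "\<dots> \<le> numer r (real k) 0" unfolding N using q by simp
    finally show ?thesis .
  next
    case False
    have Dk: "D \<le> real k" "D \<le> 1 / r - real k" by (auto simp: D_def)
    have rr: "r * (1 / r) = 1" using r by simp
    define t where "t = r * (real k + 1/2)"
    have m: "\<bar>sin \<psi>\<bar> = \<bar>sin (pi * t)\<bar>" "\<bar>sin \<psi>\<bar> = \<bar>sin (pi * (1 - t))\<bar>"
    proof -
      show *: "\<bar>sin \<psi>\<bar> = \<bar>sin (pi * t)\<bar>" by (simp add: \<psi>_def t_def mult.assoc)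
      have "pi * (1 - t) = pi - pi * t" by (simp add: right_diff_distrib)
      then show "\<bar>sin \<psi>\<bar> = \<bar>sin (pi * (1 - t))\<bar>" unfolding * by (simp only: sin_pi_minus)
    qed
    have t1: "3/4 * (r * D) \<le> t"
    proof -
      have "r * (3/4 * D) \<le> r * (real k + 1/2)" using r Dk D by (intro mult_left_mono) auto
      then show ?thesis by (simp add: t_def)
    qed
    have t2: "3/4 * (r * D) \<le> 1 - t"
    proof -
      have "r * (3/4 * D) \<le> r * (1 / r - real k - 1/2)" using r Dk False by (intro mult_left_mono) auto
      also have "\<dots> = 1 - t" unfolding t_def using rr by (simp add: algebra_simps)
      finally show ?thesis by simp
    qed
    have rD: "0 \<le> r * D" using r D by simp
    have "3/4 * (r * D) \<le> \<bar>sin \<psi>\<bar>"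
    proof -
      have aux: "3/4 * (r * D) \<le> \<bar>sin (pi * s)\<bar>" if s: "3/4 * (r * D) \<le> s" "s \<le> 1/2" for s
      proof -
        have s0: "0 \<le> s" using s rD by linarith
        have "s \<le> pi * s / 3" using s0 pi_gt3 mult_right_mono[of 3 pi s] by simp
        also have "\<dots> \<le> sin (pi * s)" using s s0 mult_left_mono[of s "1/2" pi] by (intro sin_ge_third) auto
        finally show ?thesis using s by linarith
      qed
      show ?thesis
      proof (cases "t \<le> 1/2")
        case True
        then show ?thesis unfolding m(1) by (rule aux[OF t1])
      next
        case False
        then have "1 - t \<le> 1/2" by simp
        then show ?thesis unfolding m(2) by (rule aux[OF t2])
      qed
    qed
    then have "(3/4 * (r * D))\<^sup>2 \<le> \<bar>sin \<psi>\<bar>\<^sup>2" using rD by (intro power_mono) auto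
    then have "4 * (1/729) * (3/4 * (r * D))\<^sup>2 \<le> 4 * q * (sin \<psi>)\<^sup>2"
      using q3 by (intro mult_mono) auto
    moreover have "r\<^sup>2 * (1 + D)\<^sup>2 / 729 \<le> 4 * (1/729) * (3/4 * (r * D))\<^sup>2"
    proof -
      have "(1 + D)\<^sup>2 \<le> (3/2 * D)\<^sup>2" using False by (intro power_mono) auto
      then have "r\<^sup>2 * (1 + D)\<^sup>2 \<le> r\<^sup>2 * (9/4 * D\<^sup>2)" by (intro mult_left_mono) (auto simp: power_mult_distrib power2_eq_square)
      moreover have "4 * (1/729) * (3/4 * (r * D))\<^sup>2 = (r\<^sup>2 * (9/4 * D\<^sup>2)) / 729"
        by (simp add: power2_eq_square)
      ultimately show ?thesis by (simp only: divide_right_mono zero_le_numeral)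
    qed
    moreover have "4 * q * (sin \<psi>)\<^sup>2 \<le> numer r (real k) 0" unfolding N by simp
    ultimately show ?thesis by linarith
  qed
qed

text \<open>The powers of \<open>r\<close> in the quotient of two values of \<open>numer\<close>
  cancel; \<open>400\<close> comes from \<open>160 * 729 \<le> 400\<^sup>2\<close>.\<close>

lemma exp_hgt_bounds:
  assumes r: "0 < r" "r \<le> 1/2" and k: "real k \<le> 1 / r"
  defines "D \<equiv> min (real k) (1 / r - real k)"
  shows "1 / (400 * (1 + D)) \<le> exp (- (2 * pi * hgt r (real k) 0))"
    "exp (- (2 * pi * hgt r (real k) 0)) \<le> 400 / (1 + D)"
proof -
  define E where "E = exp (- (2 * pi * hgt r (real k) 0))"
  have D: "0 \<le> D" using k by (simp add: D_def)
  note n = numer_int_bounds[OF r k, folded D_def]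
  have p: "0 < numer r (real k) 0" using numer_pos[OF r] by simp
  have E: "E\<^sup>2 * numer r (real k) 0 = numer r 0 0"
    unfolding E_def exp_hgt[OF r] using p by simp
  have n0: "numer r 0 0 \<le> 160 * r\<^sup>2" "r\<^sup>2 / 729 \<le> numer r 0 0"
    using numer_int_bounds[OF r, of 0] r by auto
  have low: "9/4 * r\<^sup>2 \<le> numer r 0 0"
  proof -
    have "3/2 * r \<le> 1 - exp (- 3 * pi * r)" using exp_gap[of r 0] r by simp
    then have "(3/2 * r)\<^sup>2 \<le> (1 - exp (- 3 * pi * r))\<^sup>2" using r by (intro power_mono) auto
    also have "\<dots> \<le> numer r 0 0" using numer_lower[of r 0 0] by simp
    finally show ?thesis by (simp add: power_mult_distrib power2_eq_square)
  qed
  have r2: "0 < r\<^sup>2" using r by simp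
  have "E\<^sup>2 * (r\<^sup>2 * (1 + D)\<^sup>2 / 729) \<le> 160 * r\<^sup>2"
    using mult_left_mono[OF n(2), of "E\<^sup>2"] E n0(1) by simp
  then have "r\<^sup>2 * (E * (1 + D))\<^sup>2 \<le> r\<^sup>2 * (160 * 729)" by (simp add: power_mult_distrib mult_ac)
  then have "(E * (1 + D))\<^sup>2 \<le> 400\<^sup>2" using r2 by (simp only: mult_le_cancel_left_pos) simp
  then have "E * (1 + D) \<le> 400" by (rule power2_le_imp_le) simp
  then show "exp (- (2 * pi * hgt r (real k) 0)) \<le> 400 / (1 + D)"
    using D unfolding E_def[symmetric] by (simp add: field_simps)
  have "9/4 * r\<^sup>2 \<le> E\<^sup>2 * (160 * r\<^sup>2 * (1 + D)\<^sup>2)"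
    using mult_left_mono[OF n(1), of "E\<^sup>2"] E low by simp
  then have "r\<^sup>2 * (9/4) \<le> r\<^sup>2 * (160 * (E * (1 + D))\<^sup>2)" by (simp add: power_mult_distrib mult_ac)
  then have "9/4 \<le> 160 * (E * (1 + D))\<^sup>2" using r2 by (simp only: mult_le_cancel_left_pos)
  then have "(1/400)\<^sup>2 \<le> (E * (1 + D))\<^sup>2" by (simp add: power2_eq_square)
  then have "1/400 \<le> E * (1 + D)" by (rule power2_le_imp_le) (use D in \<open>simp add: E_def\<close>)
  then show "1 / (400 * (1 + D)) \<le> exp (- (2 * pi * hgt r (real k) 0))"
    using D unfolding E_def[symmetric] by (simp add: field_simps)
qed

text \<open>Before an overflow the orbit of 1 involves only the first vertical map, so its heights
  are explicit.\<close>

lemma TT_power_one: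
  assumes irr: "\<alpha> \<notin> \<rat>" and k: "real k \<le> 1 / cf_rem \<alpha> 0"
  shows "cmod ((TT \<alpha> ^^ k) 1) = exp (- (2 * pi * hgt (cf_rem \<alpha> 0) (real k) 0))"
proof -
  have "fib (cf_rem \<alpha>) (cf_sgn \<alpha>) (cf_rem \<alpha> 0 * 0) (hgt (cf_rem \<alpha> 0) 0 0)"
    using fib_0[OF cf_system_cf[OF irr]] by simp
  moreover have "polar_pt (cf_sgn \<alpha> 0) (cf_rem \<alpha> 0 * 0) (hgt (cf_rem \<alpha> 0) 0 0) = 1"
    by (simp add: polar_pt_def)
  ultimately show ?thesis
    using TT_power_small[OF irr, of 0 k 0] k by (simp del: cf_rem.simps cf_sgn.simps)
qed

lemma orbit_of_one_bounds:
  fixes \<alpha> :: real and k :: nat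
  assumes irr: "\<alpha> \<notin> \<rat>" and k: "real k \<le> 1 / \<bar>\<alpha>\<bar>"
  defines "C \<equiv> 400 + 2 * exp (4 * pi)" and "D \<equiv> min (real k) (1 / \<bar>\<alpha>\<bar> - real k)"
  shows "inverse C / (1 + D) \<le> cmod ((TT \<alpha> ^^ k) 1)" "cmod ((TT \<alpha> ^^ k) 1) \<le> C / (1 + D)"
proof -
  have a0: "\<alpha> \<noteq> 0" using irr by auto
  have D: "0 \<le> D" using k by (simp add: D_def)
  have e: "0 < exp (4 * pi)" by simp
  then have C: "400 \<le> C" "2 * exp (4 * pi) \<le> C" by (simp_all add: C_def)
  note r = cf_rem_bounds[OF irr, of 0]
  have "inverse C / (1 + D) \<le> cmod ((TT \<alpha> ^^ k) 1) \<and> cmod ((TT \<alpha> ^^ k) 1) \<le> C / (1 + D)"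
  proof (cases "\<bar>\<alpha>\<bar> \<le> 1/2")
    case True
    have r0: "cf_rem \<alpha> 0 = \<bar>\<alpha>\<bar>" by (rule cf_rem_0_small[OF True])
    have "0 < \<bar>\<alpha>\<bar>" using a0 by simp
    note b = exp_hgt_bounds[OF this True k, folded D_def]
    have "cmod ((TT \<alpha> ^^ k) 1) = exp (- (2 * pi * hgt \<bar>\<alpha>\<bar> (real k) 0))"
      using TT_power_one[OF irr, of k] k unfolding r0 by simp
    moreover have "inverse C / (1 + D) \<le> 1 / (400 * (1 + D))"
    proof -
      have "inverse C / (1 + D) = 1 / (C * (1 + D))" by (simp add: divide_inverse)
      also have "\<dots> \<le> 1 / (400 * (1 + D))"
        using C D by (intro divide_left_mono mult_right_mono mult_pos_pos) auto
      finally show ?thesis .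
    qed
    moreover have "400 / (1 + D) \<le> C / (1 + D)" using C D by (intro divide_right_mono) auto
    ultimately show ?thesis using b by simp
  next
    case False
    \<comment> \<open>Beyond \<open>1/2\<close> the first remainder is not
      \<open>\<bar>\<alpha>\<bar>\<close>, but only \<open>k \<le> 1\<close> is left. Heights
      bounded by \<open>2\<close> then suffice, and the summand \<open>2 * exp (4 * pi)\<close> of
      \<open>C\<close> allows for \<open>1 + D \<le> 2\<close>.\<close>
    then have "1 / \<bar>\<alpha>\<bar> < 2" using a0 by (simp add: field_simps)
    then have "real k < 2" using k by simp
    then have k1: "k = 0 \<or> k = 1" by auto
    have "D \<le> real k" by (simp add: D_def)
    then have D1: "D \<le> 1" using k1 by auto
    have h: "- (4 * pi) \<le> - (2 * pi * hgt (cf_rem \<alpha> 0) (real k) 0) \<and> - (2 * pi * hgt (cf_rem \<alpha> 0) (real k) 0) \<le> 4 * pi"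
    proof -
      have "\<bar>hgt (cf_rem \<alpha> 0) (real k) 0 - hgt (cf_rem \<alpha> 0) 0 0\<bar> \<le> 2/3 * \<bar>real k - 0\<bar>"
        using r by (intro hgt_lipschitz_x) auto
      then have "\<bar>hgt (cf_rem \<alpha> 0) (real k) 0\<bar> \<le> 2" using k1 by auto
      then have "2 * pi * \<bar>hgt (cf_rem \<alpha> 0) (real k) 0\<bar> \<le> 2 * pi * 2" by (intro mult_left_mono) auto
      moreover have "\<bar>2 * pi * hgt (cf_rem \<alpha> 0) (real k) 0\<bar> = 2 * pi * \<bar>hgt (cf_rem \<alpha> 0) (real k) 0\<bar>"
        by (simp add: abs_mult)
      ultimately show ?thesis by linarith
    qed
    have "1 \<le> 1 / cf_rem \<alpha> 0" using r by (simp add: field_simps)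
    moreover have "real k \<le> 1" using k1 by auto
    ultimately have "real k \<le> 1 / cf_rem \<alpha> 0" by linarith
    then have T: "cmod ((TT \<alpha> ^^ k) 1) = exp (- (2 * pi * hgt (cf_rem \<alpha> 0) (real k) 0))"
      by (rule TT_power_one[OF irr])
    have "cmod ((TT \<alpha> ^^ k) 1) \<le> exp (4 * pi)" "exp (- (4 * pi)) \<le> cmod ((TT \<alpha> ^^ k) 1)"
      unfolding T using h by simp_all
    moreover have "inverse C / (1 + D) \<le> exp (- (4 * pi))"
    proof -
      have "inverse C / (1 + D) \<le> inverse C / 1" using C D by (intro divide_left_mono) auto
      also have "\<dots> \<le> inverse (exp (4 * pi))" using C e by (simp add: le_imp_inverse_le)
      finally show ?thesis by (simp add: exp_minus)
    qed
    moreover have "exp (4 * pi) \<le> C / (1 + D)"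
    proof -
      have "exp (4 * pi) * (1 + D) \<le> exp (4 * pi) * 2" using D1 by (intro mult_left_mono) auto
      then have "exp (4 * pi) * (1 + D) \<le> C" using C(2) by linarith
      then show ?thesis using D by (simp add: pos_le_divide_eq)
    qed
    ultimately show ?thesis by linarith
  qed
  then show "inverse C / (1 + D) \<le> cmod ((TT \<alpha> ^^ k) 1)" "cmod ((TT \<alpha> ^^ k) 1) \<le> C / (1 + D)" by auto
qed

theorem theoremA:
  shows "Rm \<in> model_class \<rightarrow> model_class
    \<and> (\<forall>\<alpha>. \<alpha> \<notin> \<rat> \<longrightarrow> compact (MM \<alpha>) \<and> starlike_about_0 (MM \<alpha>) \<and> {0, 1} \<subseteq> MM \<alpha>)
    \<and> (\<forall>\<alpha>. \<alpha> \<notin> \<rat> \<longrightarrow>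
          (\<exists>g. homeomorphism (MM \<alpha>) (MM \<alpha>) (TT \<alpha>) g) \<and> tangential_rotation \<alpha> (MM \<alpha>) (TT \<alpha>))
    \<and> (\<forall>\<alpha>. \<alpha> \<notin> \<rat> \<and> -1/2 < \<alpha> \<and> \<alpha> < 1/2 \<longrightarrow> Rm (model \<alpha>) = model (- 1 / \<alpha>))
    \<and> (\<exists>C::real. \<forall>\<alpha>. \<alpha> \<notin> \<rat> \<longrightarrow> (\<forall>k::nat. real k \<le> 1 / \<bar>\<alpha>\<bar> \<longrightarrow>
          inverse C / (1 + min (real k) (1 / \<bar>\<alpha>\<bar> - real k)) \<le> cmod ((TT \<alpha> ^^ k) 1)
        \<and> cmod ((TT \<alpha> ^^ k) 1) \<le> C / (1 + min (real k) (1 / \<bar>\<alpha>\<bar> - real k))))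
    \<and> (\<forall>\<alpha>. \<alpha> \<notin> \<rat> \<longrightarrow>
          MM (\<alpha> + 1) = MM \<alpha> \<and> TT (\<alpha> + 1) = TT \<alpha>
        \<and> MM (- \<alpha>) = cnj ` MM \<alpha> \<and> (\<forall>z\<in>MM (- \<alpha>). TT (- \<alpha>) z = cnj (TT \<alpha> (cnj z))))
    \<and> (\<forall>\<alpha>. \<alpha> \<notin> \<rat> \<longrightarrow>
          ((\<lambda>\<beta>. hausdorff_distance (MM \<beta>) (MM \<alpha>)) \<longlongrightarrow> 0) (at \<alpha> within - \<rat>))"
proof (intro conjI)
  show "\<exists>C::real. \<forall>\<alpha>. \<alpha> \<notin> \<rat> \<longrightarrow> (\<forall>k::nat. real k \<le> 1 / \<bar>\<alpha>\<bar> \<longrightarrow>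
          inverse C / (1 + min (real k) (1 / \<bar>\<alpha>\<bar> - real k)) \<le> cmod ((TT \<alpha> ^^ k) 1)
        \<and> cmod ((TT \<alpha> ^^ k) 1) \<le> C / (1 + min (real k) (1 / \<bar>\<alpha>\<bar> - real k)))"
    using orbit_of_one_bounds by blast
qed (use Rm_closed compact_MM starlike_MM zero_in_MM one_in_MM TT_homeomorphism TT_tangential Rm_model
    MM_plus_one TT_plus_one MM_minus TT_minus MM_hausdorff_continuous in auto)

end
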